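(* Let $M>0$. For every sufficiently large constant $\kappa_0$ (depending only on $M$) in the definition of the distance functional $J$, the following holds. For $\bar u\in\mathcal{X}$ with $\|\bar u_x\|_{L^2(\mathbb{R})}\le M$, let $t\mapsto u(t)=u(t,\cdot)\in\mathcal{X}$, $t\ge0$, be the trajectory of $$u_t+\Big(\frac{u^2}{2}\Big)_x=\frac14\Big(\int_{-\infty}^x-\int_x^\infty\Big)u_x^2\,dx,\qquad u(0,x)=\bar u(x),$$ given by the explicit construction recalled in the context. Then $t\mapsto u(t)$ is locally Lipschitz continuous as a map from $[0,\infty)$ into $\mathcal{X}$ equipped with the distance functional $J$; that is, for every $T>0$ there is $L\ge0$ such that $J(u(t),u(s))\le L|t-s|$ for all $s,t\in[0,T]$. Moreover, for any two such trajectories $t\mapsto u(t)$ and $t\mapsto v(t)$, with initial data $\bar u,\bar v\in\mathcal{X}$ satisfying $\|\bar u_x\|_{L^2(\mathbb{R})}\le M$ and $\|\bar v_x\|_{L^2(\mathbb{R})}\le M$, the distance $t\mapsto J(u(t),v(t))$ is also locally Lipschitz continuous on $[0,\infty)$.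
   Context: The space $\mathcal{X}$ is the set of bounded continuous functions $f:\mathbb{R}\to\mathbb{R}$ with distributional derivative $f_x\in L^2(\mathbb{R})$. Constructed trajectory: given $\bar u\in\mathcal{X}$, for $y\in\mathbb{R}$ set $$\varphi(t,y)=\frac14\int_{\{x:\ \bar u_x(x)>-2/t\}}\operatorname{sign}(y-x)\,\bar u_x^2(x)\,dx\ (t>0),\qquad \varphi(0,y)=\frac14\int_{\mathbb{R}}\operatorname{sign}(y-x)\,\bar u_x^2(x)\,dx,$$ $$\xi(t,y)=y+t\,\bar u(y)+\int_0^t(t-s)\,\varphi(s,y)\,ds,\qquad u\big(t,\xi(t,y)\big)=\bar u(y)+\int_0^t\varphi(s,y)\,ds .$$ For every $t\ge 0$ the map $y\mapsto\xi(t,y)$ is nondecreasing, continuous and onto $\mathbb{R}$, the last formula defines $u(t,\cdot)$ unambiguously on $\mathbb{R}$, and $u(t,\cdot)\in\mathcal{X}$. Distance on the auxiliary space: for a constant $\kappa_0>0$, let $X=\big(\mathbb{R}^2\times(-\pi/2,\pi/2]\big)\cup\{\infty\}$ with $$d\big((x,u,w),(\tilde x,\tilde u,\tilde w)\big)=\min\Big\{|x-\tilde x|+|u-\tilde u|+\kappa_0|w-\tilde w|,\ \kappa_0\big|\tfrac{\pi}{2}+w\big|+\kappa_0\big|\tfrac{\pi}{2}+\tilde w\big|\Big\},\qquad d\big((x,u,w),\infty\big)=\kappa_0\big|\tfrac{\pi}{2}+w\big|.$$ Distance functional: let $\mathcal{F}$ be the family of triples $(\psi,\phi_1,\phi_2)$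 where $\phi_1,\phi_2:\mathbb{R}\to[0,1]$ are simple Borel measurable maps (finite range, Borel preimages of points) and $\psi:\mathbb{R}\to\mathbb{R}$ is a nondecreasing absolutely continuous surjective map. For $u,v\in\mathcal{X}$, a triple in $\mathcal{F}$ is admissible if $$\phi_1(x)\,u_x^2(x)=\psi'(x)\,\phi_2(\psi(x))\,v_x^2(\psi(x))\quad\text{for a.e. }x\in\mathbb{R}.$$ With $P(x)=(x,u(x),\arctan u_x(x))$ and $Q(x)=(\psi(x),v(\psi(x)),\arctan v_x(\psi(x)))$, its cost is $$J^{(\psi,\phi_1,\phi_2)}(u,v)=\int_{\mathbb{R}} d(P(x),Q(x))\,\phi_1(x)u_x^2(x)\,dx+\int_{\mathbb{R}} d(P(x),\infty)\,(1-\phi_1(x))u_x^2(x)\,dx+\int_{\mathbb{R}} d(Q(x),\infty)\,(1-\phi_2(\psi(x)))\,v_x^2(\psi(x))\,\psi'(x)\,dx,$$ and $J(u,v)=\inf J^{(\psi,\phi_1,\phi_2)}(u,v)$ over all admissible triples. *)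

theory Defs
  imports "HOL-Analysis.Analysis"
begin

section \<open>The space of bounded continuous functions with square integrable derivative\<close>

definition test_function :: "(real \<Rightarrow> real) \<Rightarrow> bool" where
  "test_function p \<longleftrightarrow>
     (\<forall>n. ((deriv ^^ n) p) differentiable_on UNIV) \<and> compact (closure {x. p x \<noteq> 0})"

definition L2_fun :: "(real \<Rightarrow> real) \<Rightarrow> bool" where
  "L2_fun g \<longleftrightarrow> g \<in> borel_measurable borel \<and> integrable lborel (\<lambda>x. (g x)\<^sup>2)"

definition norm_L2 :: "(real \<Rightarrow> real) \<Rightarrow> real" where
  "norm_L2 g = sqrt (LINT x|lborel. (g x)\<^sup>2)"

definition distributional_derivative :: "(real \<Rightarrow> real) \<Rightarrow> (real \<Rightarrow> real) \<Rightarrow> bool" where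
  "distributional_derivative f g \<longleftrightarrow>
     (\<forall>p. test_function p \<longrightarrow>
        (LINT x|lborel. f x * deriv p x) = - (LINT x|lborel. g x * p x))"

definition space_X :: "(real \<Rightarrow> real) set" where
  "space_X = {f. bounded (range f) \<and> continuous_on UNIV f \<and>
                 (\<exists>g. L2_fun g \<and> distributional_derivative f g)}"

text \<open>A fixed Borel representative of the distributional derivative of a function in
  \<^const>\<open>space_X\<close>. It is determined up to a null set, and nothing below depends on the choice:
  compositions with \<open>\<psi>\<close> always come with the factor \<open>\<psi>'\<close>, which vanishes almost everywhere on
  the preimage under \<open>\<psi>\<close> of a null set (in the first term of the cost, through the
  admissibility condition).\<close>

definition Dx :: "(real \<Rightarrow> real) \<Rightarrow> real \<Rightarrow> real" where
  "Dx f = (SOME g. L2_fun g \<and> distributional_derivative f g)"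


section \<open>The constructed trajectory\<close>

text \<open>The case distinction is needed because \<open>- 2 / 0 = 0\<close>: at time \<open>0\<close> there is no
  restriction on the domain of integration.\<close>

definition source :: "(real \<Rightarrow> real) \<Rightarrow> real \<Rightarrow> real \<Rightarrow> real" where
  "source ubar t y =
     (if t = 0 then 1/4 * (LINT x|lborel. sgn (y - x) * (Dx ubar x)\<^sup>2)
      else 1/4 * (LINT x:{x. Dx ubar x > - 2 / t}|lborel. sgn (y - x) * (Dx ubar x)\<^sup>2))"

definition characteristic :: "(real \<Rightarrow> real) \<Rightarrow> real \<Rightarrow> real \<Rightarrow> real" where
  "characteristic ubar t y =
     y + t * ubar y + (LINT s:{0..t}|lborel. (t - s) * source ubar s y)"

definition trajectory :: "(real \<Rightarrow> real) \<Rightarrow> real \<Rightarrow> real \<Rightarrow> real" where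
  "trajectory ubar t x =
     (THE w. \<exists>y. characteristic ubar t y = x \<and>
                 w = ubar y + (LINT s:{0..t}|lborel. source ubar s y))"


section \<open>The auxiliary space\<close>

text \<open>The third coordinate is meant to range over \<open>(-\<pi>/2, \<pi>/2]\<close> only; below it is always a
  value of \<^const>\<open>arctan\<close>.\<close>

datatype aux_point = Point real real real | Infinity

fun aux_dist :: "real \<Rightarrow> aux_point \<Rightarrow> aux_point \<Rightarrow> real" where
  "aux_dist \<kappa> (Point x u w) (Point x' u' w') =
     min (\<bar>x - x'\<bar> + \<bar>u - u'\<bar> + \<kappa> * \<bar>w - w'\<bar>)
         (\<kappa> * \<bar>pi/2 + w\<bar> + \<kappa> * \<bar>pi/2 + w'\<bar>)"
| "aux_dist \<kappa> (Point x u w) Infinity = \<kappa> * \<bar>pi/2 + w\<bar>"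
| "aux_dist \<kappa> Infinity (Point x u w) = \<kappa> * \<bar>pi/2 + w\<bar>"
| "aux_dist \<kappa> Infinity Infinity = 0"

definition graph_point :: "(real \<Rightarrow> real) \<Rightarrow> real \<Rightarrow> aux_point" where
  "graph_point f x = Point x (f x) (arctan (Dx f x))"


section \<open>The distance functional\<close>

text \<open>Absolute continuity on all of the real line is understood as absolute continuity on every
  compact interval.\<close>

definition absolutely_continuous_fun :: "(real \<Rightarrow> real) \<Rightarrow> bool" where
  "absolutely_continuous_fun f \<longleftrightarrow>
     (\<forall>l r. \<forall>\<epsilon>>0. \<exists>\<delta>>0. \<forall>(n::nat) (a::nat \<Rightarrow> real) b.
        (\<forall>i<n. l \<le> a i \<and> a i \<le> b i \<and> b i \<le> r) \<and>
        disjoint_family_on (\<lambda>i. {a i<..<b i}) {..<n} \<and>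
        (\<Sum>i<n. b i - a i) < \<delta>
        \<longrightarrow> (\<Sum>i<n. \<bar>f (b i) - f (a i)\<bar>) < \<epsilon>)"

definition transport_triple :: "(real \<Rightarrow> real) \<Rightarrow> (real \<Rightarrow> real) \<Rightarrow> (real \<Rightarrow> real) \<Rightarrow> bool" where
  "transport_triple \<psi> \<phi>1 \<phi>2 \<longleftrightarrow>
     simple_function borel \<phi>1 \<and> range \<phi>1 \<subseteq> {0..1} \<and>
     simple_function borel \<phi>2 \<and> range \<phi>2 \<subseteq> {0..1} \<and>
     mono \<psi> \<and> absolutely_continuous_fun \<psi> \<and> surj \<psi>"

definition admissible ::
  "(real \<Rightarrow> real) \<Rightarrow> (real \<Rightarrow> real) \<Rightarrow>
   (real \<Rightarrow> real) \<Rightarrow> (real \<Rightarrow> real) \<Rightarrow> (real \<Rightarrow> real) \<Rightarrow> bool" where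
  "admissible u v \<psi> \<phi>1 \<phi>2 \<longleftrightarrow>
     transport_triple \<psi> \<phi>1 \<phi>2 \<and>
     (AE x in lborel. \<phi>1 x * (Dx u x)\<^sup>2 = deriv \<psi> x * \<phi>2 (\<psi> x) * (Dx v (\<psi> x))\<^sup>2)"

text \<open>The integrands are nonnegative almost everywhere, since \<open>\<psi>\<close> is differentiable with
  \<open>\<psi>' \<ge> 0\<close> outside a null set; so the integrals are taken in \<open>[0,\<infinity>]\<close>.\<close>

definition cost ::
  "real \<Rightarrow> (real \<Rightarrow> real) \<Rightarrow> (real \<Rightarrow> real) \<Rightarrow>
   (real \<Rightarrow> real) \<Rightarrow> (real \<Rightarrow> real) \<Rightarrow> (real \<Rightarrow> real) \<Rightarrow> ennreal" where
  "cost \<kappa> u v \<psi> \<phi>1 \<phi>2 =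
     (let P = graph_point u; Q = (\<lambda>x. graph_point v (\<psi> x)) in
       (\<integral>\<^sup>+x. ennreal (aux_dist \<kappa> (P x) (Q x) * \<phi>1 x * (Dx u x)\<^sup>2) \<partial>lborel) +
       (\<integral>\<^sup>+x. ennreal (aux_dist \<kappa> (P x) Infinity * (1 - \<phi>1 x) * (Dx u x)\<^sup>2) \<partial>lborel) +
       (\<integral>\<^sup>+x. ennreal (aux_dist \<kappa> (Q x) Infinity * (1 - \<phi>2 (\<psi> x)) * (Dx v (\<psi> x))\<^sup>2 * deriv \<psi> x)
          \<partial>lborel))"

definition J :: "real \<Rightarrow> (real \<Rightarrow> real) \<Rightarrow> (real \<Rightarrow> real) \<Rightarrow> ennreal" where
  "J \<kappa> u v = Inf {cost \<kappa> u v \<psi> \<phi>1 \<phi>2 | \<psi> \<phi>1 \<phi>2. admissible u v \<psi> \<phi>1 \<phi>2}"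

end

theory Submission
  imports Defs
begin

text \<open>
  Call \<open>(\<psi>, h)\<close> a transport map if \<open>\<psi>\<close> is nondecreasing and onto with density \<open>h\<close>; then
  \<open>\<integral> f(\<psi>(x)) h(x) dx = \<integral> f(y) dy\<close>. In these terms \<open>J\<close> is a pseudometric: transports compose,
  and although \<open>\<psi>\<close> need not have an absolutely continuous inverse, a transport can be reversed up to
  an arbitrarily small amount of energy by keeping \<open>\<psi>\<close> only on a compact set where it is injective
  with \<open>\<psi>' > 0\<close>. Hence both Lipschitz estimates follow from \<open>J(u(s), u(t)) \<le> L (t - s)\<close> for
  \<open>s \<le> t\<close>, and by the semigroup property from the case \<open>s = 0\<close>.

  With \<open>a\<close> the derivative of the datum, the characteristics have density \<open>((1 + t a/2)\<^sub>+)\<^sup>2\<close> and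
  carry the slope \<open>a / (1 + t a/2)\<close>. Moving the energy along them up to time \<open>t\<close> changes position,
  value and the arctangent of the slope by \<open>O(t)\<close>; the energy lost up to time \<open>t\<close> has \<open>a \<le> -2/t\<close>,
  so that its distance \<open>\<kappa> (\<pi>/2 + arctan a)\<close> to the point at infinity is \<open>O(t)\<close> as well.
\<close>

subsection \<open>Monotone transport of Lebesgue measure\<close>

text \<open>The density \<open>h\<close> travels together with the map because the cost contains
  \<open>deriv \<psi>\<close> and compositions of \<psi> with derivatives known only a.e.; these
  compositions are harmless since \<open>h\<close> vanishes a.e. on preimages of null sets. Where 1
  + t a/2 > 0, the density times the square of the carried slope is exactly a^2. Surviving energy is
  thus moved without loss and makes up all the energy at time t, so only the origin has a lost
  fraction. The carried slope solves w' = -w^2/2, and its arctangent has speed at most 1/2 even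
  while w tends to minus infinity; this is what the angle in the distance is for. Since
  \<open>Dx\<close> is a representative fixed by choice, the derivative of the trajectory must be
  identified a.e.; for this, \<open>space_X\<close> is described as the bounded functions whose
  increments are integrals of an L2 function. Restarting at time s is possible because 1 + q w(s)/2
  = (1 + (s + q) a/2) / (1 + s a/2): a restarted characteristic breaks at the same instant. The
  constants stay uniform on [0, T] because sup norm and energy remain bounded there.\<close>

abbreviation nnint :: "(real \<Rightarrow> real) \<Rightarrow> ennreal" where
  "nnint f \<equiv> \<integral>\<^sup>+x. ennreal (f x) \<partial>lborel"

abbreviation nnint_on :: "real set \<Rightarrow> (real \<Rightarrow> real) \<Rightarrow> ennreal" where
  "nnint_on A f \<equiv> \<integral>\<^sup>+x. ennreal (f x) * indicator A x \<partial>lborel"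

text \<open>The leftmost point of a level set. It is applied to nondecreasing onto maps, whose level
  sets are compact intervals, so that the infimum is attained.\<close>

definition rinv :: "(real \<Rightarrow> real) \<Rightarrow> real \<Rightarrow> real" where
  "rinv F y = Inf {x. F x = y}"

lemma continuous_mono_surj:
  fixes F :: "real \<Rightarrow> real"
  assumes "mono F" "surj F"
  shows "continuous_on UNIV F"
  using assms by (intro continuous_onI_mono) (auto simp: mono_def)

text \<open>The set is closed by continuity, an interval by monotonicity, and bounded by points with
  the values l - 1 and u + 1, which exist because F is onto.\<close>

lemma level_interval_mono_surj:
  fixes F :: "real \<Rightarrow> real"
  assumes "mono F" "surj F" "l \<le> u"
  obtains a b where "a \<le> b" "F a = l" "F b = u" "{x. l \<le> F x \<and> F x \<le> u} = {a..b}"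
proof -
  let ?S = "{x. l \<le> F x \<and> F x \<le> u}"
  have cont: "continuous_on UNIV F" by (rule continuous_mono_surj[OF assms(1,2)])
  obtain c where c: "F c = l" using assms(2) by (metis surj_def)
  obtain d where d: "F d = u" using assms(2) by (metis surj_def)
  obtain p where p: "F p = l - 1" using assms(2) by (metis surj_def)
  obtain q where q: "F q = u + 1" using assms(2) by (metis surj_def)
  have mon: "F x \<le> F y" if "x \<le> y" for x y using assms(1) that by (simp add: mono_def)
  have "closed ?S"
    using cont by (intro closed_Collect_conj closed_Collect_le) (auto intro: continuous_intros)
  moreover have "?S \<subseteq> {p..q}"
  proof
    fix x assume "x \<in> ?S"
    then have "\<not> x \<le> p" "\<not> q \<le> x" using mon[of x p] mon[of q x] p q by auto
    then show "x \<in> {p..q}" by auto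
  qed
  ultimately have "compact ?S"
    by (metis bounded_closed_interval bounded_subset compact_eq_bounded_closed)
  moreover have "connected ?S"
    unfolding is_interval_connected_1[symmetric] is_interval_1
    using mon by (force intro: order_trans)
  ultimately obtain a b where ab: "?S = {a..b}"
    using connected_compact_interval_1 by blast
  have cd: "c \<in> ?S" "d \<in> ?S" using c d assms(3) by auto
  have "c \<in> {a..b}" "d \<in> {a..b}" using cd unfolding ab .
  then have ac: "a \<le> c" "d \<le> b" "a \<le> b" by auto
  then have "a \<in> ?S" "b \<in> ?S" unfolding ab by auto
  then have "F a = l" "F b = u" using mon[OF ac(1)] mon[OF ac(2)] c d by auto
  moreover note \<open>a \<le> b\<close>
  ultimately show ?thesis using ab that by blast
qed

text \<open>Passes from the integral in [0,\<infinity>] to the Lebesgue integral and to the gauge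
  integral; Lebesgue differentiation is later applied to the latter.\<close>

lemma integral_Icc_if_nn_integral:
  fixes h :: "real \<Rightarrow> real"
  assumes [measurable]: "h \<in> borel_measurable borel" and "\<And>x. 0 \<le> h x" "0 \<le> d"
    and "nnint_on {a..b} h = ennreal d"
  shows "set_integrable lborel {a..b} h" "(LINT x:{a..b}|lborel. h x) = d" "(h has_integral d) {a..b}"
proof -
  have nn: "nnint (\<lambda>x. indicator {a..b} x *\<^sub>R h x) = ennreal d"
    unfolding assms(4)[symmetric] by (intro nn_integral_cong) (auto simp: indicator_def)
  show i: "set_integrable lborel {a..b} h"
    unfolding set_integrable_def
    by (intro integrableI_nn_integral_finite[OF _ _ nn] AE_I2) (auto simp: assms(2))
  show e: "(LINT x:{a..b}|lborel. h x) = d"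
    unfolding set_lebesgue_integral_def
    using assms(2,3) nn by (intro integral_eq_nn_integral[THEN trans]) (auto simp: enn2real_eq_posreal_iff)
  show "(h has_integral d) {a..b}"
    using set_borel_integral_eq_integral[OF i] e by (metis integrable_integral)
qed

text \<open>The measure with density h is the Lebesgue-Stieltjes measure of F. Absolute continuity
  of F and F' = h a.e. are consequences, not assumptions.\<close>

locale transport_map =
  fixes F h :: "real \<Rightarrow> real"
  assumes density_measurable [measurable]: "h \<in> borel_measurable borel"
    and density_nonneg: "0 \<le> h x"
    and mono_map: "mono F"
    and surj_map: "surj F"
    and nn_integral_interval:
      "a \<le> b \<Longrightarrow> nnint_on {a..b} h = ennreal (F b - F a)"
begin

lemma map_mono: "x \<le> y \<Longrightarrow> F x \<le> F y"
  using mono_map by (simp add: mono_def)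

lemma map_continuous: "continuous_on UNIV F"
  by (rule continuous_mono_surj[OF mono_map surj_map])

lemma map_measurable [measurable]: "F \<in> borel_measurable borel"
  using map_continuous by (rule borel_measurable_continuous_onI)

lemma emeasure_level:
  assumes "l \<le> u"
  shows "emeasure (density lborel h) (F -` {l..u}) = ennreal (u - l)"
proof -
  obtain a b where ab: "a \<le> b" "F a = l" "F b = u" "{x. l \<le> F x \<and> F x \<le> u} = {a..b}"
    by (rule level_interval_mono_surj[OF mono_map surj_map assms])
  have "F -` {l..u} = {a..b}" unfolding ab(4)[symmetric] by auto
  moreover have "emeasure (density lborel h) {a..b} = ennreal (F b - F a)"
    by (simp add: emeasure_density nn_integral_interval[OF ab(1)])
  ultimately show ?thesis by (simp add: ab(2,3))
qed

text \<open>The preimage of \<open>{l..u}\<close> is an interval on which F grows from l to u, so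
  its mass is u - l. The open intervals on which Lebesgue measure is recognised only lose two level
  sets, which have no mass.\<close>

lemma distr: "distr (density lborel h) borel F = lborel"
proof (rule lborel_eqI[symmetric])
  fix l u :: real
  assume "\<And>b. b \<in> Basis \<Longrightarrow> l \<bullet> b \<le> u \<bullet> b"
  then have lu: "l \<le> u" by simp
  let ?M = "density lborel h"
  have "{l<..<u} = {l..u} - ({l..l} \<union> {u..u})" by auto
  moreover have "F -` ({l..l} \<union> {u..u}) \<in> null_sets ?M"
  proof -
    have "F -` {l..l} \<in> null_sets ?M" "F -` {u..u} \<in> null_sets ?M"
      using emeasure_level[of l l] emeasure_level[of u u]
      using measurable_sets_borel[OF map_measurable, of "{l..l}"]
        measurable_sets_borel[OF map_measurable, of "{u..u}"]
      by (auto simp: null_sets_def simp del: atLeastAtMost_singleton)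
    then show ?thesis by (simp only: vimage_Un null_sets.Un)
  qed
  ultimately have "emeasure ?M (F -` {l<..<u}) = emeasure ?M (F -` {l..u})"
    using measurable_sets_borel[OF map_measurable, of "{l..u}"]
    by (simp only: vimage_Diff) (rule emeasure_Diff_null_set, simp_all)
  then show "emeasure (distr ?M borel F) (box l u) = ennreal (\<Prod>b\<in>Basis. (u - l) \<bullet> b)"
    using emeasure_level[OF lu] lu by (simp add: emeasure_distr)
qed simp

lemma change_of_variables:
  assumes [measurable]: "G \<in> borel_measurable borel"
  shows "(\<integral>\<^sup>+x. G (F x) * ennreal (h x) \<partial>lborel) = (\<integral>\<^sup>+y. G y \<partial>lborel)"
proof -
  have "(\<integral>\<^sup>+y. G y \<partial>lborel) = (\<integral>\<^sup>+y. G y \<partial>distr (density lborel h) borel F)"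
    by (simp add: distr)
  also have "\<dots> = (\<integral>\<^sup>+x. ennreal (h x) * G (F x) \<partial>lborel)"
    by (simp add: nn_integral_distr nn_integral_density)
  finally show ?thesis by (simp add: mult.commute)
qed

text \<open>The preimage of a null set can have positive measure, for instance over a flat piece of
  F, but then the density vanishes a.e. on it. This is how a.e. identities are composed with
  F.\<close>

lemma AE_map:
  assumes "AE y in lborel. P y"
  shows "AE x in lborel. h x = 0 \<or> P (F x)"
proof -
  have "AE y in distr (density lborel h) borel F. P y"
    unfolding distr by (rule assms)
  then have "AE x in density lborel h. P (F x)"
    by (rule AE_distrD[rotated]) simp
  then show ?thesis
    by (subst (asm) AE_density)
      (auto elim!: eventually_mono intro: order_antisym[OF _ density_nonneg])
qed

lemma rinv_closed_level:
  obtains a b where "a \<le> b" "{x. F x = y} = {a..b}"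
proof -
  obtain a b where "a \<le> b" "F a = y" "F b = y" "{x. y \<le> F x \<and> F x \<le> y} = {a..b}"
    by (rule level_interval_mono_surj[OF mono_map surj_map order_refl[of y]])
  moreover have "{x. y \<le> F x \<and> F x \<le> y} = {x. F x = y}" by auto
  ultimately show ?thesis using that by simp
qed

lemma map_rinv [simp]: "F (rinv F y) = y"
proof -
  obtain a b where ab: "a \<le> b" "{x. F x = y} = {a..b}" by (rule rinv_closed_level)
  then have "rinv F y = a" by (simp add: rinv_def)
  moreover have "a \<in> {x. F x = y}" unfolding ab(2) using ab(1) by simp
  ultimately show ?thesis by simp
qed

lemma rinv_le: "rinv F (F x) \<le> x"
proof -
  obtain a b where ab: "a \<le> b" "{z. F z = F x} = {a..b}" by (rule rinv_closed_level)
  moreover from this have "rinv F (F x) = a" by (simp add: rinv_def)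
  moreover have "x \<in> {a..b}" unfolding ab(2)[symmetric] by simp
  ultimately show ?thesis by simp
qed

lemma rinv_strict_mono: "x < y \<Longrightarrow> rinv F x < rinv F y"
  using map_mono[of "rinv F y" "rinv F x"] by force

lemma rinv_measurable [measurable]: "rinv F \<in> borel_measurable borel"
  by (rule borel_measurable_mono) (metis monoI rinv_strict_mono less_eq_real_def)

lemma flat:
  assumes "F a = F b" "a \<le> b"
  shows "AE x in lborel. x \<in> {a..b} \<longrightarrow> h x = 0"
proof -
  have "nnint_on {a..b} h = 0"
    using nn_integral_interval[OF assms(2)] assms by simp
  then have "AE x in lborel. ennreal (h x) * indicator {a..b} x = 0"
    by (subst (asm) nn_integral_0_iff_AE) auto
  then show ?thesis
    by eventually_elim (auto simp: indicator_def ennreal_eq_0_iff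
        dest: order_antisym[OF _ density_nonneg])
qed

text \<open>Otherwise a rational to the left of x lies on the same level. The levels of rationals
  are countably many intervals on which F is constant, and on each of them h vanishes a.e.\<close>

lemma rinv_map_AE: "AE x in lborel. h x = 0 \<or> rinv F (F x) = x"
proof -
  have "AE x in lborel. \<forall>q::rat. F (of_rat q) = F x \<and> of_rat q < x \<longrightarrow> h x = 0"
  proof (subst AE_all_countable, rule allI)
    fix q :: rat
    obtain a b where ab: "a \<le> b" "{x. F x = F (of_rat q)} = {a..b}" by (rule rinv_closed_level)
    then have "F a = F b" using atLeastAtMost_iff[of a a b] atLeastAtMost_iff[of b a b]
      by (metis mem_Collect_eq order_refl)
    from flat[OF this ab(1)]
    show "AE x in lborel. F (of_rat q) = F x \<and> of_rat q < x \<longrightarrow> h x = 0"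
      by eventually_elim (use ab(2) in auto)
  qed
  then show ?thesis
  proof eventually_elim
    case (elim x)
    show ?case
    proof (rule ccontr)
      assume "\<not> ?thesis"
      then have "h x \<noteq> 0" "rinv F (F x) < x" using rinv_le[of x] by auto
      then obtain q where q: "rinv F (F x) < of_rat q" "of_rat q < x"
        using of_rat_dense by blast
      have "F (of_rat q) = F x"
        using map_mono[of "rinv F (F x)" "of_rat q"] map_mono[of "of_rat q" x] q
        by (intro antisym) auto
      then show False using elim q \<open>h x \<noteq> 0\<close> by auto
    qed
  qed
qed

end

lemma transport_map_id: "transport_map (\<lambda>x. x) (\<lambda>x. 1)"
  by unfold_locales (auto simp: mono_def)

lemma transport_map_compose:
  assumes F: "transport_map F h" and G: "transport_map G k"
  shows "transport_map (\<lambda>x. G (F x)) (\<lambda>x. k (F x) * h x)"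
proof -
  interpret F: transport_map F h by (rule F)
  interpret G: transport_map G k by (rule G)
  show ?thesis
  proof
    fix a b :: real
    assume "a \<le> b"
    \<comment> \<open>The conditions \<open>x \<in> {a..b}\<close> and
      \<open>F x \<in> {F a..F b}\<close> can differ only on the levels of the two endpoints, where
      h vanishes a.e.\<close>
    have "AE x in lborel. h x = 0 \<or> (F x \<noteq> F a \<and> F x \<noteq> F b)"
      by (rule F.AE_map) (intro AE_conjI AE_lborel_singleton)
    then have "nnint_on {a..b} (\<lambda>x. k (F x) * h x)
      = (\<integral>\<^sup>+x. (ennreal (k (F x)) * indicator {F a..F b} (F x)) * ennreal (h x) \<partial>lborel)"
    proof (intro nn_integral_cong_AE, eventually_elim)
      case (elim x)
      show ?case
      proof (cases "h x = 0")
        case False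
        then have ne: "F x \<noteq> F a" "F x \<noteq> F b" using elim by auto
        have "x \<in> {a..b} \<longleftrightarrow> F x \<in> {F a..F b}"
          using ne F.map_mono[of x a] F.map_mono[of a x] F.map_mono[of b x] F.map_mono[of x b]
          by force
        then show ?thesis
          using F.density_nonneg[of x] G.density_nonneg[of "F x"]
          by (auto simp: ennreal_mult indicator_def mult.commute)
      qed simp
    qed
    also have "\<dots> = nnint_on {F a..F b} k"
      by (rule F.change_of_variables) measurable
    finally show "nnint_on {a..b} (\<lambda>x. k (F x) * h x)
        = ennreal (G (F b) - G (F a))"
      using G.nn_integral_interval F.map_mono[OF \<open>a \<le> b\<close>] by simp
  next
    show "surj (\<lambda>x. G (F x))"
      using comp_surj[OF F.surj_map G.surj_map] by (simp add: comp_def)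
    show "mono (\<lambda>x. G (F x))"
      by (intro monoI G.map_mono F.map_mono)
  qed (auto intro: mult_nonneg_nonneg F.density_nonneg G.density_nonneg)
qed

subsection \<open>Absolute continuity and Lebesgue differentiation\<close>

context transport_map
begin

lemma integral_interval:
  assumes "a \<le> b"
  shows "set_integrable lborel {a..b} h" "(LINT x:{a..b}|lborel. h x) = F b - F a"
    "(h has_integral (F b - F a)) {a..b}"
  using integral_Icc_if_nn_integral[OF density_measurable density_nonneg _ nn_integral_interval[OF assms]]
    map_mono[OF assms] by auto

text \<open>Lebesgue differentiation over the intervals \<open>{x..x + k}\<close>; since x is an
  endpoint of them, only right difference quotients are obtained.\<close>

lemma AE_right_derivative:
  "AE x in lborel. \<forall>e>0. \<exists>d>0. \<forall>k. 0 < k \<and> k < d \<longrightarrow> \<bar>(F (x + k) - F x) / k - h x\<bar> < e"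
proof -
  have "h integrable_on cbox a b" for a b
    using integral_interval(3)[of a b] by (cases "a \<le> b") (auto simp: integrable_on_def)
  then obtain N where N: "negligible N"
    "\<And>x e. x \<notin> N \<Longrightarrow> 0 < e \<Longrightarrow> \<exists>d>0. \<forall>k. 0 < k \<and> k < d \<longrightarrow>
        norm (integral (cbox x (x + k *\<^sub>R One)) h /\<^sub>R k ^ DIM(real) - h x) < e"
    using integrable_ccontinuous_explicit[of h] by metis
  have "\<exists>d>0. \<forall>k. 0 < k \<and> k < d \<longrightarrow> \<bar>(F (x + k) - F x) / k - h x\<bar> < e"
    if xe: "x \<notin> N" "0 < e" for x e
  proof -
    obtain d where d: "d > 0" "\<And>k. 0 < k \<and> k < d \<Longrightarrow>
        norm (integral (cbox x (x + k *\<^sub>R One)) h /\<^sub>R k ^ DIM(real) - h x) < e"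
      using N(2)[OF xe] by blast
    have "\<bar>(F (x + k) - F x) / k - h x\<bar> < e" if "0 < k \<and> k < d" for k
    proof -
      have "integral {x..x + k} h = F (x + k) - F x"
        using that by (intro integral_unique integral_interval(3)) auto
      then show ?thesis using d(2)[OF that] by (simp add: divide_inverse mult.commute)
    qed
    then show ?thesis using d(1) by blast
  qed
  moreover have "AE x in lebesgue. x \<notin> N"
    using N(1) by (simp add: AE_not_in negligible_iff_null_sets)
  then have "AE x in lborel. x \<notin> N" by (simp add: AE_completion_iff)
  ultimately show ?thesis by (auto elim!: eventually_mono)
qed

text \<open>Reflection turns left difference quotients into right ones and so supplies the other
  half of the derivative.\<close>

lemma transport_map_reflect: "transport_map (\<lambda>x. - F (- x)) (\<lambda>x. h (- x))"
proof
  fix a b :: real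
  assume "a \<le> b"
  have "nnint_on {a..b} (\<lambda>x. h (- x))
      = (\<integral>\<^sup>+x. ennreal (h x) * indicator {a..b} (- x) \<partial>distr lborel borel uminus)"
    by (subst nn_integral_distr) auto
  also have "\<dots> = nnint_on {-b..-a} h"
    by (subst lborel_distr_uminus) (auto intro!: nn_integral_cong simp: indicator_def)
  finally show "nnint_on {a..b} (\<lambda>x. h (- x))
      = ennreal (- F (- b) - - F (- a))"
    using nn_integral_interval[of "-b" "-a"] \<open>a \<le> b\<close> by simp
next
  show "surj (\<lambda>x. - F (- x))"
  proof (rule surjI)
    show "- F (- (- rinv F (- y))) = y" for y by simp
  qed
  show "mono (\<lambda>x. - F (- x))" by (intro monoI) (simp add: map_mono)
qed (auto simp: density_nonneg)

lemma AE_has_derivative: "AE x in lborel. (F has_real_derivative h x) (at x)"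
proof -
  interpret R: transport_map "\<lambda>x. - F (- x)" "\<lambda>x. h (- x)" by (rule transport_map_reflect)
  have "AE y in distr lborel borel uminus. \<forall>e>0. \<exists>d>0. \<forall>k. 0 < k \<and> k < d \<longrightarrow>
      \<bar>(- F (- (y + k)) - - F (- y)) / k - h (- y)\<bar> < e"
    unfolding lborel_distr_uminus by (rule R.AE_right_derivative)
  then have left: "AE x in lborel. \<forall>e>0. \<exists>d>0. \<forall>k. 0 < k \<and> k < d \<longrightarrow>
      \<bar>(- F (- (- x + k)) - - F (- (- x))) / k - h (- (- x))\<bar> < e"
    by (rule AE_distrD[rotated]) simp
  from AE_right_derivative left show ?thesis
  proof eventually_elim
    case (elim x)
    show ?case
      unfolding DERIV_def LIM_eq
    proof (intro allI impI)
      fix e :: real assume "0 < e"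
      obtain d where d: "d > 0" "\<And>k. 0 < k \<Longrightarrow> k < d \<Longrightarrow> \<bar>(F (x + k) - F x) / k - h x\<bar> < e"
        using elim(1)[rule_format, OF \<open>0 < e\<close>] by auto
      obtain d' where d': "d' > 0" "\<And>k. 0 < k \<Longrightarrow> k < d' \<Longrightarrow> \<bar>(F x - F (x - k)) / k - h x\<bar> < e"
        using elim(2)[rule_format, OF \<open>0 < e\<close>] by auto
      have "norm ((F (x + k) - F x) / k - h x) < e"
        if "k \<noteq> 0" "norm (k - 0) < min d d'" for k
      proof (cases "0 < k")
        case True then show ?thesis using d(2)[of k] that by auto
      next
        case False
        then have "(F (x + k) - F x) / k = (F x - F (x - (- k))) / (- k)"
          by (simp add: minus_divide_right[symmetric] minus_divide_left)
        then show ?thesis using d'(2)[of "- k"] that False by auto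
      qed
      then show "\<exists>s>0. \<forall>xa. xa \<noteq> 0 \<and> norm (xa - 0) < s \<longrightarrow> norm ((F (x + xa) - F x) / xa - h x) < e"
        using d(1) d'(1) by (intro exI[of _ "min d d'"]) auto
    qed
  qed
qed

lemma AE_deriv: "AE x in lborel. deriv F x = h x"
  using AE_has_derivative by eventually_elim (rule DERIV_imp_deriv)

lemma absolutely_continuous_map: "absolutely_continuous_fun F"
  unfolding absolutely_continuous_fun_def
proof (intro allI impI)
  fix l r e :: real
  assume "e > 0"
  \<comment> \<open>The excess of h above the level n. Its integral over \<open>{l..r}\<close> tends
    to 0, while the part of h below n contributes at most n times the total length of the
    intervals.\<close>
  define g where "g n x = indicator {l..r} x * (h x - min (h x) (real n))" for n x
  have [measurable]: "g n \<in> borel_measurable borel" for n unfolding g_def by measurable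
  have lr: "integrable lborel (\<lambda>x. indicator {l..r} x * h x)"
    using integral_interval(1)[of l r] by (cases "l \<le> r") (simp_all add: set_integrable_def)
  have g_le: "\<bar>g n x\<bar> \<le> indicator {l..r} x * h x" for n x
    using density_nonneg[of x] by (auto simp: g_def indicator_def)
  have g_int: "integrable lborel (g n)" for n
    by (rule Bochner_Integration.integrable_bound[OF lr]) (use g_le in \<open>auto intro: order_trans[OF _ abs_ge_self]\<close>)
  have "(\<lambda>n. LINT x|lborel. g n x) \<longlonglongrightarrow> (LINT x|(lborel :: real measure). 0)"
  proof (rule integral_dominated_convergence[OF _ _ lr])
    show "AE x in lborel. (\<lambda>n. g n x) \<longlonglongrightarrow> 0"
    proof (rule AE_I2)
      fix x
      have "eventually (\<lambda>n. g n x = 0) sequentially"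
        by (rule eventually_mono[OF eventually_ge_at_top[of "nat \<lceil>h x\<rceil>"]])
          (auto simp: g_def nat_le_iff ceiling_le_iff)
      then show "(\<lambda>n. g n x) \<longlonglongrightarrow> 0" by (rule tendsto_eventually)
    qed
  qed (use g_le in auto)
  then have "eventually (\<lambda>n. (LINT x|lborel. g n x) < e / 2) sequentially"
    using \<open>e > 0\<close> by (intro order_tendstoD(2)[of _ 0]) auto
  then obtain n where n: "(LINT x|lborel. g n x) < e / 2" by (auto simp: eventually_sequentially)
  \<comment> \<open>The summand 1 keeps d positive when n = 0.\<close>
  define d where "d = e / (2 * (real n + 1))"
  have "d > 0" "real n * d \<le> e / 2" using \<open>e > 0\<close> by (simp_all add: d_def field_simps)
  show "\<exists>d>0. \<forall>n a b. (\<forall>i<n. l \<le> a i \<and> a i \<le> b i \<and> b i \<le> r) \<and>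
        disjoint_family_on (\<lambda>i. {a i<..<b i}) {..<n} \<and> (\<Sum>i<n. b i - a i) < d \<longrightarrow>
        (\<Sum>i<(n::nat). \<bar>F (b i) - F (a i)\<bar>) < e"
  proof (intro exI[of _ d] conjI allI impI \<open>d > 0\<close>)
    fix m :: nat and a b :: "nat \<Rightarrow> real"
    assume *: "(\<forall>i<m. l \<le> a i \<and> a i \<le> b i \<and> b i \<le> r) \<and>
        disjoint_family_on (\<lambda>i. {a i<..<b i}) {..<m} \<and> (\<Sum>i<m. b i - a i) < d"
    have part: "integrable lborel (\<lambda>x. indicator {a i<..<b i} x * g n x)" for i
      by (rule Bochner_Integration.integrable_bound[OF integrable_abs[OF g_int[of n]]]) (auto simp: indicator_def)
    have "\<bar>F (b i) - F (a i)\<bar> \<le> real n * (b i - a i) + (LINT x|lborel. indicator {a i<..<b i} x * g n x)"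
      if "i < m" for i
    proof -
      have ab: "l \<le> a i" "a i \<le> b i" "b i \<le> r" using * that by auto
      have const: "integrable lborel (\<lambda>x. indicator {a i..b i} x * real n)"
        by (intro integrable_mult_left) (simp add: integrable_indicator_iff emeasure_lborel_Icc_eq)
      have "\<bar>F (b i) - F (a i)\<bar> = (LINT x|lborel. indicator {a i..b i} x *\<^sub>R h x)"
        using integral_interval(2)[OF ab(2)] map_mono[OF ab(2)] by (simp add: set_lebesgue_integral_def)
      also have "\<dots> \<le> (LINT x|lborel. indicator {a i..b i} x * real n + indicator {a i<..<b i} x * g n x)"
      proof (rule integral_mono_AE)
        have "AE x in lborel. x \<noteq> a i \<and> x \<noteq> b i" by (intro AE_conjI AE_lborel_singleton)
        then show "AE x in lborel. indicator {a i..b i} x *\<^sub>R h x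
            \<le> indicator {a i..b i} x * real n + indicator {a i<..<b i} x * g n x"
          by eventually_elim (use ab in \<open>auto simp: indicator_def g_def\<close>)
      qed (use integral_interval(1)[OF ab(2)] part const in \<open>auto simp: set_integrable_def\<close>)
      also have "\<dots> = real n * (b i - a i) + (LINT x|lborel. indicator {a i<..<b i} x * g n x)"
        using part const ab by (subst Bochner_Integration.integral_add) auto
      finally show ?thesis .
    qed
    then have "(\<Sum>i<m. \<bar>F (b i) - F (a i)\<bar>)
        \<le> (\<Sum>i<m. real n * (b i - a i) + (LINT x|lborel. indicator {a i<..<b i} x * g n x))"
      by (intro sum_mono) auto
    also have "\<dots> = real n * (\<Sum>i<m. b i - a i) + (LINT x|lborel. (\<Sum>i<m. indicator {a i<..<b i} x * g n x))"
      unfolding sum.distrib sum_distrib_left[symmetric]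
      by (subst Bochner_Integration.integral_sum) (rule part refl)+
    also have "\<dots> \<le> real n * d + (LINT x|lborel. g n x)"
    proof (intro add_mono mult_left_mono integral_mono)
      show "integrable lborel (\<lambda>x. \<Sum>i<m. indicator {a i<..<b i} x * g n x)"
        by (rule Bochner_Integration.integrable_sum) (rule part)
      fix x
      have "(\<Sum>i<m. indicator {a i<..<b i} x * g n x) = indicator (\<Union>i<m. {a i<..<b i}) x * g n x"
        using * by (subst indicator_UN_disjoint) (auto simp: sum_distrib_right)
      also have "\<dots> \<le> g n x"
        by (cases "x \<in> (\<Union>i<m. {a i<..<b i})") (simp_all only: indicator_simps, auto simp: g_def indicator_def)
      finally show "(\<Sum>i<m. indicator {a i<..<b i} x * g n x) \<le> g n x" .
    qed (use * g_int in auto)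
    also have "\<dots> < e" using n \<open>real n * d \<le> e / 2\<close> by linarith
    finally show "(\<Sum>i<m. \<bar>F (b i) - F (a i)\<bar>) < e" .
  qed
qed

end

text \<open>Radon-Nikodym for the Stieltjes measure of F, once absolute continuity of the function
  has been turned into absolute continuity of the measure.\<close>

lemma transport_map_of_absolutely_continuous:
  assumes "mono F" "surj F" and ac: "absolutely_continuous_fun F"
  obtains h where "transport_map F h"
proof -
  define M where "M = interval_measure F"
  have cont: "continuous_on UNIV F" by (rule continuous_mono_surj[OF assms(1,2)])
  have mon: "F x \<le> F y" if "x \<le> y" for x y using assms(1) that by (simp add: mono_def)
  have [simp, measurable_cong]: "sets M = sets borel" by (simp add: M_def)
  have [simp]: "space M = UNIV" by (simp add: M_def)
  have Icc: "emeasure M {a..b} = ennreal (F b - F a)" if "a \<le> b" for a b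
    unfolding M_def
    by (rule emeasure_interval_measure_Icc[OF that mon])
      (auto intro: continuous_on_subset[OF cont])
  \<comment> \<open>A null set lies in open sets of small measure. Absolute continuity bounds the
    mass of finite unions of intervals inside such a set, and the bound passes to the increasing
    limit.\<close>
  have small: "emeasure M (N \<inter> {l<..<r}) \<le> ennreal e"
    if N: "N \<in> null_sets lborel" and "e > 0" for N l r e
  proof -
    obtain d where "d > 0" and d: "\<And>(n::nat) a b.
        \<forall>i<n. l \<le> a i \<and> a i \<le> b i \<and> b i \<le> r \<Longrightarrow>
        disjoint_family_on (\<lambda>i. {a i<..<b i}) {..<n} \<Longrightarrow>
        (\<Sum>i<n. b i - a i) < d \<Longrightarrow> (\<Sum>i<n. \<bar>F (b i) - F (a i)\<bar>) < e"
      using ac[unfolded absolutely_continuous_fun_def, rule_format, of e l r] \<open>e > 0\<close> by blast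
    have [measurable]: "N \<in> sets borel" using N by auto
    obtain U where U: "open U" "N \<subseteq> U" "emeasure lborel (U - N) < ennreal d"
      using outer_regular_lborel[of N d] \<open>d > 0\<close> by auto
    define V where "V = U \<inter> {l<..<r}"
    have "open V" unfolding V_def using U(1) by auto
    have "emeasure lborel V \<le> emeasure lborel ((U - N) \<union> N)"
      using U(1) by (intro emeasure_mono) (auto simp: V_def)
    also have "\<dots> \<le> emeasure lborel (U - N) + emeasure lborel N"
      using U(1) by (intro emeasure_subadditive) auto
    also have "\<dots> < ennreal d" using U(3) N by (simp add: null_setsD1)
    finally have V: "emeasure lborel V < ennreal d" .
    obtain C where C: "countable C" "C \<subseteq> Pow V" "\<And>X. X \<in> C \<Longrightarrow> \<exists>a b. X = cbox a b" "\<Union>C = V"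
      using open_countable_Union_open_cbox[OF \<open>open V\<close>] by metis
    have fin: "emeasure M (\<Union>E) \<le> ennreal e" if E: "finite E" "E \<subseteq> C" for E
    proof -
      \<comment> \<open>Cutting a finite union of boxes into a division gives intervals with
        disjoint interiors, as the definition of absolute continuity requires.\<close>
      obtain p where p: "p division_of \<Union>E"
        using elementary_unions_intervals[OF E(1)] E(2) C(3) by (metis subsetD)
      have finp: "finite p" using p by auto
      obtain f where f: "bij_betw f {..<card p} p"
        using ex_bij_betw_nat_finite[OF finp] by (auto simp: atLeast0LessThan)
      have "\<exists>a b. f i = {a..b} \<and> a \<le> b" if "i < card p" for i
      proof -
        have "f i \<in> p" using f that by (auto simp: bij_betw_def)
        then obtain a b where "f i = cbox a b" "f i \<noteq> {}"
          using division_ofD(3)[OF p] division_ofD(4)[OF p] by metis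
        then show ?thesis by (intro exI[of _ a] exI[of _ b]) auto
      qed
      then obtain a b where ab: "\<And>i. i < card p \<Longrightarrow> f i = {a i..b i} \<and> a i \<le> b i" by metis
      have sub: "{a i..b i} \<subseteq> V" if "i < card p" for i
      proof -
        have "f i \<in> p" using f that by (auto simp: bij_betw_def)
        then have "f i \<subseteq> \<Union>E" using division_ofD(2)[OF p] by auto
        also have "\<dots> \<subseteq> V" using C(4) E(2) by blast
        finally show ?thesis using ab[OF that] by simp
      qed
      have disj: "disjoint_family_on (\<lambda>i. {a i<..<b i}) {..<card p}"
        unfolding disjoint_family_on_def
      proof (intro ballI impI)
        fix i j assume ij: "i \<in> {..<card p}" "j \<in> {..<card p}" "i \<noteq> j"
        then have "f i \<noteq> f j" "f i \<in> p" "f j \<in> p"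
          using f by (auto simp: bij_betw_def inj_on_def)
        then have "interior (f i) \<inter> interior (f j) = {}" using division_ofD(5)[OF p] by blast
        then show "{a i<..<b i} \<inter> {a j<..<b j} = {}" using ab ij by auto
      qed
      have "ennreal (\<Sum>i<card p. b i - a i) = (\<Sum>i<card p. emeasure lborel {a i<..<b i})"
        using ab by (subst sum_ennreal[symmetric]) auto
      also have "\<dots> = emeasure lborel (\<Union>i<card p. {a i<..<b i})"
        using disj by (intro sum_emeasure) auto
      also have "\<dots> \<le> emeasure lborel V"
        using sub \<open>open V\<close> by (intro emeasure_mono) (auto simp: subset_iff)
      finally have "ennreal (\<Sum>i<card p. b i - a i) < ennreal d" using V by simp
      then have len: "(\<Sum>i<card p. b i - a i) < d"
        using ab by (subst (asm) ennreal_less_iff) (auto intro!: sum_nonneg)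
      have "\<forall>i<card p. l \<le> a i \<and> a i \<le> b i \<and> b i \<le> r"
      proof (intro allI impI)
        fix i assume i: "i < card p"
        then have "{a i..b i} \<subseteq> {l<..<r}" using sub unfolding V_def by blast
        then show "l \<le> a i \<and> a i \<le> b i \<and> b i \<le> r" using ab[OF i] by auto
      qed
      from d[OF this disj len] have small: "(\<Sum>i<card p. \<bar>F (b i) - F (a i)\<bar>) < e" .
      have "\<Union>E = (\<Union>i<card p. {a i..b i})"
        using division_ofD(6)[OF p] f ab by (auto simp: bij_betw_def)
      then have "emeasure M (\<Union>E) \<le> (\<Sum>i<card p. emeasure M {a i..b i})"
        by (simp only:) (intro emeasure_subadditive_finite, auto)
      also have "\<dots> = (\<Sum>i<card p. ennreal \<bar>F (b i) - F (a i)\<bar>)"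
        using ab Icc mon by (intro sum.cong) auto
      also have "\<dots> = ennreal (\<Sum>i<card p. \<bar>F (b i) - F (a i)\<bar>)" by (intro sum_ennreal) auto
      also have "\<dots> \<le> ennreal e" using small by (intro ennreal_leI) auto
      finally show ?thesis .
    qed
    have "emeasure M V \<le> ennreal e"
    proof (cases "C = {}")
      case False
      define D where "D = from_nat_into C"
      have D: "range D = C" unfolding D_def using False C(1) by (rule range_from_nat_into)
      define W where "W n = \<Union>(D ` {..n})" for n
      have "closed X" if "X \<in> C" for X using C(3)[OF that] by (auto simp: closed_cbox)
      then have Wm: "W n \<in> sets M" for n
        unfolding W_def using D by (auto intro!: borel_closed closed_UN)
      have "V = (\<Union>n. W n)" unfolding W_def using C(4) D by auto
      moreover have "incseq W" unfolding W_def incseq_def by (auto intro: order_trans)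
      ultimately have "emeasure M V = (SUP n. emeasure M (W n))"
        using Wm by (simp add: SUP_emeasure_incseq image_subset_iff)
      also have "\<dots> \<le> ennreal e"
        unfolding W_def using D by (intro SUP_least fin) auto
      finally show ?thesis .
    qed (use C(4) in auto)
    moreover have "emeasure M (N \<inter> {l<..<r}) \<le> emeasure M V"
      using U(1,2) by (intro emeasure_mono) (auto simp: V_def)
    ultimately show ?thesis by (rule order_trans[rotated])
  qed
  have "absolutely_continuous lborel M"
    unfolding absolutely_continuous_def
  proof
    fix N :: "real set" assume N: "N \<in> null_sets lborel"
    have "N \<inter> {- real n<..<real n} \<in> null_sets M" for n
    proof (rule null_setsI)
      show "emeasure M (N \<inter> {- real n<..<real n}) = 0"
        using small[OF N, of _ "- real n" "real n"] ennreal_le_epsilon[of 0] by force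
    qed (use N in auto)
    then have "(\<Union>n. N \<inter> {- real n<..<real n}) \<in> null_sets M" by (rule null_sets_UN)
    moreover have "(\<Union>n. N \<inter> {- real n<..<real n}) = N"
    proof -
      have "\<exists>n. - real n < x \<and> x < real n" for x
      proof -
        obtain n where "\<bar>x\<bar> < real n" using reals_Archimedean2 by blast
        then have "- real n < x \<and> x < real n" by (simp add: abs_less_iff)
        then show ?thesis by blast
      qed
      then show ?thesis by auto
    qed
    ultimately show "N \<in> null_sets M" by simp
  qed
  then have RN: "density lborel (RN_deriv lborel M) = M"
    by (intro sigma_finite_measure.density_RN_deriv[OF sigma_finite_lborel]) auto
  define h where "h x = enn2real (RN_deriv lborel M x)" for x
  have M_sf: "sigma_finite_measure M"
    unfolding M_def
    by (rule sigma_finite_interval_measure[OF mon])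
      (auto intro: continuous_on_imp_continuous_within[OF cont] continuous_within_subset)
  have "AE x in lborel. RN_deriv lborel M x \<noteq> \<infinity>"
    by (rule sigma_finite_measure.RN_deriv_finite[OF sigma_finite_lborel M_sf \<open>absolutely_continuous lborel M\<close>]) simp
  then have h: "AE x in lborel. ennreal (h x) = RN_deriv lborel M x"
    by eventually_elim (simp add: h_def less_top)
  have "transport_map F h"
  proof
    fix a b :: real
    assume "a \<le> b"
    have "nnint_on {a..b} h
        = (\<integral>\<^sup>+x. RN_deriv lborel M x * indicator {a..b} x \<partial>lborel)"
      using h by (intro nn_integral_cong_AE, eventually_elim) simp
    also have "\<dots> = emeasure (density lborel (RN_deriv lborel M)) {a..b}"
      by (subst emeasure_density) auto
    finally show "nnint_on {a..b} h = ennreal (F b - F a)"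
      using Icc[OF \<open>a \<le> b\<close>] RN by simp
  next
    show "h \<in> borel_measurable borel" unfolding h_def by measurable
  qed (use assms in \<open>auto simp: h_def\<close>)
  then show ?thesis by (rule that)
qed

subsection \<open>Composition of transports\<close>

lemma aux_dist_nonneg: "0 \<le> \<kappa> \<Longrightarrow> 0 \<le> aux_dist \<kappa> p q"
  by (cases p; cases q) (auto intro: add_nonneg_nonneg)

lemma aux_dist_commute: "aux_dist \<kappa> p q = aux_dist \<kappa> q p"
  by (cases p; cases q) (auto simp: abs_minus_commute add.commute)

text \<open>A direct distance is combined with detours through infinity. The triangle inequality
  survives because the distance to infinity is 1-Lipschitz for the direct distance
  (\<open>key\<close>).\<close>

lemma aux_dist_triangle:
  assumes "0 \<le> \<kappa>"
  shows "aux_dist \<kappa> p r \<le> aux_dist \<kappa> p q + aux_dist \<kappa> q r"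
proof -
  \<comment> \<open>Here d, d1, d2 stand for the direct distances of p r, p q and q r, and a, c, b
    for the distances of p, q, r to infinity.\<close>
  have min_tri: "min d (a + b) \<le> min d1 (a + c) + min d2 (c + b)"
    if "d \<le> d1 + d2" "a \<le> d1 + c" "b \<le> d2 + c" "0 \<le> c" for a b c d d1 d2 :: real
    using that by linarith
  have key: "\<kappa> * \<bar>pi/2 + a\<bar> \<le> X + U + \<kappa> * \<bar>a - b\<bar> + \<kappa> * \<bar>pi/2 + b\<bar>"
    if "0 \<le> X" "0 \<le> U" for a b X U
  proof -
    have "\<bar>pi/2 + a\<bar> \<le> \<bar>a - b\<bar> + \<bar>pi/2 + b\<bar>" by linarith
    from mult_left_mono[OF this assms] that show ?thesis by (simp add: distrib_left)
  qed
  have tri: "\<bar>x - x''\<bar> + \<bar>u - u''\<bar> + \<kappa> * \<bar>a - c\<bar>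
      \<le> (\<bar>x - x'\<bar> + \<bar>u - u'\<bar> + \<kappa> * \<bar>a - b\<bar>) + (\<bar>x' - x''\<bar> + \<bar>u' - u''\<bar> + \<kappa> * \<bar>b - c\<bar>)"
    for x x' x'' u u' u'' a b c :: real
  proof -
    have "\<bar>a - c\<bar> \<le> \<bar>a - b\<bar> + \<bar>b - c\<bar>" by linarith
    from mult_left_mono[OF this assms] have "\<kappa> * \<bar>a - c\<bar> \<le> \<kappa> * \<bar>a - b\<bar> + \<kappa> * \<bar>b - c\<bar>"
      by (simp add: distrib_left)
    moreover have "\<bar>x - x''\<bar> \<le> \<bar>x - x'\<bar> + \<bar>x' - x''\<bar>" "\<bar>u - u''\<bar> \<le> \<bar>u - u'\<bar> + \<bar>u' - u''\<bar>"
      by linarith+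
    ultimately show ?thesis by linarith
  qed
  have nn: "0 \<le> \<kappa> * \<bar>x\<bar>" for x using assms by simp
  have PPI: "aux_dist \<kappa> (Point x u w) Infinity
      \<le> aux_dist \<kappa> (Point x u w) (Point x' u' w') + aux_dist \<kappa> (Point x' u' w') Infinity"
    for x u w x' u' w'
  proof -
    have "a \<le> min d (a + c) + c" if "a \<le> d + c" "0 \<le> c" for a c d :: real
      using that by linarith
    from this[OF key nn] show ?thesis by simp
  qed
  show ?thesis
  proof (cases p; cases q; cases r)
    fix x u w x' u' w' x'' u'' w''
    assume "p = Point x u w" "q = Point x' u' w'" "r = Point x'' u'' w''"
    moreover have "\<kappa> * \<bar>pi/2 + w''\<bar>
        \<le> \<bar>x' - x''\<bar> + \<bar>u' - u''\<bar> + \<kappa> * \<bar>w' - w''\<bar> + \<kappa> * \<bar>pi/2 + w'\<bar>"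
      using key[of "\<bar>x' - x''\<bar>" "\<bar>u' - u''\<bar>" w'' w']
      by (simp only: abs_minus_commute[of w'' w'] abs_ge_zero)
    ultimately show ?thesis
      by (simp only: aux_dist.simps) (rule min_tri[OF tri key _ nn]; simp)
  next
    fix x u w x' u' w'
    assume "p = Point x u w" "q = Point x' u' w'" "r = Infinity"
    then show ?thesis using PPI by simp
  next
    fix x' u' w' x'' u'' w''
    assume "p = Infinity" "q = Point x' u' w'" "r = Point x'' u'' w''"
    then show ?thesis using PPI[of x'' u'' w'' x' u' w']
      by (simp only: aux_dist_commute[of \<kappa> Infinity] aux_dist_commute[of \<kappa> "Point x' u' w'" "Point x'' u'' w''"] add.commute)
  qed (use nn in auto)
qed

lemma aux_dist_graph_Infinity_le:
  assumes "0 \<le> \<kappa>"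
  shows "aux_dist \<kappa> (graph_point f x) Infinity \<le> \<kappa> * pi"
proof -
  have "\<bar>pi/2 + arctan (Dx f x)\<bar> \<le> pi" using arctan_bounded[of "Dx f x"] by simp
  then show ?thesis using assms by (simp add: graph_point_def mult_left_mono)
qed

lemma measurable_aux_dist_graph [measurable]:
  assumes [measurable]: "u \<in> borel_measurable borel" "Dx u \<in> borel_measurable borel"
    "v \<in> borel_measurable borel" "Dx v \<in> borel_measurable borel"
    "f \<in> borel_measurable M" "g \<in> borel_measurable M"
  shows "(\<lambda>x. aux_dist \<kappa> (graph_point u (f x)) (graph_point v (g x))) \<in> borel_measurable M"
  unfolding graph_point_def aux_dist.simps by measurable

lemma measurable_aux_dist_Infinity [measurable]:
  assumes [measurable]: "Dx u \<in> borel_measurable borel" "f \<in> borel_measurable M"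
  shows "(\<lambda>x. aux_dist \<kappa> (graph_point u (f x)) Infinity) \<in> borel_measurable M"
  unfolding graph_point_def aux_dist.simps by measurable

section \<open>Representatives of derivatives, weights and admissible triples\<close>

lemma L2_fun_Dx:
  assumes "f \<in> space_X"
  shows "L2_fun (Dx f)" "distributional_derivative f (Dx f)"
proof -
  have "\<exists>g. L2_fun g \<and> distributional_derivative f g" using assms by (simp add: space_X_def)
  from someI_ex[OF this] show "L2_fun (Dx f)" "distributional_derivative f (Dx f)"
    by (simp_all add: Dx_def)
qed

lemma measurable_Dx: "f \<in> space_X \<Longrightarrow> Dx f \<in> borel_measurable borel"
  using L2_fun_Dx(1) by (simp add: L2_fun_def)

lemma integrable_Dx_square: "f \<in> space_X \<Longrightarrow> integrable lborel (\<lambda>x. (Dx f x)\<^sup>2)"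
  using L2_fun_Dx(1) by (simp add: L2_fun_def)

lemma measurable_space_X: "f \<in> space_X \<Longrightarrow> f \<in> borel_measurable borel"
  by (auto simp: space_X_def intro: borel_measurable_continuous_onI)

text \<open>The weights of a triple, phrased through the finite range, a property that compositions
  and pointwise operations inherit. Agreement with \<open>simple_function\<close> is
  \<open>unit_simple_iff\<close>.\<close>

definition unit_simple :: "(real \<Rightarrow> real) \<Rightarrow> bool" where
  "unit_simple \<phi> \<longleftrightarrow> \<phi> \<in> borel_measurable borel \<and> finite (range \<phi>) \<and> range \<phi> \<subseteq> {0..1}"

lemma unit_simple_measurable: "unit_simple \<phi> \<Longrightarrow> \<phi> \<in> borel_measurable borel"
  and unit_simple_nonneg: "unit_simple \<phi> \<Longrightarrow> 0 \<le> \<phi> x"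
  and unit_simple_le_1: "unit_simple \<phi> \<Longrightarrow> \<phi> x \<le> 1"
  by (auto simp: unit_simple_def image_subset_iff)

lemma unit_simple_iff: "unit_simple \<phi> \<longleftrightarrow> simple_function borel \<phi> \<and> range \<phi> \<subseteq> {0..1}"
proof
  assume "unit_simple \<phi>"
  then show "simple_function borel \<phi> \<and> range \<phi> \<subseteq> {0..1}"
    using simple_function_borel_measurable[of \<phi> borel] by (simp add: unit_simple_def)
next
  assume "simple_function borel \<phi> \<and> range \<phi> \<subseteq> {0..1}"
  then show "unit_simple \<phi>"
    using simple_functionD(1)[of borel \<phi>] borel_measurable_simple_function[of borel \<phi>]
    by (simp add: unit_simple_def)
qed

lemma unit_simple_compose:
  "unit_simple \<phi> \<Longrightarrow> f \<in> borel_measurable borel \<Longrightarrow> unit_simple (\<lambda>x. \<phi> (f x))"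
  unfolding unit_simple_def by (auto intro: finite_subset[of _ "range \<phi>"])

lemma unit_simple_binop:
  assumes "unit_simple \<phi>" "unit_simple \<eta>" "(\<lambda>x. b (\<phi> x) (\<eta> x)) \<in> borel_measurable borel"
    "\<And>x. b (\<phi> x) (\<eta> x) \<in> {0..1}"
  shows "unit_simple (\<lambda>x. b (\<phi> x) (\<eta> x))"
proof -
  have "range (\<lambda>x. b (\<phi> x) (\<eta> x)) \<subseteq> (\<lambda>(s, t). b s t) ` (range \<phi> \<times> range \<eta>)" by auto
  moreover have "finite (range \<phi> \<times> range \<eta>)" using assms by (simp add: unit_simple_def)
  ultimately have "finite (range (\<lambda>x. b (\<phi> x) (\<eta> x)))"
    using finite_subset finite_imageI by blast
  then show ?thesis using assms by (auto simp: unit_simple_def)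
qed

lemma unit_simple_mult: "unit_simple \<phi> \<Longrightarrow> unit_simple \<eta> \<Longrightarrow> unit_simple (\<lambda>x. \<phi> x * \<eta> x)"
  by (rule unit_simple_binop[where b = "\<lambda>s t. s * t"])
    (auto simp: unit_simple_nonneg unit_simple_le_1 intro!: mult_le_one borel_measurable_times
      dest: unit_simple_measurable)

lemma unit_simple_indicator: "A \<in> sets borel \<Longrightarrow> unit_simple (indicator A)"
  unfolding unit_simple_def
  by (auto simp: indicator_def intro: finite_subset[of _ "{0, 1}"])

lemma unit_simple_const: "c \<in> {0..1} \<Longrightarrow> unit_simple (\<lambda>x. c)"
  by (auto simp: unit_simple_def)

text \<open>The density stands in for \<open>deriv \<psi>\<close>, to which it is equal a.e., and
  absolute continuity of \<psi> is automatic. The converse passage is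
  \<open>admissibleE\<close>.\<close>

lemma admissibleI:
  assumes "unit_simple \<phi>1" "unit_simple \<phi>2" "transport_map \<psi> h"
    "AE x in lborel. \<phi>1 x * (Dx u x)\<^sup>2 = h x * \<phi>2 (\<psi> x) * (Dx v (\<psi> x))\<^sup>2"
  shows "admissible u v \<psi> \<phi>1 \<phi>2"
proof -
  interpret transport_map \<psi> h by fact
  have "AE x in lborel. \<phi>1 x * (Dx u x)\<^sup>2 = deriv \<psi> x * \<phi>2 (\<psi> x) * (Dx v (\<psi> x))\<^sup>2"
    using assms(4) AE_deriv by eventually_elim simp
  then show ?thesis
    using assms mono_map surj_map absolutely_continuous_map
    by (simp add: admissible_def transport_triple_def unit_simple_iff)
qed

lemma admissibleE:
  assumes "admissible u v \<psi> \<phi>1 \<phi>2"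
  obtains h where "unit_simple \<phi>1" "unit_simple \<phi>2" "transport_map \<psi> h"
    "AE x in lborel. \<phi>1 x * (Dx u x)\<^sup>2 = h x * \<phi>2 (\<psi> x) * (Dx v (\<psi> x))\<^sup>2"
proof -
  have t: "mono \<psi>" "surj \<psi>" "absolutely_continuous_fun \<psi>" "unit_simple \<phi>1" "unit_simple \<phi>2"
    using assms by (auto simp: admissible_def transport_triple_def unit_simple_iff)
  obtain h where h: "transport_map \<psi> h"
    using transport_map_of_absolutely_continuous[OF t(1-3)] by blast
  then interpret transport_map \<psi> h .
  have "AE x in lborel. \<phi>1 x * (Dx u x)\<^sup>2 = deriv \<psi> x * \<phi>2 (\<psi> x) * (Dx v (\<psi> x))\<^sup>2"
    using assms by (simp add: admissible_def)
  then have "AE x in lborel. \<phi>1 x * (Dx u x)\<^sup>2 = h x * \<phi>2 (\<psi> x) * (Dx v (\<psi> x))\<^sup>2"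
    using AE_deriv by eventually_elim simp
  then show ?thesis using that t h by blast
qed

text \<open>The substitution y = \<psi> x frees the third term from \<psi>: it becomes the cost of
  the energy of v that is not delivered.\<close>

lemma cost_eq:
  assumes "transport_map \<psi> h" "u \<in> space_X" "v \<in> space_X" "unit_simple \<phi>1" "unit_simple \<phi>2"
  shows "cost \<kappa> u v \<psi> \<phi>1 \<phi>2 =
    nnint (\<lambda>x. aux_dist \<kappa> (graph_point u x) (graph_point v (\<psi> x)) * \<phi>1 x * (Dx u x)\<^sup>2) +
    nnint (\<lambda>x. aux_dist \<kappa> (graph_point u x) Infinity * (1 - \<phi>1 x) * (Dx u x)\<^sup>2) +
    nnint (\<lambda>y. aux_dist \<kappa> (graph_point v y) Infinity * (1 - \<phi>2 y) * (Dx v y)\<^sup>2)"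
proof -
  interpret transport_map \<psi> h by fact
  note [measurable] = measurable_Dx[OF assms(3)] unit_simple_measurable[OF assms(5)]
  have "nnint (\<lambda>x. aux_dist \<kappa> (graph_point v (\<psi> x)) Infinity * (1 - \<phi>2 (\<psi> x)) * (Dx v (\<psi> x))\<^sup>2
      * deriv \<psi> x)
    = (\<integral>\<^sup>+x. ennreal (aux_dist \<kappa> (graph_point v (\<psi> x)) Infinity * (1 - \<phi>2 (\<psi> x)) * (Dx v (\<psi> x))\<^sup>2)
      * ennreal (h x) \<partial>lborel)"
    using AE_deriv by (intro nn_integral_cong_AE, eventually_elim)
      (simp add: ennreal_mult'' density_nonneg)
  also have "\<dots> = nnint (\<lambda>y. aux_dist \<kappa> (graph_point v y) Infinity * (1 - \<phi>2 y) * (Dx v y)\<^sup>2)"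
    by (rule change_of_variables) measurable
  finally show ?thesis by (simp add: cost_def Let_def)
qed

text \<open>A finite summand is moved to the other side by subtraction, so the infima can be taken
  one at a time; an infinite summand makes the claim trivial.\<close>

lemma ennreal_le_Inf_add_Inf:
  fixes a :: ennreal
  assumes "\<And>x y. x \<in> A \<Longrightarrow> y \<in> B \<Longrightarrow> a \<le> x + y"
  shows "a \<le> Inf A + Inf B"
proof -
  have one: "a \<le> Inf A + y" if "\<And>x. x \<in> A \<Longrightarrow> a \<le> x + y" for A and y :: ennreal
  proof (cases "y = \<infinity>")
    case False
    have iff: "a - y \<le> z \<longleftrightarrow> a \<le> z + y" for z
      using False by (simp add: ennreal_minus_le_iff add.commute[of y])
    show ?thesis unfolding iff[symmetric] by (intro Inf_greatest) (simp add: iff that)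
  qed simp
  have "a \<le> Inf B + Inf A"
  proof (intro one)
    fix y assume "y \<in> B"
    then show "a \<le> y + Inf A" using one[of A y] assms by (simp add: add.commute)
  qed
  then show ?thesis by (simp add: add.commute)
qed

text \<open>At an intermediate point, where the first transport delivers the fraction \<open>\<phi>\<^sub>2\<close> of the
  energy and the second one picks up the fraction \<open>p\<^sub>2\<close>, the composition moves their minimum. What
  is lost costs no more than before because \<open>\<bar>\<phi>\<^sub>2 - p\<^sub>2\<bar> \<le> (1 - \<phi>\<^sub>2) + (1 - p\<^sub>2)\<close>.\<close>

lemma J_triangle:
  assumes "0 \<le> \<kappa>" and X: "u \<in> space_X" "v \<in> space_X" "w \<in> space_X"
  shows "J \<kappa> u w \<le> J \<kappa> u v + J \<kappa> v w"
proof -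
  have "J \<kappa> u w \<le> cost \<kappa> u v F \<phi>1 \<phi>2 + cost \<kappa> v w G p2 p3"
    if 1: "admissible u v F \<phi>1 \<phi>2" and 2: "admissible v w G p2 p3" for F \<phi>1 \<phi>2 G p2 p3
  proof -
    obtain h1 where s1: "unit_simple \<phi>1" "unit_simple \<phi>2" and T1: "transport_map F h1"
      and eq1: "AE x in lborel. \<phi>1 x * (Dx u x)\<^sup>2 = h1 x * \<phi>2 (F x) * (Dx v (F x))\<^sup>2"
      using 1 by (rule admissibleE)
    obtain h2 where s2: "unit_simple p2" "unit_simple p3" and T2: "transport_map G h2"
      and eq2: "AE y in lborel. p2 y * (Dx v y)\<^sup>2 = h2 y * p3 (G y) * (Dx w (G y))\<^sup>2"
      using 2 by (rule admissibleE)
    interpret T1: transport_map F h1 by fact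
    interpret T2: transport_map G h2 by fact
    note [measurable] = X[THEN measurable_Dx] X[THEN measurable_space_X]
      s1[THEN unit_simple_measurable] s2[THEN unit_simple_measurable]
    note unit [simp] = s1[THEN unit_simple_nonneg] s2[THEN unit_simple_nonneg]
      s1[THEN unit_simple_le_1] s2[THEN unit_simple_le_1]
    \<comment> \<open>Of the energy delivered at y the fraction r goes on, and of the energy
      collected at y the fraction q is supplied by it. If a denominator is 0 then so is c, and 0 / 0
      = 0 keeps \<open>r\<phi>\<close> and \<open>qp\<close> true.\<close>
    define c where "c y = min (\<phi>2 y) (p2 y)" for y
    define r where "r y = c y / \<phi>2 y" for y
    define q where "q y = c y / p2 y" for y
    have c01: "0 \<le> c y" "c y \<le> \<phi>2 y" "c y \<le> p2 y" for y
      by (simp_all add: c_def)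
    have r\<phi>: "r y * \<phi>2 y = c y" for y using c01[of y] by (auto simp: r_def)
    have qp: "q y * p2 y = c y" for y using c01[of y] by (auto simp: q_def)
    have r01: "0 \<le> r y" "r y \<le> 1" for y
      using c01[of y] by (auto simp: r_def divide_le_eq_1 less_le)
    have q01: "0 \<le> q y" "q y \<le> 1" for y
      using c01[of y] by (auto simp: q_def divide_le_eq_1 less_le)
    have [measurable]: "c \<in> borel_measurable borel" unfolding c_def by measurable
    have [measurable]: "r \<in> borel_measurable borel" "q \<in> borel_measurable borel"
      unfolding r_def q_def by measurable
    have r_s: "unit_simple r"
      using unit_simple_binop[OF s1(2) s2(1), of "\<lambda>s t. min s t / s"] r01
      unfolding r_def c_def by simp
    have q_s: "unit_simple q"
      using unit_simple_binop[OF s1(2) s2(1), of "\<lambda>s t. min s t / t"] q01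
      unfolding q_def c_def by simp
    define \<psi> where "\<psi> x = G (F x)" for x
    define h where "h x = h2 (F x) * h1 x" for x
    define m1 where "m1 x = \<phi>1 x * r (F x)" for x
    \<comment> \<open>\<open>rinv G\<close> recovers the intermediate point from its image, except
      where h2 vanishes and nothing is moved.\<close>
    define m3 where "m3 z = p3 z * q (rinv G z)" for z
    have T: "transport_map \<psi> h"
      unfolding \<psi>_def h_def by (rule transport_map_compose[OF T1 T2])
    have m1: "unit_simple m1" and m3: "unit_simple m3"
      unfolding m1_def m3_def
      by (intro unit_simple_mult s1 s2 unit_simple_compose[OF r_s] unit_simple_compose[OF q_s]; simp)+
    note [measurable] = m1[THEN unit_simple_measurable] m3[THEN unit_simple_measurable]
    have cv: "AE y in lborel. c y * (Dx v y)\<^sup>2 = h2 y * m3 (G y) * (Dx w (G y))\<^sup>2"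
      using eq2 T2.rinv_map_AE
    proof eventually_elim
      case (elim y)
      have "c y * (Dx v y)\<^sup>2 = q y * (p2 y * (Dx v y)\<^sup>2)" by (simp add: qp[symmetric])
      also have "\<dots> = q y * (h2 y * p3 (G y) * (Dx w (G y))\<^sup>2)" by (simp add: elim(1))
      also have "\<dots> = h2 y * m3 (G y) * (Dx w (G y))\<^sup>2" using elim(2) by (auto simp: m3_def)
      finally show ?case .
    qed
    have adm: "admissible u w \<psi> m1 m3"
    proof (rule admissibleI[OF m1 m3 T])
      show "AE x in lborel. m1 x * (Dx u x)\<^sup>2 = h x * m3 (\<psi> x) * (Dx w (\<psi> x))\<^sup>2"
        using eq1 T1.AE_map[OF cv]
      proof eventually_elim
        case (elim x)
        have "m1 x * (Dx u x)\<^sup>2 = r (F x) * (\<phi>1 x * (Dx u x)\<^sup>2)" by (simp add: m1_def)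
        also have "\<dots> = h1 x * (c (F x) * (Dx v (F x))\<^sup>2)"
          by (simp add: elim(1) r\<phi>[symmetric])
        also have "\<dots> = h x * m3 (\<psi> x) * (Dx w (\<psi> x))\<^sup>2"
          using elim(2) by (auto simp: h_def \<psi>_def)
        finally show ?case .
      qed
    qed
    define A where "A x = aux_dist \<kappa> (graph_point u x) (graph_point v (F x))" for x
    define B where "B y = aux_dist \<kappa> (graph_point v y) (graph_point w (G y))" for y
    define C where "C x = aux_dist \<kappa> (graph_point u x) (graph_point w (\<psi> x))" for x
    define eu where "eu x = aux_dist \<kappa> (graph_point u x) Infinity" for x
    define ev where "ev x = aux_dist \<kappa> (graph_point v x) Infinity" for x
    define ew where "ew x = aux_dist \<kappa> (graph_point w x) Infinity" for x
    have [measurable]: "A \<in> borel_measurable borel" "B \<in> borel_measurable borel"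
      "C \<in> borel_measurable borel" "eu \<in> borel_measurable borel" "ev \<in> borel_measurable borel"
      "ew \<in> borel_measurable borel"
      unfolding A_def B_def C_def eu_def ev_def ew_def \<psi>_def by measurable
    have nn [simp]: "0 \<le> A x" "0 \<le> B x" "0 \<le> C x" "0 \<le> eu x" "0 \<le> ev x" "0 \<le> ew x" for x
      unfolding A_def B_def C_def eu_def ev_def ew_def by (simp_all add: aux_dist_nonneg assms)
    have tC: "C x \<le> A x + B (F x)" for x
      unfolding A_def B_def C_def \<psi>_def by (rule aux_dist_triangle[OF assms(1)])
    have tu: "eu x \<le> A x + ev (F x)" for x
      unfolding A_def eu_def ev_def by (rule aux_dist_triangle[OF assms(1)])
    have tw: "ew (G y) \<le> B y + ev y" for y
      unfolding B_def ew_def ev_def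
      using aux_dist_triangle[OF assms(1), of "graph_point w (G y)" Infinity "graph_point v y"]
      by (simp add: aux_dist_commute)
    let ?U = "\<lambda>x. (Dx u x)\<^sup>2" and ?V = "\<lambda>x. (Dx v x)\<^sup>2" and ?W = "\<lambda>x. (Dx w x)\<^sup>2"
    let ?a1 = "nnint (\<lambda>x. A x * \<phi>1 x * ?U x)"
    let ?a2 = "nnint (\<lambda>x. eu x * (1 - \<phi>1 x) * ?U x)"
    let ?a3 = "nnint (\<lambda>y. ev y * (1 - \<phi>2 y) * ?V y)"
    let ?b1 = "nnint (\<lambda>y. B y * p2 y * ?V y)"
    let ?b2 = "nnint (\<lambda>y. ev y * (1 - p2 y) * ?V y)"
    let ?b3 = "nnint (\<lambda>z. ew z * (1 - p3 z) * ?W z)"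
    let ?m1 = "nnint (\<lambda>y. (B y * c y + ev y * (\<phi>2 y - c y)) * ?V y)"
    let ?m2 = "nnint (\<lambda>y. (B y + ev y) * (p2 y - c y) * ?V y)"
    let ?l1 = "nnint (\<lambda>x. C x * m1 x * ?U x)"
    let ?l2 = "nnint (\<lambda>x. eu x * (1 - m1 x) * ?U x)"
    let ?l3 = "nnint (\<lambda>z. ew z * (1 - m3 z) * ?W z)"
    \<comment> \<open>Energy that goes all the way costs at most A + B. The part stopped at the
      intermediate point is now dropped at its origin, where eu is at most A + ev.\<close>
    have left: "?l1 + ?l2
      \<le> ?a1 + ?a2
        + ?m1"
    proof -
      have mu: "m1 x \<le> \<phi>1 x" "0 \<le> m1 x" "m1 x \<le> 1" for x
        using r01[of "F x"] unit_simple_le_1[OF m1]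
        by (auto simp: m1_def mult_left_le)
      have "?l1 + ?l2
        = nnint (\<lambda>x. C x * m1 x * ?U x + eu x * (1 - m1 x) * ?U x)"
        using mu by (subst nn_integral_add[symmetric]) auto
      also have "\<dots> \<le> (\<integral>\<^sup>+x. ennreal (A x * \<phi>1 x * ?U x) + ennreal (eu x * (1 - \<phi>1 x) * ?U x)
          + ennreal ((B (F x) * c (F x) + ev (F x) * (\<phi>2 (F x) - c (F x))) * ?V (F x))
            * ennreal (h1 x) \<partial>lborel)"
        using eq1
      proof (intro nn_integral_mono_AE, eventually_elim)
        case (elim x)
        have "C x * m1 x + eu x * (1 - m1 x)
            = C x * m1 x + eu x * (\<phi>1 x - m1 x) + eu x * (1 - \<phi>1 x)" by (simp add: algebra_simps)
        also have "\<dots> \<le> (A x + B (F x)) * m1 x + (A x + ev (F x)) * (\<phi>1 x - m1 x)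
            + eu x * (1 - \<phi>1 x)"
          using tC tu mu by (intro add_mono mult_right_mono) auto
        finally have "(C x * m1 x + eu x * (1 - m1 x)) * ?U x \<le> ((A x + B (F x)) * m1 x
            + (A x + ev (F x)) * (\<phi>1 x - m1 x) + eu x * (1 - \<phi>1 x)) * ?U x"
          by (rule mult_right_mono) simp
        also have "\<dots> = A x * \<phi>1 x * ?U x + eu x * (1 - \<phi>1 x) * ?U x
            + (B (F x) * r (F x) + ev (F x) * (1 - r (F x))) * (\<phi>1 x * ?U x)"
          by (simp add: m1_def algebra_simps)
        also have "(B (F x) * r (F x) + ev (F x) * (1 - r (F x))) * (\<phi>1 x * ?U x)
          = (B (F x) * c (F x) + ev (F x) * (\<phi>2 (F x) - c (F x))) * ?V (F x) * h1 x"
          unfolding elim r\<phi>[symmetric] by (simp add: algebra_simps)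
        finally have le: "(C x * m1 x + eu x * (1 - m1 x)) * ?U x
          \<le> A x * \<phi>1 x * ?U x + eu x * (1 - \<phi>1 x) * ?U x
            + (B (F x) * c (F x) + ev (F x) * (\<phi>2 (F x) - c (F x))) * ?V (F x) * h1 x" .
        have split: "ennreal (a + b + g * k) = ennreal a + ennreal b + ennreal g * ennreal k"
          if "0 \<le> a" "0 \<le> b" "0 \<le> g" "0 \<le> k" for a b g k
          using that by (simp add: ennreal_mult)
        show ?case
          unfolding distrib_right[symmetric]
          using ennreal_leI[OF le] c01[of "F x"] T1.density_nonneg[of x]
          by (subst split[symmetric]) auto
      qed
      also have "\<dots> = ?a1 + ?a2
        + (\<integral>\<^sup>+x. ennreal ((B (F x) * c (F x) + ev (F x) * (\<phi>2 (F x) - c (F x))) * ?V (F x))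
            * ennreal (h1 x) \<partial>lborel)"
        by (subst nn_integral_add, measurable)+
      also have "(\<integral>\<^sup>+x. ennreal ((B (F x) * c (F x) + ev (F x) * (\<phi>2 (F x) - c (F x))) * ?V (F x))
            * ennreal (h1 x) \<partial>lborel)
          = ?m1"
        by (rule T1.change_of_variables) measurable
      finally show ?thesis .
    qed
    \<comment> \<open>Energy of w that the second transport supplied beyond what still arrives
      counts as undelivered at its destination, where ew is at most B + ev.\<close>
    have right: "?l3
      \<le> ?b3
        + ?m2"
    proof -
      have mw: "m3 z \<le> p3 z" "0 \<le> m3 z" for z
        using q01[of "rinv G z"] by (auto simp: m3_def mult_left_le)
      have "?l3
        = (\<integral>\<^sup>+z. ennreal (ew z * (1 - p3 z) * ?W z) + ennreal (ew z * (p3 z - m3 z) * ?W z) \<partial>lborel)"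
      proof (rule nn_integral_cong)
        fix z
        have "ew z * (1 - m3 z) * ?W z = ew z * (1 - p3 z) * ?W z + ew z * (p3 z - m3 z) * ?W z"
          by (simp add: algebra_simps)
        then show "ennreal (ew z * (1 - m3 z) * ?W z)
            = ennreal (ew z * (1 - p3 z) * ?W z) + ennreal (ew z * (p3 z - m3 z) * ?W z)"
          using mw by (simp add: ennreal_plus)
      qed
      also have "\<dots> = ?b3
          + nnint (\<lambda>z. ew z * (p3 z - m3 z) * ?W z)"
        by (subst nn_integral_add) auto
      finally have split: "?l3
        = ?b3
          + nnint (\<lambda>z. ew z * (p3 z - m3 z) * ?W z)" .
      have "nnint (\<lambda>z. ew z * (p3 z - m3 z) * ?W z)
          = (\<integral>\<^sup>+y. ennreal (ew (G y) * (p3 (G y) - m3 (G y)) * ?W (G y)) * ennreal (h2 y) \<partial>lborel)"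
        by (rule T2.change_of_variables[symmetric]) measurable
      also have "\<dots> \<le> ?m2"
      proof (rule nn_integral_mono_AE, use eq2 cv in eventually_elim)
        case (elim y)
        have "ew (G y) * (p3 (G y) - m3 (G y)) * ?W (G y) * h2 y
          = ew (G y) * (h2 y * p3 (G y) * ?W (G y) - h2 y * m3 (G y) * ?W (G y))"
          by (simp add: algebra_simps)
        moreover have "h2 y * p3 (G y) * ?W (G y) - h2 y * m3 (G y) * ?W (G y)
          = (p2 y - c y) * ?V y"
          unfolding elim[symmetric] by (simp add: algebra_simps)
        moreover have "ew (G y) * ((p2 y - c y) * ?V y) \<le> (B y + ev y) * ((p2 y - c y) * ?V y)"
          using tw[of y] c01[of y] by (intro mult_right_mono) auto
        ultimately have "ew (G y) * (p3 (G y) - m3 (G y)) * ?W (G y) * h2 y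
          \<le> (B y + ev y) * ((p2 y - c y) * ?V y)" by (simp only:)
        then show ?case
          using T2.density_nonneg[of y]
          by (simp add: ennreal_mult''[symmetric] ennreal_leI mult.assoc)
      qed
      finally show ?thesis unfolding split by (rule add_left_mono)
    qed
    have middle: "?m1
        + ?m2
      \<le> ?a3
        + (?b1 + ?b2)"
    proof -
      have "ennreal ((B y * c y + ev y * (\<phi>2 y - c y)) * ?V y) + ennreal ((B y + ev y) * (p2 y - c y) * ?V y)
        \<le> ennreal (ev y * (1 - \<phi>2 y) * ?V y) + (ennreal (B y * p2 y * ?V y) + ennreal (ev y * (1 - p2 y) * ?V y))" for y
      proof -
        have "\<phi>2 y + p2 y - 2 * c y \<le> (1 - \<phi>2 y) + (1 - p2 y)"
          using unit_simple_le_1[OF s1(2), of y] unit_simple_le_1[OF s2(1), of y]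
          unfolding c_def by linarith
        from mult_left_mono[OF this nn(5)[of y]]
        have "B y * c y + ev y * (\<phi>2 y - c y) + (B y + ev y) * (p2 y - c y)
          \<le> ev y * (1 - \<phi>2 y) + (B y * p2 y + ev y * (1 - p2 y))"
          by (simp add: algebra_simps)
        then have "(B y * c y + ev y * (\<phi>2 y - c y) + (B y + ev y) * (p2 y - c y)) * ?V y
          \<le> (ev y * (1 - \<phi>2 y) + (B y * p2 y + ev y * (1 - p2 y))) * ?V y"
          by (rule mult_right_mono) simp
        then have "ennreal ((B y * c y + ev y * (\<phi>2 y - c y)) * ?V y + (B y + ev y) * (p2 y - c y) * ?V y)
          \<le> ennreal (ev y * (1 - \<phi>2 y) * ?V y + (B y * p2 y * ?V y + ev y * (1 - p2 y) * ?V y))"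
          by (intro ennreal_leI) (simp add: distrib_right)
        then show ?thesis using c01[of y] by (simp add: ennreal_plus)
      qed
      then have "(\<integral>\<^sup>+y. ennreal ((B y * c y + ev y * (\<phi>2 y - c y)) * ?V y) + ennreal ((B y + ev y) * (p2 y - c y) * ?V y) \<partial>lborel)
        \<le> (\<integral>\<^sup>+y. ennreal (ev y * (1 - \<phi>2 y) * ?V y) + (ennreal (B y * p2 y * ?V y) + ennreal (ev y * (1 - p2 y) * ?V y)) \<partial>lborel)"
        by (rule nn_integral_mono)
      then show ?thesis by (simp add: nn_integral_add)
    qed
    have "J \<kappa> u w \<le> cost \<kappa> u w \<psi> m1 m3"
      unfolding J_def using adm by (intro Inf_lower) auto
    also have "\<dots> = ?l1 + ?l2
        + ?l3"
      unfolding cost_eq[OF T X(1,3) m1 m3] C_def eu_def ew_def ..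
    also have "\<dots> \<le> ?a1 + ?a2
        + ?m1
        + (?b3
          + ?m2)"
      by (rule add_mono[OF left right])
    also have "\<dots> = ?a1 + ?a2
        + (?m1
          + ?m2)
        + ?b3"
      by (simp add: ac_simps)
    also have "\<dots> \<le> ?a1 + ?a2
        + (?a3
        + (?b1 + ?b2))
        + ?b3"
      by (intro add_mono order_refl middle)
    also have "\<dots> = cost \<kappa> u v F \<phi>1 \<phi>2 + cost \<kappa> v w G p2 p3"
      unfolding cost_eq[OF T1 X(1,2) s1] cost_eq[OF T2 X(2,3) s2] A_def B_def eu_def ev_def ew_def
      by (simp add: ac_simps)
    finally show ?thesis .
  qed
  then show ?thesis
    unfolding J_def[of \<kappa> u v] J_def[of \<kappa> v w] by (intro ennreal_le_Inf_add_Inf) blast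
qed

subsection \<open>Reversal of transports\<close>

lemma nn_integral_interval_split:
  fixes f :: "real \<Rightarrow> ennreal"
  assumes [measurable]: "f \<in> borel_measurable borel" and "a \<le> b" "b \<le> c"
  shows "(\<integral>\<^sup>+x. f x * indicator {a..c} x \<partial>lborel)
    = (\<integral>\<^sup>+x. f x * indicator {a..b} x \<partial>lborel) + (\<integral>\<^sup>+x. f x * indicator {b..c} x \<partial>lborel)"
proof -
  have "AE x in lborel. x \<noteq> b" by (rule AE_lborel_singleton)
  then have "AE x in lborel. f x * indicator {a..c} x
      = f x * indicator {a..b} x + f x * indicator {b..c} x"
    by eventually_elim (use assms(2,3) in \<open>auto simp: indicator_def\<close>)
  then have "(\<integral>\<^sup>+x. f x * indicator {a..c} x \<partial>lborel)
    = (\<integral>\<^sup>+x. f x * indicator {a..b} x + f x * indicator {b..c} x \<partial>lborel)"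
    by (rule nn_integral_cong_AE)
  also have "\<dots> = (\<integral>\<^sup>+x. f x * indicator {a..b} x \<partial>lborel) + (\<integral>\<^sup>+x. f x * indicator {b..c} x \<partial>lborel)"
    by (intro nn_integral_add) auto
  finally show ?thesis .
qed

text \<open>Bounded distance to the identity makes F onto: on the interval of radius |C| around y it
  is an indefinite integral, hence continuous, and it passes from below y to above y.\<close>

lemma transport_mapI_near_identity:
  assumes [measurable]: "h \<in> borel_measurable borel" and nonneg: "\<And>x. 0 \<le> h x" and "mono F"
    and int: "\<And>a b. a \<le> b \<Longrightarrow>
      nnint_on {a..b} h = ennreal (F b - F a)"
    and near: "\<And>x. \<bar>F x - x\<bar> \<le> C"
  shows "transport_map F h"
proof
  have mono_F: "F a \<le> F b" if "a \<le> b" for a b using \<open>mono F\<close> that by (simp add: mono_def)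
  have has_int: "(h has_integral (F b - F a)) {a..b}" if "a \<le> b" for a b
    using integral_Icc_if_nn_integral(3)[OF assms(1) nonneg _ int[OF that]] mono_F[OF that] by simp
  show "surj F"
    unfolding surj_def
  proof
    fix y
    define a where "a = y - \<bar>C\<bar>"
    define b where "b = y + \<bar>C\<bar>"
    have "continuous_on {a..b} (\<lambda>x. F a + integral {a..x} h)"
      using has_int[of a b] by (intro continuous_intros indefinite_integral_continuous_1)
        (auto simp: a_def b_def integrable_on_def)
    moreover have "F a + integral {a..x} h = F x" if "x \<in> {a..b}" for x
      using has_int[of a x] that by (simp add: integral_unique)
    ultimately have "continuous_on {a..b} F" by (rule continuous_on_eq)
    moreover have "F a \<le> y" "y \<le> F b" "a \<le> b"
      using near[of a] near[of b] by (auto simp: a_def b_def)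
    ultimately show "\<exists>x. y = F x" using IVT'[of F a y b] by metis
  qed
qed (use assms in auto)

lemma density_primitive:
  fixes H :: "real \<Rightarrow> real"
  assumes [measurable]: "H \<in> borel_measurable borel"
    and fin: "\<And>a b. nnint_on {a..b} H < \<infinity>"
  obtains F where "mono F" "F l = c"
    "\<And>a b. a \<le> b \<Longrightarrow> nnint_on {a..b} H = ennreal (F b - F a)"
proof -
  define I where "I a b = enn2real (nnint_on {a..b} H)" for a b
  have I: "nnint_on {a..b} H = ennreal (I a b)" "0 \<le> I a b" for a b
    using fin[of a b] by (auto simp: I_def)
  have split: "I a c = I a b + I b c" if "a \<le> b" "b \<le> c" for a b c
  proof -
    have "ennreal (I a c) = ennreal (I a b + I b c)"
      using nn_integral_interval_split[OF _ that, of "\<lambda>x. ennreal (H x)"] I by (simp add: ennreal_plus)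
    then show ?thesis
      by (subst (asm) ennreal_inj) (auto intro: I(2) add_nonneg_nonneg)
  qed
  define F where "F x = c + (if l \<le> x then I l x else - I x l)" for x
  have diff: "F b - F a = I a b" if "a \<le> b" for a b
    using that split[of l a b] split[of a l b] split[of a b l] I(2) by (auto simp: F_def)
  have "I l l = 0" using split[of l l l] by simp
  then have "F l = c" by (simp add: F_def)
  moreover have "mono F"
  proof (rule monoI)
    fix a b :: real assume "a \<le> b"
    then show "F a \<le> F b" using diff[of a b] I(2)[of a b] by simp
  qed
  ultimately show ?thesis using that I(1) diff by metis
qed

text \<open>A density that is positive a.e. excludes flat pieces, so F is a bijection with inverse
  \<open>rinv F\<close>. The substitution y = F x turns the mass of \<open>1 / H (G y)\<close> over
  an interval into a length.\<close>

lemma transport_map_inverse: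
  assumes T: "transport_map F H" and pos: "AE x in lborel. 0 < H x"
  obtains G k where "transport_map G k" "\<And>x. G (F x) = x" "\<And>y. F (G y) = y" "\<And>y. k y = 1 / H (G y)"
proof -
  interpret transport_map F H by fact
  have strict: "F a < F b" if "a < b" for a b
  proof (rule ccontr)
    assume "\<not> F a < F b"
    then have "F a = F b" using map_mono[of a b] that by simp
    from flat[OF this] that have "AE x in lborel. x \<in> {a..b} \<longrightarrow> H x = 0" by simp
    with pos have "AE x in lborel. x \<notin> {a..b}" by eventually_elim auto
    then have "emeasure lborel {a..b} = 0"
      by (subst (asm) AE_iff_measurable[of "{a..b}"]) auto
    then show False using that by simp
  qed
  define G where "G = rinv F"
  have FG [simp]: "F (G y) = y" for y by (simp add: G_def)
  have GF [simp]: "G (F x) = x" for x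
    using strict[of "G (F x)" x] strict[of x "G (F x)"] by (cases "G (F x)" x rule: linorder_cases) auto
  have [measurable]: "G \<in> borel_measurable borel" unfolding G_def by measurable
  have "transport_map G (\<lambda>y. 1 / H (G y))"
  proof
    show "mono G"
      by (intro monoI) (metis G_def rinv_strict_mono less_eq_real_def)
    show "surj G" by (metis GF surjI)
    show "0 \<le> 1 / H (G x)" for x by (simp add: density_nonneg)
    fix a b :: real
    assume "a \<le> b"
    have iff: "F x \<in> {a..b} \<longleftrightarrow> x \<in> {G a..G b}" for x
      using strict[of x "G a"] strict[of "G b" x] map_mono[of "G a" x] map_mono[of x "G b"]
      by (auto simp: not_less[symmetric])
    have "nnint_on {a..b} (\<lambda>y. 1 / H (G y))
        = (\<integral>\<^sup>+x. ennreal (1 / H (G (F x))) * indicator {a..b} (F x) * ennreal (H x) \<partial>lborel)"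
      by (rule change_of_variables[symmetric]) measurable
    also have "\<dots> = (\<integral>\<^sup>+x. indicator {G a..G b} x \<partial>lborel)"
      using pos
    proof (intro nn_integral_cong_AE, eventually_elim)
      case (elim x)
      then have "ennreal (1 / H x) * ennreal (H x) = 1"
        by (simp add: ennreal_mult[symmetric])
      then show ?case using iff[of x] by (simp add: indicator_def del: atLeastAtMost_iff)
    qed
    also have "\<dots> = ennreal (G b - G a)"
      using \<open>mono G\<close> \<open>a \<le> b\<close> by (simp add: mono_def)
    finally show "nnint_on {a..b} (\<lambda>y. 1 / H (G y)) = ennreal (G b - G a)" .
  qed simp
  then show ?thesis using that GF FG by blast
qed

text \<open>\<open>\<psi>\<close> is kept on \<open>K\<close> and made affine on every bounded gap \<open>(lo x, hi x)\<close> of \<open>K\<close>. That the new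
  density \<open>H\<close> has the same integral over a gap is Tonelli's theorem for the symmetric kernel
  \<open>k x z = 1 / (hi x - lo x)\<close>, for \<open>x\<close> and \<open>z\<close> in a common gap, which avoids enumerating the gaps.\<close>

lemma transport_map_spread_gaps:
  assumes T: "transport_map \<psi> h" and K: "compact K" "K \<noteq> {}"
    and inj: "\<And>x. x \<in> K \<Longrightarrow> rinv \<psi> (\<psi> x) = x" and pos: "AE x in lborel. x \<in> K \<longrightarrow> 0 < h x"
  obtains F H where "transport_map F H" "AE x in lborel. 0 < H x"
    "\<And>x. x \<in> K \<Longrightarrow> F x = \<psi> x" "\<And>x. x \<in> K \<Longrightarrow> H x = h x"
proof -
  interpret transport_map \<psi> h by fact
  define l where "l = Inf K"
  define m where "m = Sup K"
  have bdd: "bdd_below K" "bdd_above K" "closed K"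
    using K(1) by (auto simp: compact_imp_closed bounded_imp_bdd_below bounded_imp_bdd_above compact_imp_bounded)
  have lm: "l \<in> K" "m \<in> K" unfolding l_def m_def
    using closed_contains_Inf[OF K(2) bdd(1,3)] closed_contains_Sup[OF K(2) bdd(2,3)] by auto
  have Klm: "l \<le> x" "x \<le> m" if "x \<in> K" for x
    unfolding l_def m_def using that bdd by (auto intro: cInf_lower cSup_upper)
  have [measurable]: "K \<in> sets borel" using bdd(3) by (rule borel_closed)
  \<comment> \<open>The ends of the gap of K around x. Inserting l here and m in \<open>hi\<close>
    gives sensible values outside [l, m] too: both functions are monotone on the whole line and take
    values in K.\<close>
  define lo where "lo x = Sup (insert l (K \<inter> {..x}))" for x
  define hi where "hi x = Inf (insert m (K \<inter> {x..}))" for x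
  have loK: "lo x \<in> K" for x
  proof -
    have "lo x \<in> insert l (K \<inter> {..x})" unfolding lo_def
      using bdd by (intro closed_contains_Sup) (auto intro!: closed_insert closed_Int intro: bdd_above_mono[of K])
    then show ?thesis using lm by auto
  qed
  have hiK: "hi x \<in> K" for x
  proof -
    have "hi x \<in> insert m (K \<inter> {x..})" unfolding hi_def
      using bdd by (intro closed_contains_Inf) (auto intro!: closed_insert closed_Int intro: bdd_below_mono[of K])
    then show ?thesis using lm by auto
  qed
  have lo_ge: "z \<le> lo x" if "z \<in> K" "z \<le> x" for x z
    unfolding lo_def using that bdd by (intro cSup_upper) (auto intro: bdd_above_mono[of K])
  have hi_le: "hi x \<le> z" if "z \<in> K" "x \<le> z" for x z
    unfolding hi_def using that bdd by (intro cInf_lower) (auto intro: bdd_below_mono[of K])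
  have lo_le: "lo x \<le> x" if "l \<le> x" for x
    unfolding lo_def using that by (intro cSup_least) auto
  have hi_ge: "x \<le> hi x" if "x \<le> m" for x
    unfolding hi_def using that by (intro cInf_greatest) auto
  have "mono lo"
    unfolding lo_def by (intro monoI cSup_subset_mono) (use bdd in \<open>auto intro: bdd_above_mono[of K]\<close>)
  then have [measurable]: "lo \<in> borel_measurable borel" by (rule borel_measurable_mono)
  have "mono hi"
    unfolding hi_def by (intro monoI cInf_superset_mono) (use bdd in \<open>auto intro: bdd_below_mono[of K]\<close>)
  then have [measurable]: "hi \<in> borel_measurable borel" by (rule borel_measurable_mono)
  \<comment> \<open>Every point of K is the leftmost one of its level, so two points of K never
    share a value.\<close>
  have strict: "\<psi> x < \<psi> y" if "x \<in> K" "y \<in> K" "x < y" for x y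
    using map_mono[of x y] inj[OF that(1)] inj[OF that(2)] that(3) by (metis less_eq_real_def less_irrefl)
  \<comment> \<open>On a gap the slope is that of the chord, positive by \<open>strict\<close>.
    Outside [l, m] it is 1, which keeps the primitive at bounded distance from the identity and
    hence onto.\<close>
  define H where "H x = (if x \<in> K then h x else if x \<in> {l..m} then (\<psi> (hi x) - \<psi> (lo x)) / (hi x - lo x) else 1)" for x
  have [measurable]: "H \<in> borel_measurable borel" unfolding H_def by measurable
  have gap: "lo x < x" "x < hi x" if "x \<in> {l..m} - K" for x
    using lo_le[of x] hi_ge[of x] loK[of x] hiK[of x] that by (auto simp: less_le)
  have gap_no: "z \<notin> K" if "x \<in> {l..m} - K" "lo x < z" "z < hi x" for x z
    using lo_ge[of z x] hi_le[of z x] that by (cases "z \<le> x") auto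
  have gap_eq: "lo z = lo x" "hi z = hi x" if x: "x \<in> {l..m} - K" and z: "lo x < z" "z < hi x" for x z
  proof -
    have zlm: "z \<in> {l..m} - K"
      using gap_no[OF x z] z Klm[OF loK[of x]] Klm[OF hiK[of x]] by auto
    have "lo x \<le> lo z" using lo_ge[OF loK] z by simp
    moreover have "lo z < hi x" using gap(1)[OF zlm] z by simp
    ultimately show "lo z = lo x" using gap_no[OF x, of "lo z"] loK[of z] by fastforce
    have "hi z \<le> hi x" using hi_le[OF hiK] z by simp
    moreover have "lo x < hi z" using gap(2)[OF zlm] z by simp
    ultimately show "hi z = hi x" using gap_no[OF x, of "hi z"] hiK[of z] by fastforce
  qed
  have H_nonneg: "0 \<le> H x" for x
  proof (cases "x \<in> {l..m} - K")
    case True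
    then show ?thesis using gap[OF True] map_mono[of "lo x" "hi x"] by (auto simp: H_def)
  qed (auto simp: H_def density_nonneg)
  have H_pos: "AE x in lborel. 0 < H x"
    using pos
  proof eventually_elim
    case (elim x)
    show ?case
    proof (cases "x \<in> {l..m} - K")
      case True
      then show ?thesis using gap[OF True] strict[OF loK hiK, of x x] by (auto simp: H_def)
    qed (use elim in \<open>auto simp: H_def\<close>)
  qed
  have match: "nnint_on {l..b} H = ennreal (\<psi> b - \<psi> l)" if "b \<in> K" for b
  proof -
    define V where "V = {l..b} - K"
    have [measurable]: "V \<in> sets borel" unfolding V_def by measurable
    have V: "x \<in> {l..m} - K" if "x \<in> V" for x using that Klm[OF \<open>b \<in> K\<close>] by (auto simp: V_def)
    define k where "k x z = (if lo x = lo z \<and> hi x = hi z then ennreal (1 / (hi x - lo x)) else 0)" for x z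
    have [measurable]: "case_prod k \<in> borel_measurable (lborel \<Otimes>\<^sub>M lborel)"
      unfolding k_def by measurable
    have sym: "k x z = k z x" for x z by (auto simp: k_def)
    \<comment> \<open>For x in a gap, the kernel restricted to V is the uniform probability density
      of that gap.\<close>
    have kO: "k x z * indicator V z = ennreal (1 / (hi x - lo x)) * indicator {lo x<..<hi x} z"
      if x: "x \<in> V" for x z
    proof (cases "z \<in> {lo x<..<hi x}")
      case True
      have "hi x \<le> b" using hi_le[OF \<open>b \<in> K\<close>] x by (auto simp: V_def)
      then have "z \<in> V" using gap_no[OF V[OF x], of z] True Klm[OF loK[of x]] by (auto simp: V_def)
      then show ?thesis using gap_eq[OF V[OF x], of z] True by (simp add: k_def)
    next
      case False
      then have "\<not> (lo x = lo z \<and> hi x = hi z)" if "z \<in> V"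
        using gap[OF V[OF that]] by auto
      then show ?thesis using False by (auto simp: k_def indicator_def)
    qed
    have Ho: "(\<integral>\<^sup>+z. ennreal (h z) * indicator V z * k x z \<partial>lborel) = ennreal (H x)" if x: "x \<in> V" for x
    proof -
      have "(\<integral>\<^sup>+z. ennreal (h z) * indicator V z * k x z \<partial>lborel)
          = (\<integral>\<^sup>+z. ennreal (1 / (hi x - lo x)) * (ennreal (h z) * indicator {lo x..hi x} z) \<partial>lborel)"
      proof (rule nn_integral_cong_AE)
        have "AE z in lborel. z \<noteq> lo x \<and> z \<noteq> hi x" by (intro AE_conjI AE_lborel_singleton)
        then show "AE z in lborel. ennreal (h z) * indicator V z * k x z
            = ennreal (1 / (hi x - lo x)) * (ennreal (h z) * indicator {lo x..hi x} z)"
        proof eventually_elim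
          case (elim z)
          have "ennreal (h z) * indicator V z * k x z = ennreal (h z) * (k x z * indicator V z)"
            by (simp add: ac_simps)
          then show ?case unfolding kO[OF x] using elim by (auto simp: indicator_def ac_simps)
        qed
      qed
      also have "\<dots> = ennreal (1 / (hi x - lo x)) * ennreal (\<psi> (hi x) - \<psi> (lo x))"
        using gap[OF V[OF x]] by (subst nn_integral_cmult) (auto simp: nn_integral_interval)
      also have "\<dots> = ennreal (H x)"
        using gap[OF V[OF x]] V[OF x] map_mono[of "lo x" "hi x"]
        by (simp add: H_def ennreal_mult[symmetric])
      finally show ?thesis .
    qed
    have k1: "(\<integral>\<^sup>+x. k x z * indicator V x \<partial>lborel) = 1" if z: "z \<in> V" for z
    proof -
      have "(\<integral>\<^sup>+x. k x z * indicator V x \<partial>lborel)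
          = nnint_on {lo z<..<hi z} (\<lambda>x. 1 / (hi z - lo z))"
        by (subst sym) (simp add: kO[OF z])
      also have "\<dots> = 1"
        using gap[OF V[OF z]] by (simp add: nn_integral_cmult_indicator ennreal_mult[symmetric])
      finally show ?thesis .
    qed
    have "nnint_on V H
        = (\<integral>\<^sup>+x. (\<integral>\<^sup>+z. ennreal (h z) * indicator V z * k x z * indicator V x \<partial>lborel) \<partial>lborel)"
    proof (rule nn_integral_cong)
      fix x
      show "ennreal (H x) * indicator V x
          = (\<integral>\<^sup>+z. ennreal (h z) * indicator V z * k x z * indicator V x \<partial>lborel)"
        using Ho[of x] by (cases "x \<in> V") auto
    qed
    also have "\<dots> = (\<integral>\<^sup>+z. (\<integral>\<^sup>+x. ennreal (h z) * indicator V z * k x z * indicator V x \<partial>lborel) \<partial>lborel)"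
      by (rule lborel_pair.Fubini'[symmetric]) measurable
    also have "\<dots> = nnint_on V h"
    proof (rule nn_integral_cong)
      fix z
      have "(\<integral>\<^sup>+x. ennreal (h z) * indicator V z * k x z * indicator V x \<partial>lborel)
          = ennreal (h z) * indicator V z * (\<integral>\<^sup>+x. k x z * indicator V x \<partial>lborel)"
        by (subst nn_integral_cmult[symmetric]) (auto simp: ac_simps)
      then show "(\<integral>\<^sup>+x. ennreal (h z) * indicator V z * k x z * indicator V x \<partial>lborel)
          = ennreal (h z) * indicator V z"
        using k1[of z] by (cases "z \<in> V") auto
    qed
    finally have OO: "nnint_on V H = nnint_on V h" .
    have parts: "(\<integral>\<^sup>+x. f x * indicator {l..b} x \<partial>lborel)
        = (\<integral>\<^sup>+x. f x * indicator V x \<partial>lborel) + (\<integral>\<^sup>+x. f x * indicator (K \<inter> {l..b}) x \<partial>lborel)"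
      if [measurable]: "f \<in> borel_measurable borel" for f :: "real \<Rightarrow> ennreal"
      by (subst nn_integral_add[symmetric]) (auto intro!: nn_integral_cong simp: indicator_def V_def)
    have "nnint_on (K \<inter> {l..b}) H
        = nnint_on (K \<inter> {l..b}) h"
      by (intro nn_integral_cong) (auto simp: indicator_def H_def)
    then have "nnint_on {l..b} H
        = nnint_on {l..b} h"
      by (simp add: parts OO)
    then show ?thesis using nn_integral_interval[of l b] Klm[OF that] by simp
  qed
  have fin: "nnint_on {a..b} H < \<infinity>" for a b
  proof -
    have "nnint_on {a..b} H
        \<le> (\<integral>\<^sup>+x. ennreal (H x) * indicator {l..m} x + indicator {a..b} x \<partial>lborel)"
      by (intro nn_integral_mono) (auto simp: indicator_def H_def dest: Klm)
    also have "\<dots> = nnint_on {l..m} H + emeasure lborel {a..b}"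
      by (subst nn_integral_add) auto
    also have "\<dots> < \<infinity>"
      unfolding match[OF lm(2)] by (cases "a \<le> b") auto
    finally show ?thesis .
  qed
  obtain F where F: "mono F" "F l = \<psi> l"
    "\<And>a b. a \<le> b \<Longrightarrow> nnint_on {a..b} H = ennreal (F b - F a)"
    using density_primitive[of H l "\<psi> l", OF _ fin] by auto
  have F_mono: "F a \<le> F b" if "a \<le> b" for a b using F(1) that by (simp add: mono_def)
  have FK: "F x = \<psi> x" if "x \<in> K" for x
  proof -
    have "ennreal (F x - F l) = ennreal (\<psi> x - \<psi> l)"
      using match[OF that] F(3)[of l x] Klm[OF that] by simp
    then show ?thesis
      using F(2) F_mono[of l x] map_mono[of l x] Klm[OF that] by simp
  qed
  have outside: "F b - F a = b - a" if "a \<le> b" "b \<le> l \<or> m \<le> a" for a b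
  proof -
    have "AE x in lborel. x \<noteq> l \<and> x \<noteq> m" by (intro AE_conjI AE_lborel_singleton)
    then have "AE x in lborel. ennreal (H x) * indicator {a..b} x = indicator {a..b} x"
      by eventually_elim (use that in \<open>auto simp: indicator_def H_def dest: Klm\<close>)
    then have "nnint_on {a..b} H = (\<integral>\<^sup>+x. indicator {a..b} x \<partial>lborel)"
      by (rule nn_integral_cong_AE)
    then have "ennreal (F b - F a) = ennreal (b - a)" using F(3)[OF that(1)] that(1) by simp
    then show ?thesis using F_mono[OF that(1)] that(1) by simp
  qed
  have "transport_map F H"
  proof (rule transport_mapI_near_identity[where C = "\<bar>\<psi> l - l\<bar> + \<bar>\<psi> m - m\<bar> + (m - l)"])
    fix x
    have lem: "l \<le> m" using Klm[OF lm(1)] by simp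
    consider "x \<le> l" | "m \<le> x" | "l \<le> x" "x \<le> m" by linarith
    then show "\<bar>F x - x\<bar> \<le> \<bar>\<psi> l - l\<bar> + \<bar>\<psi> m - m\<bar> + (m - l)"
    proof cases
      case 1 then show ?thesis using outside[of x l] F(2) lem by auto
    next
      case 2 then show ?thesis using outside[of m x] FK[OF lm(2)] lem by auto
    next
      case 3 then show ?thesis using F_mono[of l x] F_mono[of x m] FK[OF lm(2)] F(2) by auto
    qed
  qed (use F H_nonneg in auto)
  then show ?thesis using that H_pos FK by (metis H_def)
qed

text \<open>The inverse of the map with affine gaps agrees with the inverse of \<psi> on the image
  of K, where its density is the reciprocal of h.\<close>

lemma transport_map_reverse:
  assumes T: "transport_map \<psi> h" and K: "compact K" "K \<noteq> {}"
    and inj: "\<And>x. x \<in> K \<Longrightarrow> rinv \<psi> (\<psi> x) = x" and pos: "AE x in lborel. x \<in> K \<longrightarrow> 0 < h x"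
  obtains G k where "transport_map G k" "\<And>x. x \<in> K \<Longrightarrow> G (\<psi> x) = x"
    "\<And>y. G y \<in> K \<Longrightarrow> \<psi> (G y) = y" "AE y in lborel. G y \<in> K \<longrightarrow> k y * h (G y) = 1"
proof -
  obtain F H where F: "transport_map F H" "AE x in lborel. 0 < H x"
    "\<And>x. x \<in> K \<Longrightarrow> F x = \<psi> x" "\<And>x. x \<in> K \<Longrightarrow> H x = h x"
    using transport_map_spread_gaps[OF T K inj pos] by blast
  obtain G k where G: "transport_map G k" "\<And>x. G (F x) = x" "\<And>y. F (G y) = y"
    "\<And>y. k y = 1 / H (G y)"
    using transport_map_inverse[OF F(1,2)] by blast
  have "AE y in lborel. k y = 0 \<or> 0 < H (G y)"
    by (rule transport_map.AE_map[OF G(1) F(2)])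
  \<comment> \<open>Where \<open>H (G y) = 0\<close>, the density k is 0 by the convention 1 / 0 =
    0. After substituting y = F x, the measure of this set is the integral of H over its own zero
    set, that is 0.\<close>
  moreover have "AE y in lborel. H (G y) = 0 \<longrightarrow> False"
  proof -
    interpret F: transport_map F H by fact
    interpret G: transport_map G k by fact
    have [measurable]: "{y. H (G y) = 0} \<in> sets borel" by measurable
    have "(\<integral>\<^sup>+y. indicator {y. H (G y) = 0} y \<partial>lborel)
        = (\<integral>\<^sup>+x. indicator {y. H (G y) = 0} (F x) * ennreal (H x) \<partial>lborel)"
      by (rule F.change_of_variables[symmetric]) measurable
    also have "\<dots> = (\<integral>\<^sup>+(x::real). 0 \<partial>lborel)"
      by (intro nn_integral_cong) (auto simp: G indicator_def)
    finally have "emeasure lborel {y. H (G y) = 0} = 0" by simp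
    then show ?thesis by (subst AE_iff_measurable[of "{y. H (G y) = 0}"]) auto
  qed
  ultimately have "AE y in lborel. G y \<in> K \<longrightarrow> k y * h (G y) = 1"
    by eventually_elim (auto simp: G F)
  moreover have "G (\<psi> x) = x" if "x \<in> K" for x using F(3)[OF that] G(2)[of x] by simp
  moreover have "\<psi> (G y) = y" if "G y \<in> K" for y using F(3)[OF that] G(3)[of y] by simp
  ultimately show ?thesis using that G(1) by blast
qed

text \<open>The energy \<phi>1 u_x^2 moved by \<psi> is finite; by admissibility and
  \<open>rinv_map_AE\<close> it lives where h is positive and points are leftmost on their level. A
  compact part carrying all but \<epsilon> of it is sent back; the rest costs at most \<kappa>\<pi>
  per unit at each end.\<close>

lemma J_reverse_le:
  assumes \<kappa>: "0 \<le> \<kappa>" and X: "u \<in> space_X" "v \<in> space_X"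
  shows "J \<kappa> v u \<le> J \<kappa> u v"
  unfolding J_def[of \<kappa> u v]
proof (rule Inf_greatest, clarify)
  fix \<psi> \<phi>1 \<phi>2
  assume "admissible u v \<psi> \<phi>1 \<phi>2"
  then obtain h where s: "unit_simple \<phi>1" "unit_simple \<phi>2" and T: "transport_map \<psi> h"
    and eq: "AE x in lborel. \<phi>1 x * (Dx u x)\<^sup>2 = h x * \<phi>2 (\<psi> x) * (Dx v (\<psi> x))\<^sup>2"
    by (rule admissibleE)
  interpret transport_map \<psi> h by fact
  note [measurable] = X[THEN measurable_Dx] X[THEN measurable_space_X] s[THEN unit_simple_measurable]
  note unit [simp] = s[THEN unit_simple_nonneg] s[THEN unit_simple_le_1]
  let ?U = "\<lambda>x. (Dx u x)\<^sup>2" and ?V = "\<lambda>x. (Dx v x)\<^sup>2"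
  define \<mu> where "\<mu> = density lborel (\<lambda>x. ennreal (\<phi>1 x * ?U x))"
  have [simp, measurable_cong]: "sets \<mu> = sets borel" by (simp add: \<mu>_def)
  have \<mu>_fin: "emeasure \<mu> (space \<mu>) \<noteq> \<infinity>"
  proof -
    have "emeasure \<mu> (space \<mu>) = nnint (\<lambda>x. \<phi>1 x * ?U x)"
      by (simp add: \<mu>_def emeasure_density)
    also have "\<dots> \<le> nnint (\<lambda>x. ?U x)"
      by (intro nn_integral_mono ennreal_leI) (simp add: mult_left_le_one_le)
    also have "\<dots> < \<infinity>" using integrable_Dx_square[OF X(1)]
      by (subst nn_integral_eq_integral) auto
    finally show ?thesis by simp
  qed
  define A where "A = {x. 0 < h x \<and> rinv \<psi> (\<psi> x) = x}"
  have [measurable]: "A \<in> sets borel" unfolding A_def by measurable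
  have "AE x in lborel. x \<notin> A \<longrightarrow> \<phi>1 x * ?U x = 0"
    using eq rinv_map_AE
    by eventually_elim (use density_nonneg in \<open>force simp: A_def less_le\<close>)
  then have offA: "emeasure \<mu> (- A) = 0"
    unfolding \<mu>_def
    by (subst emeasure_density) (auto simp: nn_integral_0_iff_AE indicator_def elim!: eventually_mono)
  show "J \<kappa> v u \<le> cost \<kappa> u v \<psi> \<phi>1 \<phi>2"
  proof (rule ennreal_le_epsilon)
    fix e :: real
    assume "0 < e"
    \<comment> \<open>Energy at most \<epsilon> is lost at each end, at a price of at most
      \<kappa>\<pi> per unit, which adds up to at most e. The summand 1 covers \<kappa> = 0.\<close>
    define \<epsilon> where "\<epsilon> = e / (2 * (\<kappa> * pi + 1))"
    have "\<epsilon> > 0" using \<open>0 < e\<close> \<kappa> by (simp add: \<epsilon>_def add_nonneg_pos)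
    have \<epsilon>2: "2 * (\<kappa> * pi * \<epsilon>) \<le> e"
    proof -
      have "2 * (\<kappa> * pi * \<epsilon>) \<le> 2 * ((\<kappa> * pi + 1) * \<epsilon>)"
        using \<open>\<epsilon> > 0\<close> by (simp add: distrib_right)
      also have "\<dots> = e"
      proof -
        have "\<kappa> * pi + 1 \<noteq> 0" using mult_nonneg_nonneg[OF \<kappa> pi_ge_zero] by linarith
        moreover have "c * (e / (2 * c)) = e / 2" if "c \<noteq> 0" for c using that by simp
        ultimately have "(\<kappa> * pi + 1) * \<epsilon> = e / 2" unfolding \<epsilon>_def by blast
        then show ?thesis by simp
      qed
      finally show ?thesis .
    qed
    obtain K' where K': "K' \<subseteq> A" "compact K'" "emeasure \<mu> (A - K') \<le> ennreal \<epsilon>"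
    proof -
      have sup: "emeasure \<mu> A = (SUP K \<in> {K. K \<subseteq> A \<and> compact K}. emeasure \<mu> K)"
        by (rule inner_regular[OF _ \<mu>_fin]) auto
      have Afin: "emeasure \<mu> A \<noteq> \<infinity>"
        using \<mu>_fin emeasure_space[of \<mu> A] by (auto simp: top_unique)
      show ?thesis
      proof (cases "emeasure \<mu> A = 0")
        case True
        then show ?thesis using that[of "{}"] by simp
      next
        case False
        have "emeasure \<mu> A - ennreal \<epsilon> < emeasure \<mu> A"
          using False Afin \<open>\<epsilon> > 0\<close> by (intro ennreal_between) (auto simp: zero_less_iff_neq_zero less_top)
        then obtain K where K: "K \<subseteq> A" "compact K" "emeasure \<mu> A - ennreal \<epsilon> < emeasure \<mu> K"
          unfolding sup less_SUP_iff by auto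
        have Km: "K \<in> sets borel" using K(2) by (simp add: compact_imp_closed borel_closed)
        have "emeasure \<mu> A \<le> ennreal \<epsilon> + emeasure \<mu> K"
          using less_imp_le[OF K(3)] by (simp add: ennreal_minus_le_iff)
        moreover have "emeasure \<mu> K \<noteq> \<infinity>"
          using Afin K(1) emeasure_mono[of K A \<mu>] by (auto simp: top_unique)
        ultimately have "emeasure \<mu> (A - K) \<le> ennreal \<epsilon>"
          using K(1) Km by (subst emeasure_Diff) (auto simp: ennreal_minus_le_iff add.commute)
        then show ?thesis using that K by blast
      qed
    qed
    \<comment> \<open>The extra point makes K nonempty. As a value of \<open>rinv \<psi>\<close> it
      is leftmost on its level, and a single point does not disturb the a.e. positivity of
      h.\<close>
    define K where "K = insert (rinv \<psi> 0) K'"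
    have "compact K" "K \<noteq> {}" using K'(2) by (auto simp: K_def)
    then have [measurable]: "K \<in> sets borel" by (simp add: compact_imp_closed borel_closed)
    have inj: "rinv \<psi> (\<psi> x) = x" if "x \<in> K" for x
      using that K'(1) by (auto simp: K_def A_def)
    have "AE x in lborel. x \<noteq> rinv \<psi> 0" by (rule AE_lborel_singleton)
    then have "AE x in lborel. x \<in> K \<longrightarrow> 0 < h x"
      by eventually_elim (use K'(1) in \<open>auto simp: K_def A_def\<close>)
    then obtain G k where G: "transport_map G k" "\<And>x. x \<in> K \<Longrightarrow> G (\<psi> x) = x"
      "\<And>y. G y \<in> K \<Longrightarrow> \<psi> (G y) = y" and kh: "AE y in lborel. G y \<in> K \<longrightarrow> k y * h (G y) = 1"
      using transport_map_reverse[OF T \<open>compact K\<close> \<open>K \<noteq> {}\<close> inj] by blast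
    interpret G: transport_map G k by fact
    have offK: "nnint_on (- K) (\<lambda>x. \<phi>1 x * ?U x) \<le> ennreal \<epsilon>"
    proof -
      have "nnint_on (- K) (\<lambda>x. \<phi>1 x * ?U x) = emeasure \<mu> (- K)"
        unfolding \<mu>_def by (subst emeasure_density) auto
      also have "\<dots> \<le> emeasure \<mu> (- A \<union> (A - K'))"
        using K'(2) by (intro emeasure_mono) (auto simp: K_def compact_imp_closed borel_closed)
      also have "\<dots> \<le> emeasure \<mu> (- A) + emeasure \<mu> (A - K')"
        using K'(2) by (intro emeasure_subadditive) (auto simp: compact_imp_closed borel_closed)
      finally show ?thesis using K'(3) offA by simp
    qed
    \<comment> \<open>Both weights are cut down to the energy that is kept: K on the side of u, its
      preimage under G on the side of v.\<close>
    define m1 where "m1 x = \<phi>1 x * indicator K x" for x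
    define m2 where "m2 y = \<phi>2 y * indicator K (G y)" for y
    have m: "unit_simple m1" "unit_simple m2"
      unfolding m1_def m2_def
      by (intro unit_simple_mult s unit_simple_indicator unit_simple_compose[of "indicator K"]; simp)+
    note [measurable] = m[THEN unit_simple_measurable]
    note [simp] = m[THEN unit_simple_nonneg] m[THEN unit_simple_le_1]
    have adm: "admissible v u G m2 m1"
    proof (rule admissibleI[OF m(2,1) G(1)])
      show "AE y in lborel. m2 y * ?V y = k y * m1 (G y) * ?U (G y)"
        using kh G.AE_map[OF eq]
      proof eventually_elim
        case (elim y)
        show ?case
        proof (cases "G y \<in> K")
          case True
          then have kh1: "k y * h (G y) = 1" and "\<phi>1 (G y) * ?U (G y) = h (G y) * \<phi>2 y * ?V y"
            using elim G(3)[OF True] by auto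
          then have "k y * (\<phi>1 (G y) * ?U (G y)) = (k y * h (G y)) * (\<phi>2 y * ?V y)" by simp
          then show ?thesis using True kh1 by (simp add: m1_def m2_def mult.assoc)
        qed (simp add: m1_def m2_def)
      qed
    qed
    define D where "D x = aux_dist \<kappa> (graph_point u x) (graph_point v (\<psi> x))" for x
    define eu where "eu x = aux_dist \<kappa> (graph_point u x) Infinity" for x
    define ev where "ev x = aux_dist \<kappa> (graph_point v x) Infinity" for x
    have [measurable]: "D \<in> borel_measurable borel" "eu \<in> borel_measurable borel" "ev \<in> borel_measurable borel"
      unfolding D_def eu_def ev_def by measurable
    have nn [simp]: "0 \<le> D x" "0 \<le> eu x" "0 \<le> ev x" for x
      unfolding D_def eu_def ev_def by (simp_all add: aux_dist_nonneg \<kappa>)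
    have le_pi: "eu x \<le> \<kappa> * pi" "ev x \<le> \<kappa> * pi" for x
      unfolding eu_def ev_def by (simp_all add: aux_dist_graph_Infinity_le \<kappa>)
    \<comment> \<open>Used at both ends: setting a weight to 0 on N raises the cost of dropped
      energy by at most \<kappa>\<pi> times the weighted energy on N.\<close>
    have split: "nnint (\<lambda>x. f x * (1 - m x) * g x)
        \<le> nnint (\<lambda>x. f x * (1 - \<phi> x) * g x) + ennreal (\<kappa> * pi * \<epsilon>)"
      if [measurable]: "f \<in> borel_measurable borel" "m \<in> borel_measurable borel"
        "\<phi> \<in> borel_measurable borel" "g \<in> borel_measurable borel" "N \<in> sets borel"
      and f: "\<And>x. 0 \<le> f x" "\<And>x. f x \<le> \<kappa> * pi" and "\<And>x. 0 \<le> g x"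
      and \<phi>: "\<And>x. 0 \<le> \<phi> x" "\<And>x. \<phi> x \<le> 1" and m: "\<And>x. m x = \<phi> x * indicator (- N) x"
      and N: "nnint_on N (\<lambda>x. \<phi> x * g x) \<le> ennreal \<epsilon>"
      for f m \<phi> g :: "real \<Rightarrow> real" and N
    proof -
      have "nnint (\<lambda>x. f x * (1 - m x) * g x)
        \<le> (\<integral>\<^sup>+x. ennreal (f x * (1 - \<phi> x) * g x)
            + ennreal (\<kappa> * pi) * (ennreal (\<phi> x * g x) * indicator N x) \<partial>lborel)"
      proof (rule nn_integral_mono)
        fix x
        have "f x * (\<phi> x * g x) \<le> (\<kappa> * pi) * (\<phi> x * g x)"
          using f \<phi> that(8) by (intro mult_right_mono) auto
        moreover have "f x * g x = f x * (1 - \<phi> x) * g x + f x * (\<phi> x * g x)" by (simp add: algebra_simps)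
        ultimately have "f x * g x \<le> f x * (1 - \<phi> x) * g x + (\<kappa> * pi) * (\<phi> x * g x)" by simp
        then have "ennreal (f x * g x) \<le> ennreal (f x * (1 - \<phi> x) * g x + (\<kappa> * pi) * (\<phi> x * g x))"
          by (rule ennreal_leI)
        also have "\<dots> = ennreal (f x * (1 - \<phi> x) * g x) + ennreal (\<kappa> * pi) * ennreal (\<phi> x * g x)"
          using f \<phi> that(8) \<kappa> by (simp add: ennreal_plus ennreal_mult)
        finally show "ennreal (f x * (1 - m x) * g x) \<le> ennreal (f x * (1 - \<phi> x) * g x)
            + ennreal (\<kappa> * pi) * (ennreal (\<phi> x * g x) * indicator N x)"
          by (cases "x \<in> N") (simp_all add: m)
      qed
      also have "\<dots> = nnint (\<lambda>x. f x * (1 - \<phi> x) * g x)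
          + ennreal (\<kappa> * pi) * nnint_on N (\<lambda>x. \<phi> x * g x)"
        by (subst nn_integral_add) (auto simp: nn_integral_cmult)
      also have "\<dots> \<le> nnint (\<lambda>x. f x * (1 - \<phi> x) * g x) + ennreal (\<kappa> * pi) * ennreal \<epsilon>"
        by (intro add_left_mono mult_left_mono N) auto
      also have "ennreal (\<kappa> * pi) * ennreal \<epsilon> = ennreal (\<kappa> * pi * \<epsilon>)"
        using \<kappa> \<open>\<epsilon> > 0\<close> by (simp add: ennreal_mult)
      finally show ?thesis .
    qed
    have term_u: "nnint (\<lambda>x. eu x * (1 - m1 x) * ?U x)
        \<le> nnint (\<lambda>x. eu x * (1 - \<phi>1 x) * ?U x) + ennreal (\<kappa> * pi * \<epsilon>)"
      by (rule split[where N = "- K"]) (use le_pi offK in \<open>auto simp: m1_def\<close>)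
    have term_v: "nnint (\<lambda>x. ev x * (1 - m2 x) * ?V x)
        \<le> nnint (\<lambda>x. ev x * (1 - \<phi>2 x) * ?V x) + ennreal (\<kappa> * pi * \<epsilon>)"
    proof (rule split[where N = "{y. G y \<notin> K}"])
      have "nnint_on {y. G y \<notin> K} (\<lambda>y. \<phi>2 y * ?V y)
          = (\<integral>\<^sup>+x. ennreal (\<phi>2 (\<psi> x) * ?V (\<psi> x)) * indicator {y. G y \<notin> K} (\<psi> x) * ennreal (h x) \<partial>lborel)"
        by (rule change_of_variables[symmetric]) measurable
      also have "\<dots> \<le> nnint_on (- K) (\<lambda>x. \<phi>1 x * ?U x)"
      proof (rule nn_integral_mono_AE, use eq in eventually_elim)
        case (elim x)
        have "ennreal (\<phi>2 (\<psi> x) * ?V (\<psi> x)) * ennreal (h x) = ennreal (\<phi>1 x * ?U x)"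
          unfolding elim using density_nonneg[of x] by (simp add: ennreal_mult[symmetric] ac_simps)
        then show ?case using G(2)[of x] by (auto simp: indicator_def)
      qed
      finally show "nnint_on {y. G y \<notin> K} (\<lambda>y. \<phi>2 y * ?V y) \<le> ennreal \<epsilon>"
        using offK by (rule order_trans)
    qed (use le_pi in \<open>auto simp: m2_def indicator_def\<close>)
    have term_uv: "nnint (\<lambda>y. aux_dist \<kappa> (graph_point v y) (graph_point u (G y)) * m2 y * ?V y)
        \<le> nnint (\<lambda>x. D x * \<phi>1 x * ?U x)"
    proof -
      have "nnint (\<lambda>y. aux_dist \<kappa> (graph_point v y) (graph_point u (G y)) * m2 y * ?V y)
        = (\<integral>\<^sup>+y. ennreal (D (G y) * m1 (G y) * ?U (G y)) * ennreal (k y) \<partial>lborel)"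
      proof (rule nn_integral_cong_AE, use kh G.AE_map[OF eq] in eventually_elim)
        case (elim y)
        show ?case
        proof (cases "G y \<in> K")
          case True
          then have kh1: "k y * h (G y) = 1" and "\<phi>1 (G y) * ?U (G y) = h (G y) * \<phi>2 y * ?V y"
            using elim G(3)[OF True] by auto
          then have "k y * (\<phi>1 (G y) * ?U (G y)) = (k y * h (G y)) * (\<phi>2 y * ?V y)" by simp
          then have "D (G y) * m1 (G y) * ?U (G y) * k y = D (G y) * m2 y * ?V y"
            using True kh1 by (simp add: m1_def m2_def ac_simps)
          moreover have "D (G y) = aux_dist \<kappa> (graph_point v y) (graph_point u (G y))"
            by (simp add: D_def G(3)[OF True] aux_dist_commute)
          ultimately show ?thesis
            by (simp only: ennreal_mult''[OF G.density_nonneg, symmetric])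
        qed (simp add: m1_def m2_def)
      qed
      also have "\<dots> = nnint (\<lambda>x. D x * m1 x * ?U x)"
        by (rule G.change_of_variables) measurable
      also have "\<dots> \<le> nnint (\<lambda>x. D x * \<phi>1 x * ?U x)"
        by (intro nn_integral_mono ennreal_leI mult_right_mono mult_left_mono)
          (auto simp: m1_def indicator_def)
      finally show ?thesis .
    qed
    have "J \<kappa> v u \<le> cost \<kappa> v u G m2 m1"
      unfolding J_def using adm by (intro Inf_lower) auto
    also have "\<dots> \<le> nnint (\<lambda>x. D x * \<phi>1 x * ?U x)
        + (nnint (\<lambda>x. ev x * (1 - \<phi>2 x) * ?V x) + ennreal (\<kappa> * pi * \<epsilon>))
        + (nnint (\<lambda>x. eu x * (1 - \<phi>1 x) * ?U x) + ennreal (\<kappa> * pi * \<epsilon>))"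
      unfolding cost_eq[OF G(1) X(2,1) m(2,1)]
      using term_u term_v term_uv unfolding eu_def ev_def by (intro add_mono) auto
    also have "\<dots> = cost \<kappa> u v \<psi> \<phi>1 \<phi>2 + (ennreal (\<kappa> * pi * \<epsilon>) + ennreal (\<kappa> * pi * \<epsilon>))"
      unfolding cost_eq[OF T X s] D_def eu_def ev_def by (simp add: ac_simps)
    also have "ennreal (\<kappa> * pi * \<epsilon>) + ennreal (\<kappa> * pi * \<epsilon>) = ennreal (2 * (\<kappa> * pi * \<epsilon>))"
      using \<kappa> \<open>\<epsilon> > 0\<close> by (simp add: ennreal_plus[symmetric] del: ennreal_plus)
    also have "cost \<kappa> u v \<psi> \<phi>1 \<phi>2 + ennreal (2 * (\<kappa> * pi * \<epsilon>)) \<le> cost \<kappa> u v \<psi> \<phi>1 \<phi>2 + ennreal e"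
      using \<epsilon>2 by (intro add_left_mono ennreal_leI)
    finally show "J \<kappa> v u \<le> cost \<kappa> u v \<psi> \<phi>1 \<phi>2 + ennreal e" .
  qed
qed

subsection \<open>Distributional derivatives and primitives\<close>

text \<open>The classical flat functions, a polynomial in 1/x times exp(-1/x), extended by 0;
  explicit test functions are built from them.\<close>

definition flat_poly :: "real poly \<Rightarrow> real \<Rightarrow> real" where
  "flat_poly p x = (if 0 < x then poly p (1 / x) * exp (- 1 / x) else 0)"

lemma poly_times_exp_minus_tendsto_0:
  fixes p :: "real poly"
  shows "((\<lambda>z. poly p z * exp (- z)) \<longlongrightarrow> 0) at_top"
proof -
  have "((\<lambda>z. \<Sum>i\<le>degree p. coeff p i * (z ^ i / exp z)) \<longlongrightarrow> (\<Sum>i\<le>degree p. coeff p i * 0)) at_top"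
    by (intro tendsto_intros tendsto_power_div_exp_0)
  moreover have "(\<Sum>i\<le>degree p. coeff p i * (z ^ i / exp z)) = poly p z * exp (- z)" for z
    by (simp add: poly_altdef sum_distrib_right exp_minus divide_inverse mult.assoc)
  ultimately show ?thesis by simp
qed

lemma flat_poly_tendsto_0: "(flat_poly p \<longlongrightarrow> 0) (at_right 0)"
proof -
  have "((\<lambda>x. poly p (inverse x) * exp (- inverse x)) \<longlongrightarrow> 0) (at_right 0)"
    using poly_times_exp_minus_tendsto_0 filterlim_inverse_at_top_right by (rule filterlim_compose)
  then show ?thesis
    by (rule filterlim_cong[THEN iffD1, rotated -1])
      (auto simp: flat_poly_def eventually_at_filter inverse_eq_divide)
qed

text \<open>With z = 1/x, differentiation sends p(z) exp(-z) to z^2 (p - p')(z) exp(-z), so the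
  family is closed under derivatives. At 0 the right difference quotient is the flat function of z
  p(z), which tends to 0.\<close>

lemma flat_poly_has_derivative:
  "(flat_poly p has_real_derivative flat_poly ([:0, 0, 1:] * (p - pderiv p)) x) (at x)"
proof -
  consider "0 < x" | "x < 0" | "x = 0" by linarith
  then show ?thesis
  proof cases
    case 1
    have "((\<lambda>x. poly p (1 / x) * exp (- 1 / x)) has_real_derivative
        flat_poly ([:0, 0, 1:] * (p - pderiv p)) x) (at x)"
      using 1 by (auto intro!: derivative_eq_intros simp: flat_poly_def field_simps power2_eq_square)
    then show ?thesis
      by (rule DERIV_cong_ev[THEN iffD1, rotated -1, OF _ refl _ refl])
        (use 1 in \<open>auto simp: flat_poly_def eventually_nhds intro!: exI[of _ "{0<..}"]\<close>)
  next
    case 2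
    have "((\<lambda>x. 0) has_real_derivative flat_poly ([:0, 0, 1:] * (p - pderiv p)) x) (at x)"
      using 2 by (simp add: flat_poly_def)
    then show ?thesis
      by (rule DERIV_cong_ev[THEN iffD1, rotated -1, OF _ refl _ refl])
        (use 2 in \<open>auto simp: flat_poly_def eventually_nhds intro!: exI[of _ "{..<0}"]\<close>)
  next
    case 3
    have "((\<lambda>h. flat_poly p h / h) \<longlongrightarrow> 0) (at_right 0)"
      using flat_poly_tendsto_0[of "[:0, 1:] * p"]
      by (rule filterlim_cong[THEN iffD1, rotated -1])
        (auto simp: flat_poly_def eventually_at_filter)
    moreover have "((\<lambda>h. flat_poly p h / h) \<longlongrightarrow> 0) (at_left 0)"
      by (rule tendsto_eventually) (auto simp: flat_poly_def eventually_at_filter)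
    ultimately have "((\<lambda>h. flat_poly p h / h) \<longlongrightarrow> 0) (at 0)"
      by (simp add: filterlim_at_split)
    then show ?thesis unfolding 3 DERIV_def by (simp add: flat_poly_def)
  qed
qed

text \<open>This class is closed under differentiation, so its members are smooth.\<close>

inductive_set flat_products :: "real \<Rightarrow> real \<Rightarrow> real \<Rightarrow> (real \<Rightarrow> real) set" for n a b where
  product: "(\<lambda>x. flat_poly p (n * (x - a)) * flat_poly q (n * (b - x))) \<in> flat_products n a b"
| add: "f \<in> flat_products n a b \<Longrightarrow> g \<in> flat_products n a b \<Longrightarrow> (\<lambda>x. f x + g x) \<in> flat_products n a b"

lemma flat_poly_smult: "flat_poly (smult c p) x = c * flat_poly p x"
  by (simp add: flat_poly_def)

lemma flat_poly_scaled_has_derivative: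
  "((\<lambda>x. flat_poly p (n * (x - a))) has_real_derivative
    n * flat_poly ([:0, 0, 1:] * (p - pderiv p)) (n * (x - a))) (at x)"
  "((\<lambda>x. flat_poly p (n * (b - x))) has_real_derivative
    - n * flat_poly ([:0, 0, 1:] * (p - pderiv p)) (n * (b - x))) (at x)"
  by (rule DERIV_cong[OF DERIV_chain2[OF flat_poly_has_derivative]],
      (auto intro!: derivative_eq_intros)[], simp)+

lemma flat_products_derivative:
  assumes "f \<in> flat_products n a b"
  obtains f' where "f' \<in> flat_products n a b" "\<And>x. (f has_real_derivative f' x) (at x)"
proof -
  have "\<exists>f'\<in>flat_products n a b. \<forall>x. (f has_real_derivative f' x) (at x)"
    using assms
  proof induction
    case (product p q)
    let ?D = "\<lambda>p. [:0, 0, 1:] * (p - pderiv p)"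
    let ?f' = "\<lambda>x. flat_poly (smult n (?D p)) (n * (x - a)) * flat_poly q (n * (b - x))
        + flat_poly p (n * (x - a)) * flat_poly (smult (- n) (?D q)) (n * (b - x))"
    have "((\<lambda>x. flat_poly p (n * (x - a)) * flat_poly q (n * (b - x))) has_real_derivative ?f' x) (at x)" for x
      by (rule DERIV_cong[OF DERIV_mult[OF flat_poly_scaled_has_derivative(1) flat_poly_scaled_has_derivative(2)]])
        (simp only: flat_poly_smult ac_simps)
    moreover have "?f' \<in> flat_products n a b"
      by (intro flat_products.intros)
    ultimately show ?case by (intro bexI[of _ ?f'] allI)
  next
    case (add f g)
    then obtain f' g' where "f' \<in> flat_products n a b" "g' \<in> flat_products n a b"
      "\<And>x. (f has_real_derivative f' x) (at x)" "\<And>x. (g has_real_derivative g' x) (at x)"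
      by blast
    then show ?case
      by (intro bexI[of _ "\<lambda>x. f' x + g' x"] allI DERIV_add flat_products.add)
  qed
  then show ?thesis using that by blast
qed

lemma flat_products_deriv: "f \<in> flat_products n a b \<Longrightarrow> deriv f \<in> flat_products n a b"
proof -
  assume "f \<in> flat_products n a b"
  then obtain f' where f': "f' \<in> flat_products n a b" "\<And>x. (f has_real_derivative f' x) (at x)"
    using flat_products_derivative by metis
  have "deriv f = f'" using DERIV_imp_deriv[OF f'(2)] by auto
  then show ?thesis using f'(1) by simp
qed

lemma flat_products_support: "f \<in> flat_products n a b \<Longrightarrow> 0 < n \<Longrightarrow> f x \<noteq> 0 \<Longrightarrow> x \<in> {a..b}"
proof (induction arbitrary: x rule: flat_products.induct)
  case (product p q)
  then show ?case by (auto simp: flat_poly_def zero_less_mult_iff split: if_splits)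
next
  case (add f g)
  then show ?case by (metis add.right_neutral)
qed

lemma test_function_flat_products:
  assumes "f \<in> flat_products n a b" "0 < n"
  shows "test_function f"
  unfolding test_function_def
proof
  have it: "(deriv ^^ k) f \<in> flat_products n a b" for k
    by (induction k) (auto intro: flat_products_deriv assms)
  show "\<forall>k. (deriv ^^ k) f differentiable_on UNIV"
  proof
    fix k
    obtain f' where "\<And>x. ((deriv ^^ k) f has_real_derivative f' x) (at x)"
      using flat_products_derivative[OF it[of k]] by blast
    then show "(deriv ^^ k) f differentiable_on UNIV"
      by (auto simp: differentiable_on_def real_differentiable_def intro!: differentiable_at_withinI)
  qed
  have "{x. f x \<noteq> 0} \<subseteq> {a..b}" using flat_products_support[OF assms] by auto
  then show "compact (closure {x. f x \<noteq> 0})"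
    by (meson bounded_closed_interval bounded_subset compact_closure)
qed

lemma flat_poly_continuous: "continuous_on UNIV (flat_poly p)"
  using flat_poly_has_derivative by (intro DERIV_continuous_on) (auto intro: DERIV_subset)

lemma flat_poly_measurable [measurable]: "flat_poly p \<in> borel_measurable borel"
  by (rule borel_measurable_continuous_onI[OF flat_poly_continuous])

text \<open>\<open>step\<close> is exp(-1/x) for x > 0. It climbs from 0 to the limit 1 at infinity,
  so its derivative \<open>step'\<close> is a probability density.\<close>

abbreviation "step \<equiv> flat_poly [:1:]"
abbreviation "step' \<equiv> flat_poly [:0, 0, 1:]"

lemma flat_poly_1_tendsto: "(step \<longlongrightarrow> 1) at_top"
proof -
  have "((\<lambda>x::real. exp (- inverse x)) \<longlongrightarrow> exp (- 0)) at_top"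
    by (intro tendsto_intros tendsto_inverse_0_at_top filterlim_ident)
  then have "((\<lambda>x::real. exp (- inverse x)) \<longlongrightarrow> 1) at_top" by simp
  then show ?thesis
    by (rule filterlim_cong[THEN iffD1, rotated -1])
      (auto simp: flat_poly_def inverse_eq_divide intro!: eventually_mono[OF eventually_gt_at_top[of 0]])
qed

lemma flat_poly_1_bounds: "0 \<le> step x" "step x \<le> 1"
  by (auto simp: flat_poly_def)

lemma step'_nonneg: "0 \<le> step' x"
  by (auto simp: flat_poly_def)

lemma integral_step': "integrable lborel step'" "(LINT x|lborel. step' x) = 1"
proof -
  have d: "(step has_real_derivative step' x) (at x)" for x
    using flat_poly_has_derivative[of "[:1:]" x] by (simp add: pderiv_pCons)
  have "(\<integral>\<^sup>+x. ennreal (step' x) * indicator {0..} x \<partial>lborel) = ennreal (1 - step 0)"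
    by (rule nn_integral_FTC_atLeast[OF _ _ _ flat_poly_1_tendsto])
      (auto simp: step'_nonneg intro: d)
  moreover have "(\<integral>\<^sup>+x. ennreal (step' x) * indicator {0..} x \<partial>lborel) = (\<integral>\<^sup>+x. ennreal (step' x) \<partial>lborel)"
    by (intro nn_integral_cong) (auto simp: indicator_def flat_poly_def)
  ultimately have e: "(\<integral>\<^sup>+x. ennreal (step' x) \<partial>lborel) = ennreal 1" by (simp add: flat_poly_def)
  then show i: "integrable lborel step'"
    by (intro integrableI_nn_integral_finite[of _ _ 1]) (auto simp: step'_nonneg)
  show "(LINT x|lborel. step' x) = 1"
    using nn_integral_eq_integral[OF i] e by (simp add: step'_nonneg)
qed

section \<open>From distributional derivatives to increments\<close>

lemma integrable_indicator_Icc [simp]: "integrable lborel (indicator {a..b::real} :: real \<Rightarrow> real)"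
  by (simp add: integrable_indicator_iff emeasure_lborel_Icc_eq)

lemma L2_fun_set_integrable:
  assumes "L2_fun g"
  shows "set_integrable lborel {a..b} g"
proof -
  have [measurable]: "g \<in> borel_measurable borel" and i: "integrable lborel (\<lambda>x. (g x)\<^sup>2)"
    using assms by (auto simp: L2_fun_def)
  have "integrable lborel (\<lambda>x. indicator {a..b} x + (g x)\<^sup>2)"
    using i by (intro Bochner_Integration.integrable_add) simp_all
  then show ?thesis
    unfolding set_integrable_def
  proof (rule Bochner_Integration.integrable_bound)
    have "\<bar>g x\<bar> \<le> 1 + (g x)\<^sup>2" for x
    proof -
      have "0 \<le> (\<bar>g x\<bar> - 1)\<^sup>2" by simp
      then have "2 * \<bar>g x\<bar> \<le> 1 + (g x)\<^sup>2" by (simp add: power2_diff)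
      then show ?thesis using abs_ge_zero[of "g x"] by linarith
    qed
    then show "AE x in lborel. norm (indicator {a..b} x *\<^sub>R g x) \<le> norm (indicator {a..b} x + (g x)\<^sup>2)"
      by (intro AE_I2) (auto simp: indicator_def)
  qed simp
qed

text \<open>One end of the differentiated cut-off after rescaling: the density \<open>step'\<close>
  concentrates at a, from the side selected by the sign r. The last factor is the cut-off at the
  other end, at distance d, and tends to 1.\<close>

lemma mollified_step_limit:
  fixes f :: "real \<Rightarrow> real"
  assumes f: "bounded (range f)" "continuous_on UNIV f" and "0 < d" "\<bar>r\<bar> = 1"
  shows "(\<lambda>k. LINT s|lborel. f (a + r * (s / real (Suc k))) * step' s * step (real (Suc k) * d - s))
    \<longlonglongrightarrow> f a"
proof -
  let ?g = "\<lambda>k s. f (a + r * (s / real (Suc k))) * step' s * step (real (Suc k) * d - s)"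
  obtain B where B: "\<And>x. \<bar>f x\<bar> \<le> B" using f(1) by (auto simp: bounded_iff)
  have [measurable]: "f \<in> borel_measurable borel" by (rule borel_measurable_continuous_onI[OF f(2)])
  have "(\<lambda>k. LINT s|lborel. ?g k s)
    \<longlonglongrightarrow> (LINT s|lborel. f a * step' s)"
  proof (rule integral_dominated_convergence[where w = "\<lambda>s. B * step' s"])
    show "integrable lborel (\<lambda>s. B * step' s)" using integral_step'(1) by simp
    show "AE s in lborel. (\<lambda>k. ?g k s)
        \<longlonglongrightarrow> f a * step' s"
    proof (rule AE_I2)
      fix s
      have "(\<lambda>k. a + r * (s / real (Suc k))) \<longlonglongrightarrow> a + r * 0"
        by (intro tendsto_intros LIMSEQ_Suc[OF lim_const_over_n])
      then have "(\<lambda>k. f (a + r * (s / real (Suc k)))) \<longlonglongrightarrow> f a"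
        using f(2) by (intro continuous_on_tendsto_compose[of UNIV f]) auto
      moreover have "filterlim (\<lambda>k. - s + real (Suc k) * d) at_top sequentially"
        by (intro filterlim_tendsto_add_at_top[OF tendsto_const]
            filterlim_at_top_mult_tendsto_pos[OF tendsto_const \<open>0 < d\<close>]
            filterlim_compose[OF filterlim_real_sequentially filterlim_Suc])
      then have "filterlim (\<lambda>k. real (Suc k) * d - s) at_top sequentially" by simp
      then have "(\<lambda>k. step (real (Suc k) * d - s)) \<longlonglongrightarrow> 1"
        by (rule filterlim_compose[OF flat_poly_1_tendsto])
      ultimately have "(\<lambda>k. ?g k s)
        \<longlonglongrightarrow> f a * step' s * 1" by (intro tendsto_intros)
      then show "(\<lambda>k. ?g k s)
        \<longlonglongrightarrow> f a * step' s" by simp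
    qed
    show "AE s in lborel. norm (?g k s)
        \<le> B * step' s" for k
    proof (rule AE_I2)
      fix s
      have "\<bar>f (a + r * (s / real (Suc k)))\<bar> * step' s * step (real (Suc k) * d - s) \<le> B * step' s * 1"
        using B step'_nonneg flat_poly_1_bounds by (intro mult_mono mult_nonneg_nonneg) (auto intro: order_trans[OF abs_ge_zero])
      then show "norm (?g k s) \<le> B * step' s"
        using step'_nonneg[of s] flat_poly_1_bounds by (simp add: abs_mult)
    qed
  qed auto
  then show ?thesis using integral_step' by simp
qed

text \<open>The test functions \<open>step (k (x - a)) * step (k (b - x))\<close> tend to the indicator of \<open>(a, b)\<close>.\<close>

lemma distributional_derivative_imp_primitive:
  fixes f g :: "real \<Rightarrow> real"
  assumes f: "bounded (range f)" "continuous_on UNIV f" and g: "L2_fun g"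
    and D: "distributional_derivative f g" and "a \<le> b"
  shows "f b - f a = (LINT x:{a..b}|lborel. g x)"
proof (cases "a = b")
  case True
  have "AE x in lborel. x \<noteq> b" by (rule AE_lborel_singleton)
  then have "(LINT x:{b..b}|lborel. g x) = (LINT x|(lborel :: real measure). 0)"
    unfolding set_lebesgue_integral_def using g
    by (intro integral_cong_AE) (auto simp: L2_fun_def)
  then show ?thesis using True by simp
next
  case False
  then have ab: "a < b" using \<open>a \<le> b\<close> by simp
  have [measurable]: "g \<in> borel_measurable borel" using g by (simp add: L2_fun_def)
  have [measurable]: "f \<in> borel_measurable borel" by (rule borel_measurable_continuous_onI[OF f(2)])
  obtain B where B: "\<And>x. \<bar>f x\<bar> \<le> B" using f(1) by (auto simp: bounded_iff)
  define n where "n k = real (Suc k)" for k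
  have n: "0 < n k" for k by (simp add: n_def)
  define p where "p k x = step (n k * (x - a)) * step (n k * (b - x))" for k x
  have tp: "test_function (p k)" for k
    unfolding p_def by (intro test_function_flat_products[where n = "n k" and a = a and b = b] flat_products.product n)
  have dp: "deriv (p k) x = n k * step' (n k * (x - a)) * step (n k * (b - x))
      - n k * step' (n k * (b - x)) * step (n k * (x - a))" for k x
    unfolding p_def
    by (rule DERIV_imp_deriv, rule DERIV_cong[OF DERIV_mult[OF flat_poly_scaled_has_derivative(1) flat_poly_scaled_has_derivative(2)]])
      (simp add: pderiv_pCons)
  \<comment> \<open>The contributions of the two ends to the integral of f against the derivative of
    p k, with s = n k (x - a) at the left end and s = n k (b - x) at the right one.\<close>
  define I where "I k = (LINT s|lborel. f (a + 1 * (s / n k)) * step' s * step (n k * (b - a) - s))" for k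
  define I' where "I' k = (LINT s|lborel. f (b + (-1) * (s / n k)) * step' s * step (n k * (b - a) - s))" for k
  have bound: "\<bar>f x * (n k * step' z * step w)\<bar> \<le> B * (n k * step' z)" for x k z w
  proof -
    have "\<bar>f x\<bar> * (n k * step' z * step w) \<le> B * (n k * step' z * 1)"
      using B step'_nonneg flat_poly_1_bounds n[of k]
      by (intro mult_mono mult_nonneg_nonneg order_refl) (auto intro: order_trans[OF abs_ge_zero])
    then show ?thesis using step'_nonneg[of z] flat_poly_1_bounds(1)[of w] n[of k] by (simp add: abs_mult)
  qed
  \<comment> \<open>One substitution serves both ends: z is the end, r the direction pointing into
    the interval.\<close>
  have affine: "integrable lborel (\<lambda>x. f x * (n k * step' (n k * (r * (x - z))) * step (n k * (b - a - r * (x - z)))))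
      \<and> (LINT x|lborel. f x * (n k * step' (n k * (r * (x - z))) * step (n k * (b - a - r * (x - z)))))
        = (LINT s|lborel. f (z + r * (s / n k)) * step' s * step (n k * (b - a) - s))"
    if r: "r = 1 \<or> r = -1" for k z and r :: real
  proof
    show "integrable lborel (\<lambda>x. f x * (n k * step' (n k * (r * (x - z))) * step (n k * (b - a - r * (x - z)))))"
    proof (rule Bochner_Integration.integrable_bound)
      have "integrable lborel (\<lambda>x. step' (- n k * r * z + (n k * r) * x))"
        using n[of k] integral_step'(1) r by (subst lborel_integrable_real_affine_iff) auto
      then show "integrable lborel (\<lambda>x. B * (n k * step' (n k * (r * (x - z)))))"
        by (intro integrable_mult_right) (simp add: algebra_simps)
    qed (use bound in \<open>auto intro!: AE_I2 order_trans[OF _ abs_ge_self]\<close>)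
    show "(LINT x|lborel. f x * (n k * step' (n k * (r * (x - z))) * step (n k * (b - a - r * (x - z)))))
        = (LINT s|lborel. f (z + r * (s / n k)) * step' s * step (n k * (b - a) - s))"
      using n[of k] r
      by (subst lborel_integral_real_affine[where t = z and c = "r / n k"])
        (auto simp: integral_mult_right_zero[symmetric] algebra_simps simp del: integral_mult_right_zero
          intro!: Bochner_Integration.integral_cong)
  qed
  have left: "(LINT x|lborel. f x * deriv (p k) x) = I k - I' k" for k
  proof -
    note ab = affine[of 1 k a] affine[of "-1" k b]
    have "f x * deriv (p k) x = f x * (n k * step' (n k * (1 * (x - a))) * step (n k * (b - a - 1 * (x - a))))
        - f x * (n k * step' (n k * (- 1 * (x - b))) * step (n k * (b - a - - 1 * (x - b))))" for x
      unfolding dp by (simp add: right_diff_distrib)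
    then show ?thesis
      unfolding I_def I'_def using ab by (simp only:) (subst Bochner_Integration.integral_diff, auto)
  qed
  have "(\<lambda>k. I k - I' k) \<longlonglongrightarrow> f a - f b"
    unfolding I_def I'_def n_def using ab by (intro tendsto_diff mollified_step_limit f) auto
  moreover have "(\<lambda>k. LINT x|lborel. g x * p k x) \<longlonglongrightarrow> (LINT x|lborel. indicator {a<..<b} x * g x)"
  proof (rule integral_dominated_convergence[where w = "\<lambda>x. \<bar>indicator {a..b} x * g x\<bar>"])
    show "integrable lborel (\<lambda>x. \<bar>indicator {a..b} x * g x\<bar>)"
      using L2_fun_set_integrable[OF g, of a b] by (intro integrable_abs) (simp add: set_integrable_def)
    show "AE x in lborel. (\<lambda>k. g x * p k x) \<longlonglongrightarrow> indicator {a<..<b} x * g x"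
    proof (rule AE_I2)
      fix x
      show "(\<lambda>k. g x * p k x) \<longlonglongrightarrow> indicator {a<..<b} x * g x"
      proof (cases "x \<in> {a<..<b}")
        case True
        have "filterlim (\<lambda>k. n k * d) at_top sequentially" if "0 < d" for d
          unfolding n_def using that
          by (intro filterlim_at_top_mult_tendsto_pos[OF tendsto_const]
              filterlim_compose[OF filterlim_real_sequentially filterlim_Suc])
        then have "(\<lambda>k. step (n k * d)) \<longlonglongrightarrow> 1" if "0 < d" for d
          using that by (intro filterlim_compose[OF flat_poly_1_tendsto]) auto
        then have "(\<lambda>k. g x * (step (n k * (x - a)) * step (n k * (b - x)))) \<longlonglongrightarrow> g x * (1 * 1)"
          using True by (intro tendsto_mult tendsto_const) auto
        then show ?thesis using True by (simp add: p_def)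
      next
        case False
        then have "p k x = 0" for k using n[of k]
          by (auto simp: p_def flat_poly_def zero_less_mult_iff)
        then show ?thesis using False by simp
      qed
    qed
    show "AE x in lborel. norm (g x * p k x) \<le> \<bar>indicator {a..b} x * g x\<bar>" for k
    proof (rule AE_I2)
      fix x
      have "p k x = 0" if "x \<notin> {a..b}" using that n[of k]
        by (auto simp: p_def flat_poly_def zero_less_mult_iff)
      moreover have "0 \<le> p k x" "p k x \<le> 1"
        unfolding p_def by (intro mult_nonneg_nonneg mult_le_one flat_poly_1_bounds)+
      ultimately show "norm (g x * p k x) \<le> \<bar>indicator {a..b} x * g x\<bar>"
        by (auto simp: indicator_def abs_mult mult_left_le)
    qed
  qed (auto simp: p_def)
  then have "(\<lambda>k. - (LINT x|lborel. g x * p k x)) \<longlonglongrightarrow> - (LINT x|lborel. indicator {a<..<b} x * g x)"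
    by (rule tendsto_minus)
  moreover have "I k - I' k = - (LINT x|lborel. g x * p k x)" for k
    using D tp left by (simp add: distributional_derivative_def)
  ultimately have "f a - f b = - (LINT x|lborel. indicator {a<..<b} x * g x)"
    by (simp add: LIMSEQ_unique)
  moreover have "(LINT x|lborel. indicator {a<..<b} x * g x) = (LINT x:{a..b}|lborel. g x)"
  proof -
    have "AE x in lborel. x \<noteq> a \<and> x \<noteq> b" by (intro AE_conjI AE_lborel_singleton)
    then have "AE x in lborel. indicator {a<..<b} x * g x = indicator {a..b} x *\<^sub>R g x"
      by eventually_elim (auto simp: indicator_def)
    then show ?thesis unfolding set_lebesgue_integral_def by (intro integral_cong_AE) auto
  qed
  ultimately show ?thesis by simp
qed

section \<open>From increments back to distributional derivatives\<close>

lemma Fubini_product_bound: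
  fixes f :: "real \<Rightarrow> real \<Rightarrow> real"
  assumes [measurable]: "case_prod f \<in> borel_measurable (lborel \<Otimes>\<^sub>M lborel)"
    and b: "integrable lborel b" and c: "integrable lborel c"
    and le: "\<And>x y. \<bar>f x y\<bar> \<le> b x * c y"
  shows "(LINT x|lborel. LINT y|lborel. f x y) = (LINT y|lborel. LINT x|lborel. f x y)"
proof -
  have [measurable]: "(\<lambda>y. f x y) \<in> borel_measurable borel" for x
    using measurable_Pair2[OF assms(1), of x] by simp
  have row: "integrable lborel (\<lambda>y. f x y)" for x
    by (rule Bochner_Integration.integrable_bound[OF integrable_mult_right[OF c, of "b x"]])
      (use le in \<open>auto intro: order_trans[OF _ abs_ge_self]\<close>)
  have "integrable (lborel \<Otimes>\<^sub>M lborel) (case_prod f)"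
  proof (rule lborel_pair.Fubini_integrable)
    show "integrable lborel (\<lambda>x. LINT y|lborel. norm (case_prod f (x, y)))"
    proof (rule Bochner_Integration.integrable_bound)
      show "integrable lborel (\<lambda>x. b x * (LINT y|lborel. c y))" using b by simp
      show "AE x in lborel. norm (LINT y|lborel. norm (case_prod f (x, y))) \<le> norm (b x * (LINT y|lborel. c y))"
      proof (rule AE_I2)
        fix x
        have "(LINT y|lborel. \<bar>f x y\<bar>) \<le> (LINT y|lborel. b x * c y)"
          using row c le by (intro integral_mono) auto
        moreover have "0 \<le> (LINT y|lborel. \<bar>f x y\<bar>)" by (intro integral_nonneg_AE) auto
        ultimately show "norm (LINT y|lborel. norm (case_prod f (x, y))) \<le> norm (b x * (LINT y|lborel. c y))"
          by simp
      qed
    qed measurable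
    show "AE x in lborel. integrable lborel (\<lambda>y. case_prod f (x, y))" using row by simp
  qed measurable
  from lborel_pair.Fubini_integral[OF this] show ?thesis by simp
qed

text \<open>Integration by parts through Fubini: f x is f R minus the integral of g over
  \<open>{x..R}\<close>. After the exchange the inner integral of p' up to s is p s, while the
  constant f R meets the full integral of p', which is 0.\<close>

lemma primitive_imp_distributional_derivative:
  fixes f g :: "real \<Rightarrow> real"
  assumes [measurable]: "f \<in> borel_measurable borel" and g: "L2_fun g"
    and prim: "\<And>a b. a \<le> b \<Longrightarrow> f b - f a = (LINT x:{a..b}|lborel. g x)"
  shows "distributional_derivative f g"
  unfolding distributional_derivative_def
proof (intro allI impI)
  fix p
  assume "test_function p"
  then have diff: "(deriv ^^ n) p differentiable_on UNIV" and comp: "compact (closure {x. p x \<noteq> 0})" for n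
    by (auto simp: test_function_def)
  have [measurable]: "g \<in> borel_measurable borel" using g by (simp add: L2_fun_def)
  define q where "q = deriv p"
  have dp: "(p has_real_derivative q x) (at x)" for x
    using diff[of 0] unfolding q_def
    by (auto simp: differentiable_on_def DERIV_deriv_iff_real_differentiable)
  have q_cont: "continuous_on UNIV q"
    using differentiable_imp_continuous_on[OF diff[of 1]] by (simp add: q_def)
  then have [measurable]: "q \<in> borel_measurable borel" by (rule borel_measurable_continuous_onI)
  have "bounded {x. p x \<noteq> 0}"
    using comp bounded_subset[OF compact_imp_bounded closure_subset] by blast
  then obtain R0 where R0: "\<And>x. p x \<noteq> 0 \<Longrightarrow> \<bar>x\<bar> \<le> R0" by (auto simp: bounded_iff)
  \<comment> \<open>Strictly beyond the support on both sides, so that p vanishes at -R and at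
    R.\<close>
  define R where "R = \<bar>R0\<bar> + 1"
  have p0: "p x = 0" if "R0 < \<bar>x\<bar>" for x using R0[of x] that by force
  have q0: "q x = 0" if "R0 < \<bar>x\<bar>" for x
  proof -
    have "open {x. R0 < \<bar>x\<bar>}" by (intro open_Collect_less continuous_intros)
    then have "eventually (\<lambda>y. p y = 0) (nhds x)"
      using that p0 unfolding eventually_nhds by blast
    then have "(p has_real_derivative q x) (at x) \<longleftrightarrow> ((\<lambda>_. 0) has_real_derivative q x) (at x)"
      by (intro DERIV_cong_ev) auto
    then have "((\<lambda>_. 0) has_real_derivative q x) (at x)" using dp by simp
    then show ?thesis using DERIV_unique[OF _ DERIV_const] by blast
  qed
  have ind: "p x = p x * indicator {-R..R} x" "q x = q x * indicator {-R..R} x" for x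
  proof -
    have "R0 < \<bar>x\<bar>" if "x \<notin> {-R..R}" using that by (auto simp: R_def)
    then show "p x = p x * indicator {-R..R} x" "q x = q x * indicator {-R..R} x"
      using p0[of x] q0[of x] by (auto simp: indicator_def simp del: atLeastAtMost_iff)
  qed
  have FTC: "(LINT x|lborel. q x * indicator {-R..s} x) = p s" if "-R \<le> s" for s
  proof -
    have "(LINT x|lborel. q x * indicator {-R..s} x) = p s - p (-R)"
      using q_cont by (intro integral_FTC_Icc_real that dp) (auto simp: continuous_on_eq_continuous_at)
    then show ?thesis using p0[of "-R"] by (simp add: R_def)
  qed
  have q_int: "integrable lborel (\<lambda>x. q x * indicator {-R..R} x)"
    using borel_integrable_atLeastAtMost'[of "-R" R q] continuous_on_subset[OF q_cont]
    by (simp add: set_integrable_def mult.commute)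
  have g_int: "integrable lborel (\<lambda>s. g s * indicator {-R..R} s)"
    using L2_fun_set_integrable[OF g, of "-R" R] by (simp add: set_integrable_def mult.commute)
  let ?k = "\<lambda>x s. (q x * indicator {-R..R} x) * (g s * indicator {x..R} s)"
  have rep: "f x * q x = f R * (q x * indicator {-R..R} x) - (LINT s|lborel. ?k x s)" for x
  proof (cases "x \<in> {-R..R}")
    case True
    have "(LINT s|lborel. g s * indicator {x..R} s) = f R - f x"
      using prim[of x R] True by (simp add: set_lebesgue_integral_def mult.commute)
    moreover have "(LINT s|lborel. ?k x s)
        = (q x * indicator {-R..R} x) * (LINT s|lborel. g s * indicator {x..R} s)"
      by (rule integral_mult_right_zero)
    ultimately have "(LINT s|lborel. ?k x s) = q x * (f R - f x)" using True by simp
    then show ?thesis using True by (simp only:) (simp add: algebra_simps)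
  next
    case False
    then show ?thesis using ind(2)[of x] by simp
  qed
  have k_swap: "(LINT x|lborel. LINT s|lborel. ?k x s) = (LINT s|lborel. LINT x|lborel. ?k x s)"
  proof (rule Fubini_product_bound)
    show "integrable lborel (\<lambda>x. \<bar>q x * indicator {-R..R} x\<bar>)" "integrable lborel (\<lambda>s. \<bar>g s * indicator {-R..R} s\<bar>)"
      using q_int g_int by auto
    show "\<bar>?k x s\<bar> \<le> \<bar>q x * indicator {-R..R} x\<bar> * \<bar>g s * indicator {-R..R} s\<bar>" for x s
      by (auto simp: abs_mult indicator_def)
    have "(\<lambda>(x, s). (q x * indicator {-R..R} x) * (g s * (if x \<le> s \<and> s \<le> R then 1 else 0)))
        \<in> borel_measurable (lborel \<Otimes>\<^sub>M lborel)" by measurable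
    then show "(\<lambda>(x, s). ?k x s) \<in> borel_measurable (lborel \<Otimes>\<^sub>M lborel)"
      by (simp add: indicator_def cong: if_cong)
  qed
  have inner: "(LINT x|lborel. ?k x s) = g s * p s" for s
  proof (cases "s \<in> {-R..R}")
    case True
    have "(LINT x|lborel. ?k x s) = (LINT x|lborel. g s * (q x * indicator {-R..s} x))"
      using True by (intro Bochner_Integration.integral_cong) (auto simp: indicator_def)
    then show ?thesis using FTC[of s] True by simp
  next
    case False
    have "?k x s = 0" for x using False by (auto simp: indicator_def)
    then have "(LINT x|lborel. ?k x s) = (LINT x|(lborel :: real measure). 0)"
      by (rule Bochner_Integration.integral_cong[OF refl])
    then show ?thesis using False ind(1)[of s] by simp
  qed
  \<comment> \<open>By \<open>rep\<close> this reduces to integrability of f q, which holds because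
    f is continuous on \<open>{-R..R}\<close> as an indefinite integral.\<close>
  have k_int: "integrable lborel (\<lambda>x. LINT s|lborel. ?k x s)"
  proof -
    have fc: "continuous_on {-R..R} f"
    proof -
      have gi: "g integrable_on {-R..R}" "\<And>x. x \<in> {-R..R} \<Longrightarrow> integral {-R..x} g = f x - f (-R)"
        using set_borel_integral_eq_integral[OF L2_fun_set_integrable[OF g]] prim by auto
      have "continuous_on {-R..R} (\<lambda>x. f (-R) + integral {-R..x} g)"
        by (intro continuous_intros indefinite_integral_continuous_1 gi)
      then show ?thesis by (rule continuous_on_eq) (simp add: gi)
    qed
    have "integrable lborel (\<lambda>x. f x * q x * indicator {-R..R} x)"
      using borel_integrable_atLeastAtMost'[OF continuous_on_mult[OF fc continuous_on_subset[OF q_cont]]]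
      by (simp add: set_integrable_def mult.commute)
    then have fq: "integrable lborel (\<lambda>x. f x * q x)" by (simp add: mult.assoc ind(2)[symmetric])
    have "(\<lambda>x. LINT s|lborel. ?k x s) = (\<lambda>x. f R * (q x * indicator {-R..R} x) - f x * q x)"
      by (rule ext) (simp add: rep)
    then show ?thesis using fq q_int by simp
  qed
  have "(LINT x|lborel. f x * q x)
      = (LINT x|lborel. f R * (q x * indicator {-R..R} x)) - (LINT x|lborel. LINT s|lborel. ?k x s)"
    unfolding rep using q_int k_int by (intro Bochner_Integration.integral_diff) auto
  also have "(LINT x|lborel. f R * (q x * indicator {-R..R} x)) = 0"
    using FTC[of R] p0[of R] by (simp add: R_def)
  finally show "(LINT x|lborel. f x * deriv p x) = - (LINT x|lborel. g x * p x)"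
    unfolding k_swap inner by (simp add: q_def)
qed

text \<open>The averages of f - g over \<open>{x..x + k}\<close> all vanish, and they converge to f
  x - g x for almost every x.\<close>

lemma AE_eq_if_interval_integrals_eq:
  fixes f g :: "real \<Rightarrow> real"
  assumes f: "\<And>a b. set_integrable lborel {a..b} f" and g: "\<And>a b. set_integrable lborel {a..b} g"
    and eq: "\<And>a b. a \<le> b \<Longrightarrow> (LINT x:{a..b}|lborel. f x) = (LINT x:{a..b}|lborel. g x)"
  shows "AE x in lborel. f x = g x"
proof -
  let ?d = "\<lambda>x. f x - g x"
  have i: "set_integrable lborel {a..b} ?d" for a b using f g by (rule set_integral_diff)
  have zero: "integral {a..b} ?d = 0" if "a \<le> b" for a b
    using set_borel_integral_eq_integral(2)[OF i] set_integral_diff(2)[OF f g] eq[OF that]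
    by (metis diff_self)
  have int: "?d integrable_on cbox a b" for a b
    using set_borel_integral_eq_integral(1)[OF i] by simp
  obtain N where N: "negligible N"
    "\<And>x e. \<lbrakk>x \<notin> N; 0 < e\<rbrakk> \<Longrightarrow> \<exists>d>0. \<forall>k. 0 < k \<and> k < d \<longrightarrow>
        norm (integral (cbox x (x + k *\<^sub>R One)) ?d /\<^sub>R k ^ DIM(real) - ?d x) < e"
    by (rule integrable_ccontinuous_explicit[of ?d, OF int]) (rule that, assumption, blast)
  have "f x = g x" if "x \<notin> N" for x
  proof (rule ccontr)
    assume "f x \<noteq> g x"
    then obtain d where d: "d > 0" "\<And>k. 0 < k \<and> k < d \<Longrightarrow>
        norm (integral (cbox x (x + k *\<^sub>R One)) ?d /\<^sub>R k ^ DIM(real) - ?d x) < \<bar>f x - g x\<bar>"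
      using N(2)[OF \<open>x \<notin> N\<close>, of "\<bar>f x - g x\<bar>"] by auto
    from d(2)[of "d/2"] d(1) zero[of x "x + d/2"] show False by simp
  qed
  moreover have "AE x in lebesgue. x \<notin> N"
    using N(1) by (simp add: AE_not_in negligible_iff_null_sets)
  then have "AE x in lborel. x \<notin> N" by (simp add: AE_completion_iff)
  ultimately show ?thesis by (auto elim!: eventually_mono)
qed

lemma space_X_primitive:
  assumes "f \<in> space_X" "a \<le> b"
  shows "f b - f a = (LINT x:{a..b}|lborel. Dx f x)"
  using assms L2_fun_Dx[OF assms(1)]
  by (intro distributional_derivative_imp_primitive) (auto simp: space_X_def)

text \<open>Membership in the space is read off from increments; the second claim pins down the
  unspecified representative \<open>Dx f\<close> up to a null set.\<close>

lemma space_XI: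
  fixes f g :: "real \<Rightarrow> real"
  assumes "bounded (range f)" and g: "L2_fun g"
    and prim: "\<And>a b. a \<le> b \<Longrightarrow> f b - f a = (LINT x:{a..b}|lborel. g x)"
  shows "f \<in> space_X" "AE x in lborel. Dx f x = g x"
proof -
  have "continuous_on {a..b} f" for a b
  proof (cases "a \<le> b")
    case True
    have gi: "g integrable_on {a..b}" "\<And>x. x \<in> {a..b} \<Longrightarrow> integral {a..x} g = f x - f a"
      using set_borel_integral_eq_integral[OF L2_fun_set_integrable[OF g]] prim by auto
    have "continuous_on {a..b} (\<lambda>x. f a + integral {a..x} g)"
      by (intro continuous_intros indefinite_integral_continuous_1 gi)
    then show ?thesis by (rule continuous_on_eq) (simp add: gi)
  qed simp
  then have "isCont f x" for x
    by (rule continuous_on_interior[of "{x - 1..x + 1}"]) simp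
  then have cont: "continuous_on UNIV f" by (simp add: continuous_at_imp_continuous_on)
  then have "f \<in> borel_measurable borel" by (rule borel_measurable_continuous_onI)
  from primitive_imp_distributional_derivative[OF this g prim]
  show X: "f \<in> space_X" using cont assms(1) g by (auto simp: space_X_def)
  show "AE x in lborel. Dx f x = g x"
  proof (rule AE_eq_if_interval_integrals_eq)
    fix a b :: real assume "a \<le> b"
    then show "(LINT x:{a..b}|lborel. Dx f x) = (LINT x:{a..b}|lborel. g x)"
      using space_X_primitive[OF X] prim by metis
  qed (intro L2_fun_set_integrable L2_fun_Dx(1) X g)+
qed

subsection \<open>The trajectory\<close>

text \<open>Indicator that a characteristic with initial slope \<alpha> is unbroken at time s. For s
  > 0 the condition says \<alpha> > -2/s, and at s = 0 it always holds, which absorbs the case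
  distinction in \<open>source\<close>.\<close>

definition alive :: "real \<Rightarrow> real \<Rightarrow> real" where
  "alive \<alpha> s = (if 0 < 1 + s * \<alpha> / 2 then 1 else 0)"

lemma alive_measurable [measurable]:
  assumes [measurable]: "f \<in> borel_measurable M" "g \<in> borel_measurable M"
  shows "(\<lambda>x. alive (f x) (g x)) \<in> borel_measurable M"
  unfolding alive_def by measurable

text \<open>The density \<open>(1 + ta/2)\<^sub>+\<^sup>2\<close> of the characteristics solves \<open>x'' = a\<^sup>2/2\<close> up to the
  breaking time \<open>-2/a\<close>, at which both the density and its velocity vanish.\<close>

lemma breaking_time:
  assumes "0 \<le> t"
  obtains r where "0 \<le> r" "r \<le> t"
    "AE s in lborel. indicator {0..t} s * alive a s = indicator {0..r} s"
    "a\<^sup>2 / 2 * (t * r - r\<^sup>2 / 2) = (max 0 (1 + t * a / 2))\<^sup>2 - 1 - t * a"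
    "a\<^sup>2 / 2 * r = a * max 0 (1 + t * a / 2) - a"
proof (cases "0 < 1 + t * a / 2")
  case True
  have "alive a s = 1" if "s \<in> {0..t}" for s
  proof -
    have "0 < 1 + s * a / 2"
    proof (cases "0 \<le> a")
      case False
      then have "t * a \<le> s * a" using that by (intro mult_right_mono_neg) auto
      then show ?thesis using True by simp
    qed (use that in \<open>simp add: add_pos_nonneg\<close>)
    then show ?thesis by (simp add: alive_def)
  qed
  then have "AE s in lborel. indicator {0..t} s * alive a s = indicator {0..t} s"
    by (intro AE_I2) (auto simp: indicator_def)
  moreover have "a\<^sup>2 / 2 * (t * t - t\<^sup>2 / 2) = (max 0 (1 + t * a / 2))\<^sup>2 - 1 - t * a"
    "a\<^sup>2 / 2 * t = a * max 0 (1 + t * a / 2) - a"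
    using True by (simp_all add: max_def power2_eq_square field_simps)
  ultimately show ?thesis using that[of t] assms by simp
next
  case False
  then have "t * a < 0" by simp
  then have neg: "a < 0" using assms by (simp add: mult_less_0_iff)
  define r where "r = - 2 / a"
  have r: "0 < r" "r \<le> t" using neg False by (auto simp: r_def field_simps)
  have "alive a s = (if s < r then 1 else 0)" for s
    using neg by (auto simp: alive_def r_def field_simps)
  moreover have "AE s in lborel. s \<noteq> r" by (rule AE_lborel_singleton)
  ultimately have "AE s in lborel. indicator {0..t} s * alive a s = indicator {0..r} s"
    using r by (auto elim!: eventually_mono simp: indicator_def)
  moreover have "a\<^sup>2 / 2 * (t * r - r\<^sup>2 / 2) = (max 0 (1 + t * a / 2))\<^sup>2 - 1 - t * a"
    "a\<^sup>2 / 2 * r = a * max 0 (1 + t * a / 2) - a"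
    using False neg by (simp_all add: max_def r_def power2_eq_square field_simps)
  ultimately show ?thesis using that[of r] r by simp
qed

lemma integral_affine_Icc:
  fixes p q r :: real
  assumes "0 \<le> r"
  shows "(LINT s|lborel. (p - q * s) * indicator {0..r} s) = p * r - q * r\<^sup>2 / 2"
proof -
  have "(LINT s|lborel. (p - q * s) * indicator {0..r} s)
      = (p * r - q * r\<^sup>2 / 2) - (p * 0 - q * 0\<^sup>2 / 2)"
    using assms by (intro integral_FTC_Icc_real) (auto intro!: derivative_eq_intros continuous_intros)
  then show ?thesis by simp
qed

lemma breaking_integrals:
  assumes "0 \<le> t"
  shows "a\<^sup>2 / 2 * (LINT s|lborel. indicator {0..t} s * alive a s * (t - s))
      = (max 0 (1 + t * a / 2))\<^sup>2 - 1 - t * a"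
    and "a\<^sup>2 / 2 * (LINT s|lborel. indicator {0..t} s * alive a s * 1)
      = a * max 0 (1 + t * a / 2) - a"
proof -
  obtain r where r: "0 \<le> r" "r \<le> t"
    "AE s in lborel. indicator {0..t} s * alive a s = indicator {0..r} s"
    "a\<^sup>2 / 2 * (t * r - r\<^sup>2 / 2) = (max 0 (1 + t * a / 2))\<^sup>2 - 1 - t * a"
    "a\<^sup>2 / 2 * r = a * max 0 (1 + t * a / 2) - a"
    using breaking_time[OF assms, of a] by blast
  \<comment> \<open>Both weights are affine in s: (p, q) = (t, 1) gives the one for positions, (1,
    0) the one for velocities.\<close>
  have "(LINT s|lborel. indicator {0..t} s * alive a s * (p - q * s)) = p * r - q * r\<^sup>2 / 2" for p q
  proof -
    have "(LINT s|lborel. indicator {0..t} s * alive a s * (p - q * s))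
        = (LINT s|lborel. (p - q * s) * indicator {0..r} s)"
      by (rule integral_cong_AE; measurable?) (use r(3) in eventually_elim, simp)
    then show ?thesis using integral_affine_Icc[OF r(1)] by simp
  qed
  from this[of t 1] this[of 1 0] r(4,5) show
    "a\<^sup>2 / 2 * (LINT s|lborel. indicator {0..t} s * alive a s * (t - s))
      = (max 0 (1 + t * a / 2))\<^sup>2 - 1 - t * a"
    "a\<^sup>2 / 2 * (LINT s|lborel. indicator {0..t} s * alive a s * 1)
      = a * max 0 (1 + t * a / 2) - a" by simp_all
qed

context transport_map
begin

lemma change_of_variables_lebesgue:
  fixes f :: "real \<Rightarrow> real"
  assumes [measurable]: "f \<in> borel_measurable borel"
  shows "(LINT y|lborel. f y) = (LINT x|lborel. h x * f (F x))"
proof -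
  have "(LINT y|lborel. f y) = (LINT y|distr (density lborel h) borel F. f y)"
    by (simp add: distr)
  also have "\<dots> = (LINT x|lborel. h x * f (F x))"
    by (subst integral_distr) (simp_all add: integral_density density_nonneg)
  finally show ?thesis .
qed

end

section \<open>Characteristics of a datum\<close>

locale initial_datum =
  fixes ubar :: "real \<Rightarrow> real"
  assumes datum: "ubar \<in> space_X"
begin

abbreviation slope :: "real \<Rightarrow> real" where
  "slope \<equiv> Dx ubar"

definition energy :: real where
  "energy = (LINT x|lborel. (slope x)\<^sup>2)"

text \<open>Its square is the density of the characteristics, and slope / stretch, as long as the
  denominator is positive, is the solution of w' = -w^2/2 that starts from the slope.\<close>

definition stretch :: "real \<Rightarrow> real \<Rightarrow> real" where
  "stretch t y = max 0 (1 + t * slope y / 2)"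

definition src :: "real \<Rightarrow> real \<Rightarrow> real" where
  "src s y = 1/4 * (LINT x|lborel. sgn (y - x) * ((slope x)\<^sup>2 * alive (slope x) s))"

definition velocity :: "real \<Rightarrow> real \<Rightarrow> real" where
  "velocity t y = ubar y + (LINT s:{0..t}|lborel. source ubar s y)"

abbreviation \<xi> :: "real \<Rightarrow> real \<Rightarrow> real" where
  "\<xi> \<equiv> characteristic ubar"

lemma slope_measurable [measurable]: "slope \<in> borel_measurable borel"
  by (rule measurable_Dx[OF datum])

lemma ubar_measurable [measurable]: "ubar \<in> borel_measurable borel"
  by (rule measurable_space_X[OF datum])

lemma stretch_measurable [measurable]: "stretch t \<in> borel_measurable borel"
  unfolding stretch_def by measurable

lemma stretch_nonneg: "0 \<le> stretch t y"
  by (simp add: stretch_def)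

lemma slope_square_integrable: "integrable lborel (\<lambda>x. (slope x)\<^sup>2)"
  by (rule integrable_Dx_square[OF datum])

lemma energy_nonneg: "0 \<le> energy"
  unfolding energy_def by (intro integral_nonneg_AE) auto

lemma slope_set_integrable: "set_integrable lborel {a..b} slope"
  by (rule L2_fun_set_integrable[OF L2_fun_Dx(1)[OF datum]])

lemma source_eq_src: "0 \<le> s \<Longrightarrow> source ubar s y = src s y"
proof (cases "s = 0")
  case True
  then show ?thesis by (simp add: source_def src_def alive_def)
next
  case False
  moreover assume "0 \<le> s"
  ultimately have "indicator {x. slope x > - 2 / s} x = alive (slope x) s" for x
    by (auto simp: alive_def indicator_def field_simps)
  then show ?thesis using False
    by (simp add: source_def src_def set_lebesgue_integral_def ac_simps)
qed

lemma src_integrand_integrable: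
  "integrable lborel (\<lambda>x. sgn (y - x) * ((slope x)\<^sup>2 * alive (slope x) s))"
  using slope_square_integrable
  by (rule Bochner_Integration.integrable_bound) (auto simp: abs_mult sgn_if alive_def)

lemma src_measurable [measurable]: "(\<lambda>s. src s y) \<in> borel_measurable borel"
  unfolding src_def by measurable

lemma abs_src_le: "\<bar>src s y\<bar> \<le> energy / 4"
proof -
  have "\<bar>LINT x|lborel. sgn (y - x) * ((slope x)\<^sup>2 * alive (slope x) s)\<bar> \<le> energy"
    unfolding energy_def
    by (rule integral_abs_bound_integral[OF src_integrand_integrable slope_square_integrable])
      (auto simp: abs_mult sgn_if alive_def)
  then show ?thesis by (simp add: src_def abs_mult)
qed

text \<open>The difference of the two signs is 2 between y1 and y2 and 0 outside, which turns the
  factor 1/4 into 1/2.\<close>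

lemma src_diff:
  assumes "y1 \<le> y2"
  shows "src s y2 - src s y1 = (LINT x|lborel. indicator {y1..y2} x * ((slope x)\<^sup>2 / 2) * alive (slope x) s)"
proof -
  have "src s y2 - src s y1 = 1/4 * (LINT x|lborel. sgn (y2 - x) * ((slope x)\<^sup>2 * alive (slope x) s)
      - sgn (y1 - x) * ((slope x)\<^sup>2 * alive (slope x) s))"
    unfolding src_def
    by (subst Bochner_Integration.integral_diff[OF src_integrand_integrable src_integrand_integrable]) simp
  also have "\<dots> = (LINT x|lborel. 1/4 * (sgn (y2 - x) * ((slope x)\<^sup>2 * alive (slope x) s)
      - sgn (y1 - x) * ((slope x)\<^sup>2 * alive (slope x) s)))"
    by (rule integral_mult_right_zero[symmetric])
  also have "\<dots> = (LINT x|lborel. indicator {y1..y2} x * ((slope x)\<^sup>2 / 2) * alive (slope x) s)"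
  proof (rule integral_cong_AE)
    have "AE x in lborel. x \<noteq> y1 \<and> x \<noteq> y2" by (intro AE_conjI AE_lborel_singleton)
    then show "AE x in lborel. 1/4 * (sgn (y2 - x) * ((slope x)\<^sup>2 * alive (slope x) s)
      - sgn (y1 - x) * ((slope x)\<^sup>2 * alive (slope x) s)) = indicator {y1..y2} x * ((slope x)\<^sup>2 / 2) * alive (slope x) s"
      by eventually_elim (use assms in \<open>auto simp: indicator_def sgn_if\<close>)
  qed measurable
  finally show ?thesis .
qed

lemma weighted_src_integrable:
  assumes [measurable]: "w \<in> borel_measurable borel" and "\<And>s. s \<in> {0..t} \<Longrightarrow> \<bar>w s\<bar> \<le> W"
  shows "integrable lborel (\<lambda>s. indicator {0..t} s * (w s * src s y))"
proof (rule Bochner_Integration.integrable_bound)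
  show "integrable lborel (\<lambda>s. W * (energy / 4) * indicator {0..t} s :: real)"
    by (intro integrable_mult_right) simp
  show "AE s in lborel. norm (indicator {0..t} s * (w s * src s y)) \<le> norm (W * (energy / 4) * indicator {0..t} s :: real)"
  proof (rule AE_I2)
    fix s
    have "\<bar>w s\<bar> * \<bar>src s y\<bar> \<le> W * (energy / 4)" if "s \<in> {0..t}"
      using assms(2)[OF that] abs_src_le by (intro mult_mono) auto
    then have "\<bar>w s * src s y\<bar> \<le> \<bar>W * (energy / 4)\<bar>" if "s \<in> {0..t}"
      using that by (metis abs_mult abs_ge_self order_trans)
    then show "norm (indicator {0..t} s * (w s * src s y)) \<le> norm (W * (energy / 4) * indicator {0..t} s :: real)"
      by (cases "s \<in> {0..t}") simp_all
  qed
qed measurable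

abbreviation src_integral :: "(real \<Rightarrow> real) \<Rightarrow> real \<Rightarrow> real \<Rightarrow> real" where
  "src_integral w t y \<equiv> LINT s|lborel. indicator {0..t} s * (w s * src s y)"

text \<open>Fubini moves the time integral inside. For fixed x and the two weights in use it is one
  of the explicit integrals of \<open>breaking_integrals\<close>.\<close>

lemma weighted_src_diff:
  assumes [measurable]: "w \<in> borel_measurable borel" and w: "\<And>s. s \<in> {0..t} \<Longrightarrow> \<bar>w s\<bar> \<le> W"
    and "y1 \<le> y2"
  shows "src_integral w t y2 - src_integral w t y1
    = (LINT x|lborel. indicator {y1..y2} x *
        ((slope x)\<^sup>2 / 2 * (LINT s|lborel. indicator {0..t} s * alive (slope x) s * w s)))"
proof -
  let ?f = "\<lambda>s x. indicator {0..t} s * w s * (indicator {y1..y2} x * ((slope x)\<^sup>2 / 2) * alive (slope x) s)"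
  have "src_integral w t y2 - src_integral w t y1
    = (LINT s|lborel. indicator {0..t} s * (w s * src s y2) - indicator {0..t} s * (w s * src s y1))"
    by (rule Bochner_Integration.integral_diff[symmetric]; rule weighted_src_integrable[OF assms(1,2)])
  also have "\<dots> = (LINT s|lborel. LINT x|lborel. ?f s x)"
  proof (rule Bochner_Integration.integral_cong[OF refl])
    fix s
    have "(LINT x|lborel. ?f s x) = indicator {0..t} s * w s * (src s y2 - src s y1)"
      unfolding src_diff[OF assms(3)] by (rule integral_mult_right_zero)
    then show "indicator {0..t} s * (w s * src s y2) - indicator {0..t} s * (w s * src s y1) = (LINT x|lborel. ?f s x)"
      by (simp add: algebra_simps)
  qed
  also have "\<dots> = (LINT x|lborel. LINT s|lborel. ?f s x)"
  proof (rule Fubini_product_bound)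
    show "integrable lborel (\<lambda>s. W * indicator {0..t} s :: real)"
      by (intro integrable_mult_right) simp
    show "integrable lborel (\<lambda>x. (slope x)\<^sup>2)" by (rule slope_square_integrable)
    show "\<bar>?f s x\<bar> \<le> W * indicator {0..t} s * (slope x)\<^sup>2" for s x
    proof (cases "s \<in> {0..t}")
      case True
      have "\<bar>w s\<bar> * \<bar>indicator {y1..y2} x * ((slope x)\<^sup>2 / 2) * alive (slope x) s\<bar> \<le> W * (slope x)\<^sup>2"
        using w[OF True] by (intro mult_mono) (auto simp: indicator_def alive_def)
      then show ?thesis using True by (simp add: abs_mult)
    qed simp
  qed measurable
  also have "\<dots> = (LINT x|lborel. indicator {y1..y2} x *
        ((slope x)\<^sup>2 / 2 * (LINT s|lborel. indicator {0..t} s * alive (slope x) s * w s)))"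
  proof (rule Bochner_Integration.integral_cong[OF refl])
    fix x
    have "(LINT s|lborel. ?f s x)
        = (LINT s|lborel. (indicator {y1..y2} x * ((slope x)\<^sup>2 / 2)) * (indicator {0..t} s * alive (slope x) s * w s))"
      by (rule Bochner_Integration.integral_cong[OF refl]) (simp only: ac_simps)
    also have "\<dots> = indicator {y1..y2} x * ((slope x)\<^sup>2 / 2) * (LINT s|lborel. indicator {0..t} s * alive (slope x) s * w s)"
      by (rule integral_mult_right_zero)
    finally show "(LINT s|lborel. ?f s x) = indicator {y1..y2} x *
        ((slope x)\<^sup>2 / 2 * (LINT s|lborel. indicator {0..t} s * alive (slope x) s * w s))"
      by (simp only: mult.assoc)
  qed
  finally show ?thesis .
qed

lemma characteristic_eq:
  "\<xi> t y = y + t * ubar y + src_integral (\<lambda>s. t - s) t y"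
proof -
  have "(LINT s:{0..t}|lborel. (t - s) * source ubar s y) = src_integral (\<lambda>s. t - s) t y"
    unfolding set_lebesgue_integral_def
    by (intro Bochner_Integration.integral_cong) (auto simp: indicator_def source_eq_src)
  then show ?thesis by (simp add: characteristic_def)
qed

lemma velocity_eq: "velocity t y = ubar y + src_integral (\<lambda>s. 1) t y"
proof -
  have "(LINT s:{0..t}|lborel. source ubar s y) = src_integral (\<lambda>s. 1) t y"
    unfolding set_lebesgue_integral_def
    by (intro Bochner_Integration.integral_cong) (auto simp: indicator_def source_eq_src)
  then show ?thesis by (simp add: velocity_def)
qed

lemma abs_weighted_src_le:
  assumes [measurable]: "w \<in> borel_measurable borel" and w: "\<And>s. s \<in> {0..t} \<Longrightarrow> \<bar>w s\<bar> \<le> W"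
    and "0 \<le> t"
  shows "\<bar>src_integral w t y\<bar> \<le> t * W * (energy / 4)"
proof -
  have "\<bar>src_integral w t y\<bar> \<le> (LINT s|lborel. W * (energy / 4) * indicator {0..t} s)"
  proof (rule integral_abs_bound_integral)
    show "integrable lborel (\<lambda>s. W * (energy / 4) * indicator {0..t} s :: real)"
      by (intro integrable_mult_right) simp
    fix s
    have "\<bar>w s\<bar> * \<bar>src s y\<bar> \<le> W * (energy / 4)" if "s \<in> {0..t}"
      using w[OF that] abs_src_le by (intro mult_mono) auto
    then show "\<bar>indicator {0..t} s * (w s * src s y)\<bar> \<le> W * (energy / 4) * indicator {0..t} s"
      by (auto simp: indicator_def abs_mult)
  qed (rule weighted_src_integrable[OF assms(1,2)])
  also have "\<dots> = t * W * (energy / 4)" using assms(3) by simp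
  finally show ?thesis .
qed

lemma ubar_bounded: obtains B where "0 \<le> B" "\<And>y. \<bar>ubar y\<bar> \<le> B"
proof -
  obtain B where "\<And>y. \<bar>ubar y\<bar> \<le> B"
    using datum by (auto simp: space_X_def bounded_iff)
  moreover from this[of 0] have "0 \<le> B" by (rule order_trans[OF abs_ge_zero])
  ultimately show ?thesis using that by blast
qed

lemma abs_velocity_minus_datum_le: "0 \<le> t \<Longrightarrow> \<bar>velocity t y - ubar y\<bar> \<le> t * (energy / 4)"
  using abs_weighted_src_le[of "\<lambda>_. 1" t 1 y] by (simp add: velocity_eq)

lemma abs_characteristic_minus_id_le:
  assumes "0 \<le> t" "\<And>y. \<bar>ubar y\<bar> \<le> B"
  shows "\<bar>\<xi> t y - y\<bar> \<le> t * B + t * t * (energy / 4)"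
proof -
  have "\<bar>t * ubar y\<bar> \<le> t * B" using assms by (simp add: abs_mult mult_left_mono)
  moreover have "\<bar>src_integral (\<lambda>s. t - s) t y\<bar> \<le> t * t * (energy / 4)"
    using assms(1) by (intro abs_weighted_src_le) auto
  ultimately show ?thesis unfolding characteristic_eq by linarith
qed

lemma stretch_square_set_integrable: "set_integrable lborel {a..b} (\<lambda>x. (stretch t x)\<^sup>2)"
  unfolding set_integrable_def
proof (rule Bochner_Integration.integrable_bound)
  show "integrable lborel (\<lambda>x. 2 * indicator {a..b} x + t\<^sup>2 * (slope x)\<^sup>2)"
    using slope_square_integrable
    by (intro Bochner_Integration.integrable_add integrable_mult_right)
      simp_all
  \<comment> \<open>From (1 + z)^2 \<le> 2 + 2 z^2 with z = t slope / 2.\<close>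
  have "(stretch t x)\<^sup>2 \<le> 2 + t\<^sup>2 * (slope x)\<^sup>2" for x
  proof -
    have "(stretch t x)\<^sup>2 \<le> (1 + t * slope x / 2)\<^sup>2" by (auto simp: stretch_def max_def)
    also have "\<dots> \<le> 2 + t\<^sup>2 * (slope x)\<^sup>2 / 2"
      using zero_le_power2[of "1 - t * slope x / 2"] by (simp add: power2_eq_square algebra_simps)
    finally have "(stretch t x)\<^sup>2 \<le> 2 + t\<^sup>2 * (slope x)\<^sup>2 / 2" .
    moreover have "0 \<le> t\<^sup>2 * (slope x)\<^sup>2" by simp
    ultimately show ?thesis by linarith
  qed
  then show "AE x in lborel. norm (indicator {a..b} x *\<^sub>R (stretch t x)\<^sup>2)
      \<le> norm (2 * indicator {a..b} x + t\<^sup>2 * (slope x)\<^sup>2)"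
    by (intro AE_I2) (auto simp: indicator_def)
qed measurable

lemma slope_stretch_set_integrable: "set_integrable lborel {a..b} (\<lambda>x. slope x * stretch t x)"
  unfolding set_integrable_def
proof (rule Bochner_Integration.integrable_bound)
  show "integrable lborel (\<lambda>x. (slope x)\<^sup>2 + indicator {a..b} x *\<^sub>R (stretch t x)\<^sup>2)"
    using slope_square_integrable stretch_square_set_integrable
    by (intro Bochner_Integration.integrable_add) (simp_all add: set_integrable_def)
  have "\<bar>slope x * stretch t x\<bar> \<le> (slope x)\<^sup>2 + (stretch t x)\<^sup>2" for x
  proof -
    have "2 * (\<bar>slope x\<bar> * \<bar>stretch t x\<bar>) \<le> (slope x)\<^sup>2 + (stretch t x)\<^sup>2"
      using zero_le_power2[of "\<bar>slope x\<bar> - \<bar>stretch t x\<bar>"] by (simp add: power2_diff)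
    moreover have "0 \<le> \<bar>slope x\<bar> * \<bar>stretch t x\<bar>" by simp
    ultimately show ?thesis unfolding abs_mult by linarith
  qed
  then show "AE x in lborel. norm (indicator {a..b} x *\<^sub>R (slope x * stretch t x))
      \<le> norm ((slope x)\<^sup>2 + indicator {a..b} x *\<^sub>R (stretch t x)\<^sup>2)"
    by (intro AE_I2) (auto simp: indicator_def)
qed measurable

text \<open>The part y + t ubar contributes the integral of 1 + t slope, and the source adds exactly
  that of stretch^2 - 1 - t slope.\<close>

lemma characteristic_diff:
  assumes "0 \<le> t" "y1 \<le> y2"
  shows "\<xi> t y2 - \<xi> t y1 = (LINT x:{y1..y2}|lborel. (stretch t x)\<^sup>2)"
proof -
  have one: "set_integrable lborel {y1..y2} (\<lambda>_. 1::real)"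
    by (simp add: set_integrable_def)
  have ts: "set_integrable lborel {y1..y2} (\<lambda>x. t * slope x)"
    by (rule set_integrable_mult_right) (rule slope_set_integrable)
  have "src_integral (\<lambda>s. t - s) t y2 - src_integral (\<lambda>s. t - s) t y1
    = (LINT x|lborel. indicator {y1..y2} x *
        ((slope x)\<^sup>2 / 2 * (LINT s|lborel. indicator {0..t} s * alive (slope x) s * (t - s))))"
    using assms by (intro weighted_src_diff[where W = t]) auto
  also have "\<dots> = (LINT x:{y1..y2}|lborel. (stretch t x)\<^sup>2 - 1 - t * slope x)"
    by (simp only: set_lebesgue_integral_def breaking_integrals[OF assms(1)] stretch_def real_scaleR_def)
  also have "\<dots> = (LINT x:{y1..y2}|lborel. (stretch t x)\<^sup>2) - (y2 - y1) - t * (LINT x:{y1..y2}|lborel. slope x)"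
    using assms(2) one ts stretch_square_set_integrable[of y1 y2 t]
    by (simp add: set_integral_diff set_integral_mult_right set_lebesgue_integral_def[of _ _ "\<lambda>_. 1"])
  finally show ?thesis
    using space_X_primitive[OF datum assms(2)] by (simp add: characteristic_eq algebra_simps)
qed

lemma velocity_diff:
  assumes "0 \<le> t" "y1 \<le> y2"
  shows "velocity t y2 - velocity t y1 = (LINT x:{y1..y2}|lborel. slope x * stretch t x)"
proof -
  have "src_integral (\<lambda>s. 1) t y2 - src_integral (\<lambda>s. 1) t y1
    = (LINT x|lborel. indicator {y1..y2} x *
        ((slope x)\<^sup>2 / 2 * (LINT s|lborel. indicator {0..t} s * alive (slope x) s * 1)))"
    using assms by (intro weighted_src_diff[where W = 1]) auto
  also have "\<dots> = (LINT x:{y1..y2}|lborel. slope x * stretch t x - slope x)"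
    by (simp only: set_lebesgue_integral_def breaking_integrals[OF assms(1)] stretch_def real_scaleR_def)
  also have "\<dots> = (LINT x:{y1..y2}|lborel. slope x * stretch t x) - (LINT x:{y1..y2}|lborel. slope x)"
    using slope_set_integrable slope_stretch_set_integrable by (simp add: set_integral_diff)
  finally show ?thesis
    using space_X_primitive[OF datum assms(2)] by (simp add: velocity_eq algebra_simps)
qed

text \<open>The bounded datum and the bounded source keep the characteristics at bounded distance
  from the identity, whence they are onto.\<close>

lemma characteristic_transport_map:
  assumes "0 \<le> t"
  shows "transport_map (\<xi> t) (\<lambda>y. (stretch t y)\<^sup>2)"
proof -
  obtain B where "0 \<le> B" and B: "\<And>y. \<bar>ubar y\<bar> \<le> B" by (rule ubar_bounded) (rule that)
  have nonneg: "0 \<le> (LINT x:{y1..y2}|lborel. (stretch t x)\<^sup>2)" for y1 y2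
    unfolding set_lebesgue_integral_def by (intro integral_nonneg_AE) auto
  show ?thesis
  proof (rule transport_mapI_near_identity[OF _ _ _ _ abs_characteristic_minus_id_le[OF assms B]])
    show "mono (\<xi> t)"
      using characteristic_diff[OF assms] nonneg by (intro monoI) (metis diff_ge_0_iff_ge)
    fix y1 y2 :: real assume "y1 \<le> y2"
    have "nnint_on {y1..y2} (\<lambda>x. (stretch t x)\<^sup>2)
        = nnint (\<lambda>x. indicator {y1..y2} x *\<^sub>R (stretch t x)\<^sup>2)"
      by (intro nn_integral_cong) (auto simp: indicator_def)
    also have "\<dots> = ennreal (LINT x|lborel. indicator {y1..y2} x *\<^sub>R (stretch t x)\<^sup>2)"
      using stretch_square_set_integrable unfolding set_integrable_def
      by (intro nn_integral_eq_integral) auto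
    finally show "nnint_on {y1..y2} (\<lambda>x. (stretch t x)\<^sup>2) = ennreal (\<xi> t y2 - \<xi> t y1)"
      using characteristic_diff[OF assms \<open>y1 \<le> y2\<close>] by (simp add: set_lebesgue_integral_def)
  qed auto
qed

text \<open>Characteristics that meet enclose an interval on which stretch is 0 a.e.; the velocity
  takes the same value at both of its ends, so the description by \<open>THE\<close> is
  unambiguous.\<close>

lemma trajectory_characteristic:
  assumes "0 \<le> t"
  shows "trajectory ubar t (\<xi> t y) = velocity t y"
proof -
  interpret transport_map "\<xi> t" "\<lambda>y. (stretch t y)\<^sup>2" by (rule characteristic_transport_map[OF assms])
  have le: "velocity t y1 = velocity t y2" if "\<xi> t y1 = \<xi> t y2" "y1 \<le> y2" for y1 y2
  proof -
    have "AE x in lborel. indicator {y1..y2} x *\<^sub>R (slope x * stretch t x) = 0"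
      using flat[OF that] by eventually_elim (auto simp: indicator_def)
    then have "(LINT x:{y1..y2}|lborel. slope x * stretch t x) = 0"
      unfolding set_lebesgue_integral_def by (rule integral_eq_zero_AE)
    then show ?thesis using velocity_diff[OF assms that(2)] by simp
  qed
  have eq: "velocity t y1 = velocity t y2" if "\<xi> t y1 = \<xi> t y2" for y1 y2
  proof (cases "y1 \<le> y2")
    case False
    then show ?thesis using le[OF that[symmetric]] by simp
  qed (rule le[OF that])
  show ?thesis
    unfolding trajectory_def velocity_def[symmetric]
  proof (rule the_equality)
    show "\<exists>z. \<xi> t z = \<xi> t y \<and> velocity t y = velocity t z" by blast
    show "w = velocity t y" if "\<exists>z. \<xi> t z = \<xi> t y \<and> w = velocity t z" for w
      using that eq by blast
  qed
qed

text \<open>Candidate for the derivative of the trajectory: the carried slope, read at the leftmost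
  characteristic through x. The quotient is 0 where stretch is 0.\<close>

definition slope_at :: "real \<Rightarrow> real \<Rightarrow> real" where
  "slope_at t x = slope (rinv (\<xi> t) x) / stretch t (rinv (\<xi> t) x)"

lemma rinv_characteristic_AE:
  "0 \<le> t \<Longrightarrow> AE y in lborel. stretch t y = 0 \<or> rinv (\<xi> t) (\<xi> t y) = y"
  using transport_map.rinv_map_AE[OF characteristic_transport_map] by simp

lemma slope_at_measurable: "0 \<le> t \<Longrightarrow> slope_at t \<in> borel_measurable borel"
proof -
  assume "0 \<le> t"
  then have [measurable]: "rinv (\<xi> t) \<in> borel_measurable borel"
    by (rule transport_map.rinv_measurable[OF characteristic_transport_map])
  show ?thesis unfolding slope_at_def by measurable
qed

text \<open>The density stretch^2 cancels the denominator, which leaves slope^2 on the unbroken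
  characteristics and 0 on the broken ones.\<close>

lemma nn_integral_slope_at_le:
  assumes "0 \<le> t"
  shows "nnint (\<lambda>x. (slope_at t x)\<^sup>2) \<le> ennreal energy"
proof -
  interpret transport_map "\<xi> t" "\<lambda>y. (stretch t y)\<^sup>2" by (rule characteristic_transport_map[OF assms])
  note [measurable] = slope_at_measurable[OF assms]
  have "nnint (\<lambda>x. (slope_at t x)\<^sup>2)
      = (\<integral>\<^sup>+y. ennreal ((slope_at t (\<xi> t y))\<^sup>2) * ennreal ((stretch t y)\<^sup>2) \<partial>lborel)"
    by (rule change_of_variables[symmetric]) measurable
  also have "\<dots> \<le> nnint (\<lambda>y. (slope y)\<^sup>2)"
  proof (rule nn_integral_mono_AE, use rinv_characteristic_AE[OF assms] in eventually_elim)
    case (elim y)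
    then show ?case
      by (cases "stretch t y = 0") (simp_all add: slope_at_def power_divide ennreal_mult[symmetric])
  qed
  also have "\<dots> = ennreal energy"
    unfolding energy_def using slope_square_integrable by (intro nn_integral_eq_integral) auto
  finally show ?thesis .
qed

lemma L2_fun_slope_at: "0 \<le> t \<Longrightarrow> L2_fun (slope_at t)"
  unfolding L2_fun_def
proof
  assume t: "0 \<le> t"
  show [measurable]: "slope_at t \<in> borel_measurable borel" by (rule slope_at_measurable[OF t])
  show "integrable lborel (\<lambda>x. (slope_at t x)\<^sup>2)"
    using nn_integral_slope_at_le[OF t] le_less_trans
    by (intro integrableI_bounded) (auto simp: less_top[symmetric] top_unique)
qed

text \<open>After the substitution x = \<xi> t y the integrand times its density is slope * stretch,
  and the integral of this is the increment of the velocity.\<close>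

lemma trajectory_primitive:
  assumes "0 \<le> t" "x1 \<le> x2"
  shows "trajectory ubar t x2 - trajectory ubar t x1 = (LINT x:{x1..x2}|lborel. slope_at t x)"
proof -
  interpret transport_map "\<xi> t" "\<lambda>y. (stretch t y)\<^sup>2" by (rule characteristic_transport_map[OF assms(1)])
  note [measurable] = slope_at_measurable[OF assms(1)]
  define y1 where "y1 = rinv (\<xi> t) x1"
  define y2 where "y2 = rinv (\<xi> t) x2"
  have x: "\<xi> t y1 = x1" "\<xi> t y2 = x2" by (simp_all add: y1_def y2_def)
  have rmono: "rinv (\<xi> t) a \<le> rinv (\<xi> t) b \<longleftrightarrow> a \<le> b" for a b
    using rinv_strict_mono[of a b] rinv_strict_mono[of b a] by (cases a b rule: linorder_cases) auto
  have "y1 \<le> y2" using assms(2) by (simp add: y1_def y2_def rmono)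
  have "(LINT x:{x1..x2}|lborel. slope_at t x)
      = (LINT y|lborel. (stretch t y)\<^sup>2 * (indicator {x1..x2} (\<xi> t y) *\<^sub>R slope_at t (\<xi> t y)))"
    unfolding set_lebesgue_integral_def by (rule change_of_variables_lebesgue) measurable
  also have "\<dots> = (LINT y:{y1..y2}|lborel. slope y * stretch t y)"
    unfolding set_lebesgue_integral_def
  proof (rule integral_cong_AE)
    show "AE y in lborel. (stretch t y)\<^sup>2 * (indicator {x1..x2} (\<xi> t y) *\<^sub>R slope_at t (\<xi> t y))
        = indicator {y1..y2} y *\<^sub>R (slope y * stretch t y)"
      using rinv_characteristic_AE[OF assms(1)]
    proof eventually_elim
      case (elim y)
      show ?case
      proof (cases "stretch t y = 0")
        case False
        then have r: "rinv (\<xi> t) (\<xi> t y) = y" using elim by simp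
        have "\<xi> t y \<in> {x1..x2} \<longleftrightarrow> y \<in> {y1..y2}"
          using rmono[of x1 "\<xi> t y"] rmono[of "\<xi> t y" x2] r by (simp add: y1_def y2_def)
        then show ?thesis using False
          by (simp add: indicator_def slope_at_def r power2_eq_square del: atLeastAtMost_iff)
      qed simp
    qed
  qed measurable
  finally show ?thesis
    using velocity_diff[OF assms(1) \<open>y1 \<le> y2\<close>] trajectory_characteristic[OF assms(1), of y1]
      trajectory_characteristic[OF assms(1), of y2] by (simp add: x)
qed

lemma abs_trajectory_le:
  assumes "0 \<le> t" "\<And>y. \<bar>ubar y\<bar> \<le> B"
  shows "\<bar>trajectory ubar t x\<bar> \<le> B + t * (energy / 4)"
proof -
  interpret transport_map "\<xi> t" "\<lambda>y. (stretch t y)\<^sup>2" by (rule characteristic_transport_map[OF assms(1)])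
  let ?y = "rinv (\<xi> t) x"
  have "trajectory ubar t x = velocity t ?y" using trajectory_characteristic[OF assms(1), of ?y] by simp
  then show ?thesis
    using abs_velocity_minus_datum_le[OF assms(1), of ?y] assms(2)[of ?y] by linarith
qed

lemma trajectory_space_X:
  assumes "0 \<le> t"
  shows "trajectory ubar t \<in> space_X" "AE x in lborel. Dx (trajectory ubar t) x = slope_at t x"
proof -
  obtain B where "0 \<le> B" and B: "\<And>y. \<bar>ubar y\<bar> \<le> B" by (rule ubar_bounded) (rule that)
  have bdd: "bounded (range (trajectory ubar t))"
    using abs_trajectory_le[OF assms B] by (auto simp: bounded_iff)
  note * = bdd L2_fun_slope_at[OF assms] trajectory_primitive[OF assms]
  show "trajectory ubar t \<in> space_X" by (rule space_XI(1)[OF *])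
  show "AE x in lborel. Dx (trajectory ubar t) x = slope_at t x" by (rule space_XI(2)[OF *])
qed

lemma Dx_trajectory_characteristic:
  assumes "0 \<le> t"
  shows "AE y in lborel. stretch t y = 0 \<or> Dx (trajectory ubar t) (\<xi> t y) = slope y / stretch t y"
  using rinv_characteristic_AE[OF assms]
    transport_map.AE_map[OF characteristic_transport_map[OF assms] trajectory_space_X(2)[OF assms]]
  by eventually_elim (auto simp: slope_at_def)

lemma energy_trajectory_le:
  assumes "0 \<le> t"
  shows "(LINT x|lborel. (Dx (trajectory ubar t) x)\<^sup>2) \<le> energy"
proof -
  have "ennreal (LINT x|lborel. (Dx (trajectory ubar t) x)\<^sup>2)
      = nnint (\<lambda>x. (Dx (trajectory ubar t) x)\<^sup>2)"
    using integrable_Dx_square[OF trajectory_space_X(1)[OF assms]]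
    by (intro nn_integral_eq_integral[symmetric]) auto
  also have "\<dots> = nnint (\<lambda>x. (slope_at t x)\<^sup>2)"
    using trajectory_space_X(2)[OF assms] by (intro nn_integral_cong_AE, eventually_elim) simp
  also have "\<dots> \<le> ennreal energy" by (rule nn_integral_slope_at_le[OF assms])
  finally show ?thesis using energy_nonneg by simp
qed

section \<open>Cost of following the characteristics from time 0\<close>

lemma stretch_eq_0_iff: "stretch t y = 0 \<longleftrightarrow> 1 + t * slope y / 2 \<le> 0"
  by (auto simp: stretch_def max_def)

text \<open>Along w' = -w^2/2 the arctangent moves with speed (w^2/2) / (1 + w^2), which is at most
  1/2 however large w becomes.\<close>

lemma arctan_slope_diff_le:
  assumes "0 \<le> t" "stretch t y \<noteq> 0"
  shows "\<bar>arctan (slope y) - arctan (slope y / stretch t y)\<bar> \<le> t / 2"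
proof -
  define a where "a = slope y"
  have pos_t: "0 < 1 + t * a / 2" using assms(2) by (simp add: stretch_eq_0_iff a_def)
  have pos: "0 < 1 + r * a / 2" if "r \<in> {0..t}" for r
  proof (cases "0 \<le> a")
    case False
    then have "t * a \<le> r * a" using that by (intro mult_right_mono_neg) auto
    then show ?thesis using pos_t by simp
  qed (use that in \<open>simp add: add_pos_nonneg\<close>)
  let ?f = "\<lambda>r. arctan (a / (1 + r * a / 2))"
  let ?f' = "\<lambda>r. inverse (1 + (a / (1 + r * a / 2))\<^sup>2) * (- (a * (a / 2)) / ((1 + r * a / 2) * (1 + r * a / 2)))"
  have der: "(?f has_real_derivative ?f' r) (at r within {0..t})" if "r \<in> {0..t}" for r
    using pos[OF that] by (auto intro!: derivative_eq_intros)
  have bound: "norm (?f' r) \<le> 1 / 2" if "r \<in> {0..t}" for r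
  proof -
    define c where "c = 1 + r * a / 2"
    have "0 < c" using pos[OF that] by (simp add: c_def)
    then have "0 < c * c + a * a" by (simp add: add_pos_nonneg)
    have "?f' r = - (a * a / 2) / (c * c + a * a)"
      unfolding c_def[symmetric] using \<open>0 < c\<close> \<open>0 < c * c + a * a\<close>
      by (simp add: power2_eq_square divide_simps)
    then have "norm (?f' r) = (a * a / 2) / (c * c + a * a)"
      using \<open>0 < c * c + a * a\<close> by simp
    also have "\<dots> \<le> 1 / 2" using \<open>0 < c * c + a * a\<close> by (simp add: divide_simps)
    finally show ?thesis .
  qed
  have "norm (?f t - ?f 0) \<le> 1 / 2 * norm (t - 0)"
    by (rule field_differentiable_bound[where S = "{0..t}" and f' = ?f'])
      (use der bound assms(1) in auto)
  moreover have "stretch t y = 1 + t * a / 2" using pos_t by (simp add: stretch_def a_def)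
  ultimately show ?thesis using assms(1) by (simp add: a_def[symmetric] abs_minus_commute)
qed

text \<open>Being broken at time t means slope \<le> -2/t. With z = -1/slope, which is at most t/2,
  the angle \<pi>/2 + arctan slope equals arctan z, and this is at most z.\<close>

lemma arctan_broken_slope_le:
  assumes "0 \<le> t" "stretch t y = 0"
  shows "\<bar>pi / 2 + arctan (slope y)\<bar> \<le> t / 2"
proof -
  have le: "1 + t * slope y / 2 \<le> 0" using assms(2) by (simp add: stretch_eq_0_iff)
  then have "t * slope y < 0" by simp
  then have neg: "slope y < 0" using assms(1) by (simp add: mult_less_0_iff)
  define z where "z = - 1 / slope y"
  have "0 < z" using neg by (simp add: z_def)
  have "z \<le> t / 2" using le neg by (simp add: z_def field_simps)
  have "arctan (slope y) = - arctan (1 / z)" by (simp add: z_def arctan_minus[symmetric])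
  also have "arctan (1 / z) = pi / 2 - arctan z" using arctan_inverse[of z] \<open>0 < z\<close>
    by (simp add: inverse_eq_divide)
  finally have "pi / 2 + arctan (slope y) = arctan z" by simp
  moreover have "0 \<le> arctan z" "arctan z \<le> z"
    using \<open>0 < z\<close> arctan_le_self by auto
  ultimately show ?thesis using \<open>z \<le> t / 2\<close> by simp
qed

text \<open>Unbroken energy is moved along the characteristics and accounts for all energy at time
  t, so the weight at the destination is 1 and the third cost term vanishes. Broken energy is
  dropped at the start.\<close>

lemma J_datum_trajectory_le:
  assumes "0 \<le> t" "0 \<le> \<kappa>" "\<And>y. \<bar>ubar y\<bar> \<le> B"
  shows "J \<kappa> ubar (trajectory ubar t) \<le> ennreal (t * (B + t * (energy / 4) + energy / 4 + \<kappa> / 2) * energy)"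
proof -
  let ?u = "trajectory ubar t"
  \<comment> \<open>Per unit of time, the summands bound the displacement (B and t energy / 4), the
    change of the value (energy / 4) and that of the angle (\<kappa> / 2).\<close>
  let ?C = "t * (B + t * (energy / 4) + energy / 4 + \<kappa> / 2)"
  define \<phi> where "\<phi> = (indicator {y. stretch t y \<noteq> 0} :: real \<Rightarrow> real)"
  note T = characteristic_transport_map[OF assms(1)]
  interpret transport_map "\<xi> t" "\<lambda>y. (stretch t y)\<^sup>2" by (rule T)
  have B0: "0 \<le> B" using assms(3)[of 0] by simp
  have s: "unit_simple \<phi>" "unit_simple (\<lambda>_. 1)"
    unfolding \<phi>_def by (auto intro!: unit_simple_indicator unit_simple_const)
  note [measurable] = unit_simple_measurable[OF s(1)] trajectory_space_X(1)[OF assms(1), THEN measurable_Dx]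
    trajectory_space_X(1)[OF assms(1), THEN measurable_space_X]
  have adm: "admissible ubar ?u (\<xi> t) \<phi> (\<lambda>_. 1)"
  proof (rule admissibleI[OF s T], use Dx_trajectory_characteristic[OF assms(1)] in eventually_elim)
    case (elim y)
    then show ?case by (auto simp: \<phi>_def power_divide)
  qed
  have C: "\<kappa> * (t / 2) \<le> ?C"
    using assms B0 energy_nonneg by (simp add: algebra_simps)
  have moved: "aux_dist \<kappa> (graph_point ubar y) (graph_point ?u (\<xi> t y)) \<le> ?C"
    if y: "stretch t y \<noteq> 0" "Dx ?u (\<xi> t y) = slope y / stretch t y" for y
  proof -
    have "aux_dist \<kappa> (graph_point ubar y) (graph_point ?u (\<xi> t y))
        \<le> \<bar>y - \<xi> t y\<bar> + \<bar>ubar y - velocity t y\<bar> + \<kappa> * \<bar>arctan (slope y) - arctan (slope y / stretch t y)\<bar>"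
      unfolding graph_point_def aux_dist.simps y(2) trajectory_characteristic[OF assms(1)] by (rule min.cobounded1)
    also have "\<dots> \<le> (t * B + t * t * (energy / 4)) + t * (energy / 4) + \<kappa> * (t / 2)"
      using abs_characteristic_minus_id_le[OF assms(1,3), of y] abs_velocity_minus_datum_le[OF assms(1), of y]
        arctan_slope_diff_le[OF assms(1) y(1)] assms(2)
      by (intro add_mono mult_left_mono) (auto simp: abs_minus_commute)
    finally show ?thesis by (simp add: algebra_simps)
  qed
  have lost: "aux_dist \<kappa> (graph_point ubar y) Infinity \<le> ?C" if "stretch t y = 0" for y
    using mult_left_mono[OF arctan_broken_slope_le[OF assms(1) that] assms(2)] C
    by (simp add: graph_point_def)
  have "J \<kappa> ubar ?u \<le> cost \<kappa> ubar ?u (\<xi> t) \<phi> (\<lambda>_. 1)"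
    unfolding J_def using adm by (intro Inf_lower) auto
  also have "\<dots> = (\<integral>\<^sup>+y. ennreal (aux_dist \<kappa> (graph_point ubar y) (graph_point ?u (\<xi> t y)) * \<phi> y * (slope y)\<^sup>2)
      + ennreal (aux_dist \<kappa> (graph_point ubar y) Infinity * (1 - \<phi> y) * (slope y)\<^sup>2) \<partial>lborel)"
    unfolding cost_eq[OF T datum trajectory_space_X(1)[OF assms(1)] s]
    by (subst nn_integral_add) auto
  also have "\<dots> \<le> nnint (\<lambda>y. ?C * (slope y)\<^sup>2)"
  proof (rule nn_integral_mono_AE, use Dx_trajectory_characteristic[OF assms(1)] in eventually_elim)
    case (elim y)
    show ?case
    proof (cases "stretch t y = 0")
      case True
      then show ?thesis using mult_right_mono[OF lost[OF True], of "(slope y)\<^sup>2"]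
        by (simp add: \<phi>_def ennreal_leI)
    next
      case False
      then have "Dx ?u (\<xi> t y) = slope y / stretch t y" using elim by simp
      from mult_right_mono[OF moved[OF False this], of "(slope y)\<^sup>2"] False show ?thesis
        by (simp add: \<phi>_def ennreal_leI)
    qed
  qed
  also have "\<dots> = ennreal (LINT y|lborel. ?C * (slope y)\<^sup>2)"
    using slope_square_integrable assms B0 energy_nonneg
    by (intro nn_integral_eq_integral integrable_mult_right AE_I2 mult_nonneg_nonneg add_nonneg_nonneg) auto
  also have "(LINT y|lborel. ?C * (slope y)\<^sup>2) = ?C * energy"
    unfolding energy_def by (rule integral_mult_right_zero)
  finally show ?thesis .
qed

section \<open>The semigroup property\<close>

lemma alive_slope_eq_0:
  assumes "0 \<le> s" "0 \<le> q" "stretch s y = 0"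
  shows "alive (slope y) (s + q) = 0"
proof -
  have le: "1 + s * slope y / 2 \<le> 0" using assms(3) by (simp add: stretch_eq_0_iff)
  then have "s * slope y < 0" by simp
  then have "slope y < 0" using assms(1) by (simp add: mult_less_0_iff)
  then have "q * slope y \<le> 0" using assms(2) by (simp add: mult_nonneg_nonpos)
  then show ?thesis using le by (simp add: alive_def distrib_right add_divide_distrib)
qed

text \<open>1 + q (slope / stretch) / 2 is (1 + (s + q) slope / 2) divided by the positive stretch,
  so restarting with the carried slope does not change the instant of breaking.\<close>

lemma alive_slope_div_stretch:
  assumes "stretch s y \<noteq> 0"
  shows "alive (slope y / stretch s y) q = alive (slope y) (s + q)"
proof -
  have "0 < stretch s y" using assms stretch_nonneg[of s y] by simp
  moreover from this have "stretch s y = 1 + s * slope y / 2" by (auto simp: stretch_def max_def split: if_splits)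
  moreover have "0 < 1 + q * (slope y / stretch s y) / 2 \<longleftrightarrow> 0 < stretch s y + q * slope y / 2"
    using \<open>0 < stretch s y\<close> by (simp add: field_simps)
  moreover have "stretch s y + q * slope y / 2 = 1 + (s + q) * slope y / 2"
    using calculation(2) by (simp add: distrib_right add_divide_distrib)
  ultimately show ?thesis by (simp only: alive_def)
qed

text \<open>The substitution x = \<xi> s z cancels stretch^2 against the carried slopes. Points
  broken at time s contribute 0 on both sides, since they remain broken.\<close>

lemma src_trajectory:
  assumes "0 \<le> s" "0 \<le> q"
  shows "initial_datum.src (trajectory ubar s) q (\<xi> s y) = src (s + q) y"
proof -
  let ?u = "trajectory ubar s"
  interpret u: initial_datum ?u by unfold_locales (rule trajectory_space_X(1)[OF assms(1)])
  interpret transport_map "\<xi> s" "\<lambda>y. (stretch s y)\<^sup>2" by (rule characteristic_transport_map[OF assms(1)])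
  have "(LINT x|lborel. sgn (\<xi> s y - x) * ((Dx ?u x)\<^sup>2 * alive (Dx ?u x) q))
    = (LINT z|lborel. (stretch s z)\<^sup>2 * (sgn (\<xi> s y - \<xi> s z) * ((Dx ?u (\<xi> s z))\<^sup>2 * alive (Dx ?u (\<xi> s z)) q)))"
    by (rule change_of_variables_lebesgue) measurable
  also have "\<dots> = (LINT z|lborel. sgn (y - z) * ((slope z)\<^sup>2 * alive (slope z) (s + q)))"
  proof (rule integral_cong_AE)
    \<comment> \<open>An unbroken z on the level of y is, up to a null set, the leftmost point of
      that level. With this one point excluded, \<xi> s preserves the strict order and hence the
      sign.\<close>
    have "AE z in lborel. z \<noteq> rinv (\<xi> s) (\<xi> s y)" by (rule AE_lborel_singleton)
    then show "AE z in lborel. (stretch s z)\<^sup>2 * (sgn (\<xi> s y - \<xi> s z) * ((Dx ?u (\<xi> s z))\<^sup>2 * alive (Dx ?u (\<xi> s z)) q))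
        = sgn (y - z) * ((slope z)\<^sup>2 * alive (slope z) (s + q))"
      using rinv_characteristic_AE[OF assms(1)] Dx_trajectory_characteristic[OF assms(1)]
    proof eventually_elim
      case (elim z)
      show ?case
      proof (cases "stretch s z = 0")
        case True
        then show ?thesis using alive_slope_eq_0[OF assms] by simp
      next
        case False
        then have "\<xi> s z \<noteq> \<xi> s y" using elim by metis
        then have "sgn (\<xi> s y - \<xi> s z) = sgn (y - z)"
          using map_mono[of y z] map_mono[of z y] by (cases y z rule: linorder_cases) auto
        moreover have "Dx ?u (\<xi> s z) = slope z / stretch s z" using elim False by simp
        ultimately show ?thesis using False
          by (simp add: alive_slope_div_stretch power_divide)
      qed
    qed
  qed measurable
  finally show ?thesis by (simp add: u.src_def src_def)
qed

lemma integral_shift_Icc: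
  fixes f :: "real \<Rightarrow> real"
  shows "(LINT q|lborel. indicator {0..r} q * f (s + q)) = (LINT q|lborel. indicator {s..s + r} q * f q)"
  by (subst (2) lborel_integral_real_affine[where c = 1 and t = s])
    (auto intro!: Bochner_Integration.integral_cong simp: indicator_def)

lemma integral_split_src:
  assumes [measurable]: "w \<in> borel_measurable borel" "w' \<in> borel_measurable borel"
    and w: "\<And>q. q \<in> {0..s + r} \<Longrightarrow> \<bar>w q\<bar> \<le> W" and "0 \<le> s" "0 \<le> r"
    and ww': "\<And>q. w' q = w (s + q)"
  shows "src_integral w (s + r) y
    = src_integral w s y
      + (LINT q|lborel. indicator {0..r} q * (w' q * src (s + q) y))"
proof -
  have total: "integrable lborel (\<lambda>q. indicator {0..s + r} q * (w q * src q y))"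
    by (rule weighted_src_integrable[OF assms(1) w])
  have part: "integrable lborel (\<lambda>q. indicator {a..b} q * (w q * src q y))" if "0 \<le> a" "b \<le> s + r" for a b
    by (rule Bochner_Integration.integrable_bound[OF total])
      (use that in \<open>auto simp: indicator_def\<close>)
  have "src_integral w (s + r) y
    = (LINT q|lborel. indicator {0..s} q * (w q * src q y) + indicator {s..s + r} q * (w q * src q y))"
  proof (rule integral_cong_AE)
    have "AE q in lborel. q \<noteq> s" by (rule AE_lborel_singleton)
    then show "AE q in lborel. indicator {0..s + r} q * (w q * src q y)
        = indicator {0..s} q * (w q * src q y) + indicator {s..s + r} q * (w q * src q y)"
      by eventually_elim (use assms(4,5) in \<open>auto simp: indicator_def\<close>)
  qed measurable
  also have "\<dots> = src_integral w s y
      + (LINT q|lborel. indicator {s..s + r} q * (w q * src q y))"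
    using assms(4,5) by (intro Bochner_Integration.integral_add part) auto
  also have "(LINT q|lborel. indicator {s..s + r} q * (w q * src q y))
      = (LINT q|lborel. indicator {0..r} q * (w' q * src (s + q) y))"
    unfolding ww' by (rule integral_shift_Icc[symmetric])
  finally show ?thesis .
qed

text \<open>From \<xi> s y on, the restarted construction sees the same source as the original one
  after time s, so its characteristics and velocities continue the original ones; and every x is
  some \<xi> (s + r) y.\<close>

lemma trajectory_semigroup:
  assumes "0 \<le> s" "0 \<le> r"
  shows "trajectory (trajectory ubar s) r = trajectory ubar (s + r)"
proof
  fix x
  let ?u = "trajectory ubar s"
  interpret u: initial_datum ?u by unfold_locales (rule trajectory_space_X(1)[OF assms(1)])
  interpret transport_map "\<xi> (s + r)" "\<lambda>y. (stretch (s + r) y)\<^sup>2"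
    using assms by (intro characteristic_transport_map) simp
  define y where "y = rinv (\<xi> (s + r)) x"
  have x: "\<xi> (s + r) y = x" by (simp add: y_def)
  have later: "(LINT q|lborel. indicator {0..r} q * (w q * u.src q (\<xi> s y)))
      = (LINT q|lborel. indicator {0..r} q * (w q * src (s + q) y))" for w :: "real \<Rightarrow> real"
    by (intro Bochner_Integration.integral_cong) (auto simp: indicator_def src_trajectory[OF assms(1)])
  have vel: "u.velocity r (\<xi> s y) = velocity (s + r) y"
    using integral_split_src[of "\<lambda>_. 1" "\<lambda>_. 1" s r 1 y] assms
    unfolding u.velocity_eq later trajectory_characteristic[OF assms(1)] by (simp add: velocity_eq)
  have "src_integral (\<lambda>q. s + r - q) (s + r) y
    = src_integral (\<lambda>q. s + r - q) s y
      + (LINT q|lborel. indicator {0..r} q * ((r - q) * src (s + q) y))"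
    using assms by (intro integral_split_src[where W = "s + r"]) auto
  \<comment> \<open>On [0, s] the weight is (s - q) + r. The summand r, together with r ubar, gives
    r times the velocity at time s, the linear term of the restarted characteristic.\<close>
  also have "src_integral (\<lambda>q. s + r - q) s y
    = (LINT q|lborel. indicator {0..s} q * ((s - q) * src q y) + r * (indicator {0..s} q * (1 * src q y)))"
    by (intro Bochner_Integration.integral_cong) (auto simp: algebra_simps)
  also have "\<dots> = src_integral (\<lambda>q. s - q) s y
      + (LINT q|lborel. r * (indicator {0..s} q * (1 * src q y)))"
    by (intro Bochner_Integration.integral_add integrable_mult_right weighted_src_integrable[where W = "\<bar>s\<bar> + 1"]) auto
  also have "(LINT q|lborel. r * (indicator {0..s} q * (1 * src q y))) = r * src_integral (\<lambda>q. 1) s y"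
    by (rule integral_mult_right_zero)
  finally have "u.\<xi> r (\<xi> s y) = \<xi> (s + r) y"
    unfolding u.characteristic_eq later trajectory_characteristic[OF assms(1)]
    by (simp add: velocity_eq characteristic_eq algebra_simps)
  then have "trajectory ?u r x = u.velocity r (\<xi> s y)"
    using u.trajectory_characteristic[OF assms(2), of "\<xi> s y"] x by simp
  also have "\<dots> = trajectory ubar (s + r) x"
    using trajectory_characteristic[of "s + r" y] assms x vel by simp
  finally show "trajectory ?u r x = trajectory ubar (s + r) x" .
qed

lemma J_trajectory_lipschitz:
  assumes "0 \<le> \<kappa>" "0 \<le> T"
  obtains L where "0 \<le> L" "\<And>s t. s \<in> {0..T} \<Longrightarrow> t \<in> {0..T} \<Longrightarrow>
    J \<kappa> (trajectory ubar t) (trajectory ubar s) \<le> ennreal (L * \<bar>t - s\<bar>)"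
proof -
  obtain B where "0 \<le> B" and B: "\<And>y. \<bar>ubar y\<bar> \<le> B" by (rule ubar_bounded) (rule that)
  \<comment> \<open>Uniform on [0, T]: the sup norm is at most B + T energy / 4, the energy does not
    grow, and the elapsed time is at most T.\<close>
  define L where "L = ((B + T * (energy / 4)) + T * (energy / 4) + energy / 4 + \<kappa> / 2) * energy"
  have nonneg: "0 \<le> L"
    unfolding L_def using assms \<open>0 \<le> B\<close> energy_nonneg by (intro mult_nonneg_nonneg add_nonneg_nonneg) auto
  have forward: "J \<kappa> (trajectory ubar s) (trajectory ubar t) \<le> ennreal (L * (t - s))"
    if "0 \<le> s" "s \<le> t" "t \<le> T" for s t
  proof -
    let ?u = "trajectory ubar s"
    interpret u: initial_datum ?u by unfold_locales (rule trajectory_space_X(1)[OF that(1)])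
    have eu: "u.energy \<le> energy" unfolding u.energy_def by (rule energy_trajectory_le[OF that(1)])
    have Bu: "\<bar>?u y\<bar> \<le> B + T * (energy / 4)" for y
      using abs_trajectory_le[OF that(1) B, of y] mult_right_mono[of s T "energy / 4"] that energy_nonneg
      by linarith
    have "J \<kappa> ?u (trajectory ?u (t - s)) \<le> ennreal ((t - s) * ((B + T * (energy / 4))
        + (t - s) * (u.energy / 4) + u.energy / 4 + \<kappa> / 2) * u.energy)"
      using that by (intro u.J_datum_trajectory_le assms(1) Bu) auto
    also have "\<dots> \<le> ennreal ((t - s) * ((B + T * (energy / 4))
        + T * (energy / 4) + energy / 4 + \<kappa> / 2) * energy)"
      using that eu u.energy_nonneg assms \<open>0 \<le> B\<close>
      by (intro ennreal_leI mult_mono add_mono mult_nonneg_nonneg add_nonneg_nonneg order_refl) auto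
    finally show ?thesis
      using trajectory_semigroup[of s "t - s"] that by (simp add: L_def ac_simps)
  qed
  have "J \<kappa> (trajectory ubar t) (trajectory ubar s) \<le> ennreal (L * \<bar>t - s\<bar>)"
    if "s \<in> {0..T}" "t \<in> {0..T}" for s t
  proof (cases "s \<le> t")
    case True
    have "J \<kappa> (trajectory ubar t) (trajectory ubar s) \<le> J \<kappa> (trajectory ubar s) (trajectory ubar t)"
      using that by (intro J_reverse_le assms(1) trajectory_space_X(1)) auto
    then show ?thesis using forward[of s t] True that by auto
  next
    case False
    then show ?thesis using forward[of t s] that by auto
  qed
  then show ?thesis using that nonneg by blast
qed

end

section \<open>Finiteness and Lipschitz dependence on both arguments\<close>

lemma J_finite:
  assumes "0 \<le> \<kappa>" and X: "u \<in> space_X" "v \<in> space_X"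
  shows "J \<kappa> u v < \<infinity>"
proof -
  \<comment> \<open>Moving nothing is always admissible and costs at most \<kappa>\<pi> times the
    two energies.\<close>
  have s: "unit_simple (\<lambda>_. 0)" by (rule unit_simple_const) simp
  have adm: "admissible u v (\<lambda>x. x) (\<lambda>_. 0) (\<lambda>_. 0)"
    by (rule admissibleI[OF s s transport_map_id]) simp
  have fin: "nnint (\<lambda>x. aux_dist \<kappa> (graph_point f x) Infinity * (1 - 0) * (Dx f x)\<^sup>2) < \<infinity>"
    if "f \<in> space_X" for f
  proof -
    have "nnint (\<lambda>x. aux_dist \<kappa> (graph_point f x) Infinity * (1 - 0) * (Dx f x)\<^sup>2)
        \<le> nnint (\<lambda>x. \<kappa> * pi * (Dx f x)\<^sup>2)"
      using aux_dist_graph_Infinity_le[OF assms(1)]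
      by (intro nn_integral_mono ennreal_leI mult_right_mono) auto
    also have "\<dots> < \<infinity>"
      using integrable_Dx_square[OF that] assms(1)
      by (subst nn_integral_eq_integral) auto
    finally show ?thesis .
  qed
  have "J \<kappa> u v \<le> cost \<kappa> u v (\<lambda>x. x) (\<lambda>_. 0) (\<lambda>_. 0)"
    unfolding J_def using adm by (intro Inf_lower) auto
  also have "\<dots> < \<infinity>"
    unfolding cost_eq[OF transport_map_id X s s] using fin X by simp
  finally show ?thesis .
qed

text \<open>Two applications of the triangle inequality in each direction; each direction uses one
  of the given bounds as it stands and the other one reversed.\<close>

lemma abs_J_diff_le:
  assumes \<kappa>: "0 \<le> \<kappa>" and X: "u \<in> space_X" "u' \<in> space_X" "v \<in> space_X" "v' \<in> space_X"
    and le: "J \<kappa> u u' \<le> ennreal p" "J \<kappa> v v' \<le> ennreal q" and "0 \<le> p" "0 \<le> q"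
  shows "\<bar>enn2real (J \<kappa> u v) - enn2real (J \<kappa> u' v')\<bar> \<le> p + q"
proof -
  have one: "enn2real (J \<kappa> a b) \<le> enn2real (J \<kappa> a' b') + (p + q)"
    if Y: "a \<in> space_X" "a' \<in> space_X" "b \<in> space_X" "b' \<in> space_X"
      and l: "J \<kappa> a a' \<le> ennreal p" "J \<kappa> b' b \<le> ennreal q" for a a' b b'
  proof -
    have fin: "J \<kappa> a' b' = ennreal (enn2real (J \<kappa> a' b'))"
      using J_finite[OF \<kappa> Y(2,4)] by simp
    have "J \<kappa> a b \<le> J \<kappa> a a' + (J \<kappa> a' b' + J \<kappa> b' b)"
      using J_triangle[OF \<kappa> Y(1,2,3)] J_triangle[OF \<kappa> Y(2,4,3)] by (meson add_left_mono order_trans)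
    also have "\<dots> \<le> ennreal p + (ennreal (enn2real (J \<kappa> a' b')) + ennreal q)"
      using l fin by (intro add_mono) auto
    also have "\<dots> = ennreal (enn2real (J \<kappa> a' b') + (p + q))"
      using assms(8,9) by (simp add: ennreal_plus[symmetric] add.left_commute del: ennreal_plus)
    finally show ?thesis
      using assms(8,9) by (intro enn2real_leI) (auto intro: add_nonneg_nonneg)
  qed
  have rev: "J \<kappa> u' u \<le> ennreal p" "J \<kappa> v' v \<le> ennreal q"
    using J_reverse_le[OF \<kappa> X(1,2)] J_reverse_le[OF \<kappa> X(3,4)] le by (auto intro: order_trans)
  show ?thesis
    using one[OF X le(1) rev(2)] one[OF X(2,1,4,3) rev(1) le(2)] by linarith
qed

theorem theorem2:
  fixes M :: real
  assumes "M > 0"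
  shows "\<exists>K>0. \<forall>\<kappa>\<ge>K.
    (\<forall>ubar\<in>space_X. norm_L2 (Dx ubar) \<le> M \<longrightarrow>
       (\<forall>t\<ge>0. trajectory ubar t \<in> space_X) \<and>
       (\<forall>T>0. \<exists>L\<ge>0. \<forall>s\<in>{0..T}. \<forall>t\<in>{0..T}.
          J \<kappa> (trajectory ubar t) (trajectory ubar s) \<le> ennreal (L * \<bar>t - s\<bar>))) \<and>
    (\<forall>ubar\<in>space_X. \<forall>vbar\<in>space_X. norm_L2 (Dx ubar) \<le> M \<and> norm_L2 (Dx vbar) \<le> M \<longrightarrow>
       (\<forall>t\<ge>0. J \<kappa> (trajectory ubar t) (trajectory vbar t) < \<infinity>) \<and>
       (\<forall>T>0. \<exists>L. L-lipschitz_on {0..T}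
          (\<lambda>t. enn2real (J \<kappa> (trajectory ubar t) (trajectory vbar t)))))"
proof (rule exI[of _ 1], intro conjI ballI allI impI)
  show "(0::real) < 1" by simp
  fix \<kappa> :: real
  assume "1 \<le> \<kappa>"
  \<comment> \<open>The threshold 1 enters through nonnegativity of \<kappa>, which is what all the
    estimates ask of it.\<close>
  then have \<kappa>: "0 \<le> \<kappa>" by simp
  have in_X: "trajectory f t \<in> space_X" if "f \<in> space_X" "0 \<le> t" for f t
    using that by (intro initial_datum.trajectory_space_X(1)) unfold_locales
  have lip: "\<exists>L\<ge>0. \<forall>s\<in>{0..T}. \<forall>t\<in>{0..T}.
      J \<kappa> (trajectory f t) (trajectory f s) \<le> ennreal (L * \<bar>t - s\<bar>)" if "f \<in> space_X" "0 < T" for f T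
  proof -
    interpret initial_datum f by unfold_locales (rule that)
    show ?thesis using J_trajectory_lipschitz[OF \<kappa> less_imp_le[OF that(2)]] by metis
  qed
  fix ubar assume u: "ubar \<in> space_X"
  show "trajectory ubar t \<in> space_X" if "0 \<le> t" for t by (rule in_X[OF u that])
  show "\<exists>L\<ge>0. \<forall>s\<in>{0..T}. \<forall>t\<in>{0..T}.
      J \<kappa> (trajectory ubar t) (trajectory ubar s) \<le> ennreal (L * \<bar>t - s\<bar>)" if "0 < T" for T
    by (rule lip[OF u that])
  fix vbar assume v: "vbar \<in> space_X"
  show "J \<kappa> (trajectory ubar t) (trajectory vbar t) < \<infinity>" if "0 \<le> t" for t
    by (intro J_finite \<kappa> in_X u v that)
  show "\<exists>L. L-lipschitz_on {0..T} (\<lambda>t. enn2real (J \<kappa> (trajectory ubar t) (trajectory vbar t)))" if T: "0 < T" for T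
  proof -
    obtain Lu where Lu: "0 \<le> Lu" "\<forall>s\<in>{0..T}. \<forall>t\<in>{0..T}.
        J \<kappa> (trajectory ubar t) (trajectory ubar s) \<le> ennreal (Lu * \<bar>t - s\<bar>)"
      using lip[OF u T] by blast
    obtain Lv where Lv: "0 \<le> Lv" "\<forall>s\<in>{0..T}. \<forall>t\<in>{0..T}.
        J \<kappa> (trajectory vbar t) (trajectory vbar s) \<le> ennreal (Lv * \<bar>t - s\<bar>)"
      using lip[OF v T] by blast
    have "(Lu + Lv)-lipschitz_on {0..T} (\<lambda>t. enn2real (J \<kappa> (trajectory ubar t) (trajectory vbar t)))"
    proof (rule lipschitz_onI)
      fix t s assume ts: "t \<in> {0..T}" "s \<in> {0..T}"
      have "\<bar>enn2real (J \<kappa> (trajectory ubar t) (trajectory vbar t))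
          - enn2real (J \<kappa> (trajectory ubar s) (trajectory vbar s))\<bar> \<le> Lu * \<bar>t - s\<bar> + Lv * \<bar>t - s\<bar>"
        using ts Lu Lv by (intro abs_J_diff_le \<kappa> in_X u v) auto
      then show "dist (enn2real (J \<kappa> (trajectory ubar t) (trajectory vbar t)))
          (enn2real (J \<kappa> (trajectory ubar s) (trajectory vbar s))) \<le> (Lu + Lv) * dist t s"
        by (simp add: dist_real_def distrib_right)
    qed (use Lu Lv in simp)
    then show ?thesis by blast
  qed
qed

end
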